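(* Let $(n,l,r,d)$ be a tuple of positive integers with $r \le \min\{d,l\}$, and let $S=\mathbb{C}[x_0,\ldots,x_n]$. Say that a form $F\in S_d$ is $(l,r)$-presentable if there exist general linear forms $L_1,\ldots,L_l\in S_1$ and forms $M_\sigma\in S_{d-r}$, one for each $\sigma\subseteq\{1,\ldots,l\}$ with $|\sigma|=r$, such that $$F=\sum_{\sigma\subseteq\{1,\ldots,l\},\ |\sigma|=r} L_\sigma M_\sigma,\qquad \text{where } L_\sigma=\prod_{i\in\sigma}L_i .$$ Then: \begin{enumerate} \item If $l-r+1<n$ and $d\gg 0$, then the generic form of degree $d$ in $n+1$ variables is not $(l,r)$-presentable. \item If $l-r+1=n$, then the generic form of degree $d$ in $n+1$ variables is $(l,r)$-presentable if and only if $(n,l,r,d)$ belongs to the following list: \begin{enumerate} \item[(i)] $(1,l,l,d)$ for all $d\ge l\ge 1$; \item[(ii)] $(2,2,1,d)$ for all $d\ge 1$; \item[(iii)] $(2,3,2,d)$ for all $d\ge 2$; \item[(iv)] $(2,4,3,d)$ for all $d\ge 3$; \item[(v)] $(2,5,4,d)$ for all $d\ge 5$; \item[(vi)] $(n,n,1,d)$ for all $n\ge 3$ and $d\ge 1$; \item[(vii)] $(n,n+1,2,d)$ for all $n\ge 3$ and $d\ge 2$; \item[(viii)] $(n,n+2,3,d)$ for all $n\ge 3$ and $d\ge 3$. \end{enumerate} \item If $l-r+1>n$, then every form of degree $d$ in $n+1$ variables (not just the generic one) is $(l,r)$-presentable. \end{enumerate}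
   Context: $S_t$ denotes the $\mathbb{C}$-vector space of homogeneous polynomials (forms) of degree $t$ in $S=\mathbb{C}[x_0,\ldots,x_n]$ (with $0$ included). Linear forms $L_1,\ldots,L_l\in S_1$ are called general if any $n+1$ of them are linearly independent; if $l<n+1$, the requirement is instead that $L_1,\ldots,L_l$ are linearly independent. The forms $L_i$ and $M_\sigma$ in a presentation may depend on $F$. "The generic form of degree $d$ has property $P$" means that there is a nonempty Zariski open subset of $S_d$ all of whose elements have property $P$. The phrase "$d\gg 0$" means: for all $d\ge d_0$, where $d_0$ is some integer depending only on $n,l,r$. *)

theory Defs
  imports "HOL-Analysis.Analysis" "HOL-Library.Poly_Mapping"
begin

(* A monomial in variables of type 'v is its exponent vector; a polynomial maps each monomial to
   its coefficient.  The type of polynomials is a commutative ring by Poly_Mapping. *)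
type_synonym 'v monomial = "'v \<Rightarrow>\<^sub>0 nat"
type_synonym 'v cpoly = "'v monomial \<Rightarrow>\<^sub>0 complex"

definition monomial_degree :: "'v monomial \<Rightarrow> nat" where
  "monomial_degree m = (\<Sum>v\<in>Poly_Mapping.keys m. Poly_Mapping.lookup m v)"

definition eval_poly :: "('v \<Rightarrow> complex) \<Rightarrow> 'v cpoly \<Rightarrow> complex" where
  "eval_poly a p =
     (\<Sum>m\<in>Poly_Mapping.keys p. Poly_Mapping.lookup p m *
        (\<Prod>v\<in>Poly_Mapping.keys m. a v ^ Poly_Mapping.lookup m v))"

definition cpoly_scale :: "complex \<Rightarrow> 'v cpoly \<Rightarrow> 'v cpoly" where
  "cpoly_scale c p = Poly_Mapping.single 0 c * p"

interpretation cpoly: vector_space cpoly_scale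
  by unfold_locales
    (simp_all add: cpoly_scale_def algebra_simps single_add mult_single flip: mult.assoc)

(* S_t for S = C[x_0,...,x_n]; the variable x_i is the index i. *)
definition forms :: "nat \<Rightarrow> nat \<Rightarrow> nat cpoly set" where
  "forms n t = {F. \<forall>m\<in>Poly_Mapping.keys F. Poly_Mapping.keys m \<subseteq> {..n} \<and> monomial_degree m = t}"

(* Linear independence of a family; cpoly.independent alone would ignore repetitions. *)
definition independent_family :: "(nat \<Rightarrow> 'v cpoly) \<Rightarrow> nat set \<Rightarrow> bool" where
  "independent_family L I \<longleftrightarrow> inj_on L I \<and> cpoly.independent (L ` I)"

definition general_linear_forms :: "nat \<Rightarrow> nat \<Rightarrow> (nat \<Rightarrow> nat cpoly) \<Rightarrow> bool" where
  "general_linear_forms n l L \<longleftrightarrow>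
     (\<forall>i\<in>{1..l}. L i \<in> forms n 1) \<and>
     (if l < n + 1 then independent_family L {1..l}
      else \<forall>I. I \<subseteq> {1..l} \<and> card I = n + 1 \<longrightarrow> independent_family L I)"

definition presentable :: "nat \<Rightarrow> nat \<Rightarrow> nat \<Rightarrow> nat \<Rightarrow> nat cpoly \<Rightarrow> bool" where
  "presentable n l r d F \<longleftrightarrow>
     (\<exists>L M. general_linear_forms n l L \<and>
        (\<forall>\<sigma>. \<sigma> \<subseteq> {1..l} \<and> card \<sigma> = r \<longrightarrow> M \<sigma> \<in> forms n (d - r)) \<and>
        F = (\<Sum>\<sigma> | \<sigma> \<subseteq> {1..l} \<and> card \<sigma> = r. (\<Prod>i\<in>\<sigma>. L i) * M \<sigma>))"

(* The coordinates on the affine space S_d are the coefficients, so a polynomial function on S_d is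
   a polynomial g whose variables are monomials, evaluated at the coefficient function of F.
   Variables of g that are not monomials of degree d in x_0,...,x_n take the value 0 on S_d. *)
definition zariski_open :: "nat \<Rightarrow> nat \<Rightarrow> nat cpoly set \<Rightarrow> bool" where
  "zariski_open n d U \<longleftrightarrow>
     (\<exists>G :: nat monomial cpoly set.
        U = forms n d - {F \<in> forms n d. \<forall>g\<in>G. eval_poly (Poly_Mapping.lookup F) g = 0})"

definition generic_form :: "nat \<Rightarrow> nat \<Rightarrow> (nat cpoly \<Rightarrow> bool) \<Rightarrow> bool" where
  "generic_form n d P \<longleftrightarrow> (\<exists>U. zariski_open n d U \<and> U \<noteq> {} \<and> (\<forall>F\<in>U. P F))"

end

theory Submission
  imports Defs "HOL-Computational_Algebra.Fundamental_Theorem_Algebra"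
begin

text \<open>
  The products of \<open>r\<close> out of \<open>l\<close> general linear forms generate the ideal of the star configuration
  formed by the intersections of any \<open>l - r + 1\<close> of the hyperplanes.  If \<open>l - r + 1 > n\<close> it is empty
  and an induction on \<open>r\<close> shows that the products span all forms.

  If \<open>l - r + 1 = n\<close>, the differential of the map \<open>(L, M) \<mapsto> \<Sum> L\<^sub>\<sigma> M\<^sub>\<sigma>\<close> is surjective as soon as its
  values at the points of the configuration are; in the listed cases this is checked for the
  hyperplanes \<open>x\<^sub>0 + i x\<^sub>1 + \<dots> + i\<^sup>n x\<^sub>n\<close>, whose intersection points are the coefficient vectors of
  polynomials with prescribed roots.  A polynomial map with a surjective differential is algebraically
  independent, and then its image contains a nonempty Zariski open set: after inverting a polynomial
  the source is finite over the target, so a Nakayama argument and the Nullstellensatz give a point in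
  every fibre.

  Conversely, a polynomial map from fewer parameters is algebraically dependent by counting monomials,
  and the points of the configuration bound the number of parameters needed.  For Lueroth quartics,
  the tuple \<open>(2, 5, 4, 4)\<close>, the numbers of parameters agree, but the differential is singular because
  the five lines can move as tangents of a conic.
\<close>

section \<open>Polynomial functions\<close>

text \<open>The list in the case l - r + 1 = n comes from comparing two numbers. For l = n + s, the
  configuration has binom(n+s, n) points, and l hyperplanes up to scaling have n(n+s) parameters.
  The first number is at most the second exactly for n = 1, for s \<le> 2, and for n = 2, s = 3,
  where both are 10. In that borderline case nonconstant cofactors (d \<ge> 5) still give a
  surjective differential, constant ones (d = 4) do not. Algebraic independence stands in for
  dimension theory, and this needs a source with no more variables than the target. In the positive
  cases the presentations are therefore restricted to an affine slice with exactly dim S_d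
  parameters on which the differential is the identity; each parameter is then algebraic over the
  coefficients of the form. In the negative cases the cofactors carry too many parameters because of
  syzygies, so they are replaced by finitely many choices of a basis among the products. In these
  arguments polynomials are represented by the functions they define, which is faithful over the
  complex numbers.\<close>

inductive_set pfuns :: "'v set \<Rightarrow> (('v \<Rightarrow> complex) \<Rightarrow> complex) set" for V :: "'v set" where
  const: "(\<lambda>x. c) \<in> pfuns V"
| var: "v \<in> V \<Longrightarrow> (\<lambda>x. x v) \<in> pfuns V"
| add: "f \<in> pfuns V \<Longrightarrow> g \<in> pfuns V \<Longrightarrow> (\<lambda>x. f x + g x) \<in> pfuns V"
| mult: "f \<in> pfuns V \<Longrightarrow> g \<in> pfuns V \<Longrightarrow> (\<lambda>x. f x * g x) \<in> pfuns V"

lemma pfuns_uminus: "f \<in> pfuns V \<Longrightarrow> (\<lambda>x. - f x) \<in> pfuns V"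
  using pfuns.mult[OF pfuns.const[of "-1"]] by simp

lemma pfuns_diff: "f \<in> pfuns V \<Longrightarrow> g \<in> pfuns V \<Longrightarrow> (\<lambda>x. f x - g x) \<in> pfuns V"
  using pfuns.add[OF _ pfuns_uminus] by simp

lemma pfuns_power: "f \<in> pfuns V \<Longrightarrow> (\<lambda>x. f x ^ k) \<in> pfuns V"
  by (induction k) (auto intro: pfuns.intros)

lemma pfuns_sum: "(\<And>i. i \<in> I \<Longrightarrow> f i \<in> pfuns V) \<Longrightarrow> (\<lambda>x. \<Sum>i\<in>I. f i x) \<in> pfuns V"
  by (induction I rule: infinite_finite_induct) (auto intro: pfuns.intros)

lemma pfuns_prod: "(\<And>i. i \<in> I \<Longrightarrow> f i \<in> pfuns V) \<Longrightarrow> (\<lambda>x. \<Prod>i\<in>I. f i x) \<in> pfuns V"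
  by (induction I rule: infinite_finite_induct) (auto intro: pfuns.intros)

lemmas pfuns_intros =
  pfuns.intros pfuns_uminus pfuns_diff pfuns_power pfuns_sum pfuns_prod

lemma pfuns_cong: "f \<in> pfuns V \<Longrightarrow> (\<And>v. v \<in> V \<Longrightarrow> x v = y v) \<Longrightarrow> f x = f y"
  by (induction rule: pfuns.induct) auto

lemma pfuns_compose:
  assumes "f \<in> pfuns K" "\<And>k. k \<in> K \<Longrightarrow> \<phi> k \<in> pfuns V"
  shows "(\<lambda>x. f (\<lambda>k. \<phi> k x)) \<in> pfuns V"
  using assms by (induction rule: pfuns.induct) (auto intro: pfuns.intros)

lemma pfuns_line:
  assumes "f \<in> pfuns V"
  shows "\<exists>p. \<forall>s. f (\<lambda>v. a v + s * b v) = poly p s"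
  using assms
proof (induction rule: pfuns.induct)
  case (const c)
  show ?case by (rule exI[of _ "[:c:]"]) simp
next
  case (var v)
  show ?case by (rule exI[of _ "[:a v, b v:]"]) simp
next
  case (add f g)
  then obtain p q where "\<forall>s. f (\<lambda>v. a v + s * b v) = poly p s" "\<forall>s. g (\<lambda>v. a v + s * b v) = poly q s"
    by blast
  then show ?case by (intro exI[of _ "p + q"]) simp
next
  case (mult f g)
  then obtain p q where "\<forall>s. f (\<lambda>v. a v + s * b v) = poly p s" "\<forall>s. g (\<lambda>v. a v + s * b v) = poly q s"
    by blast
  then show ?case by (intro exI[of _ "p * q"]) simp
qed

text \<open>There are no zero divisors: on the line joining \<open>x\<close> and \<open>y\<close>
  both functions become nonzero polynomials in one variable.\<close>

lemma pfuns_mult_nonzero: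
  assumes f: "f \<in> pfuns V" "f x \<noteq> 0" and g: "g \<in> pfuns V" "g y \<noteq> 0"
  shows "\<exists>z. f z * g z \<noteq> 0"
proof -
  obtain p where p: "\<And>s. f (\<lambda>v. x v + s * (y v - x v)) = poly p s"
    using pfuns_line[OF f(1), of x "\<lambda>v. y v - x v"] by blast
  obtain q where q: "\<And>s. g (\<lambda>v. x v + s * (y v - x v)) = poly q s"
    using pfuns_line[OF g(1), of x "\<lambda>v. y v - x v"] by blast
  have "p \<noteq> 0" using p[of 0] f(2) by auto
  moreover have "q \<noteq> 0" using q[of 1] g(2) by auto
  ultimately have "p * q \<noteq> 0" by simp
  then obtain s where "poly (p * q) s \<noteq> 0"
    using poly_all_0_iff_0 by blast
  then show ?thesis
    using p[of s] q[of s] by (intro exI[of _ "\<lambda>v. x v + s * (y v - x v)"]) simp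
qed

lemma pfuns_prod_nonzero:
  assumes "finite I" "\<And>i. i \<in> I \<Longrightarrow> f i \<in> pfuns V" "\<And>i. i \<in> I \<Longrightarrow> \<exists>x. f i x \<noteq> 0"
  shows "\<exists>x. (\<Prod>i\<in>I. f i x) \<noteq> 0"
  using assms
proof (induction I)
  case (insert i I)
  then obtain x y where "f i x \<noteq> 0" "(\<Prod>i\<in>I. f i y) \<noteq> 0" by (metis insert_iff)
  then show ?case
    using pfuns_mult_nonzero[of "f i" V x "\<lambda>x. \<Prod>i\<in>I. f i x" y] insert by (auto intro!: pfuns_prod)
qed simp

section \<open>Independence of monomials and homogeneous linear systems\<close>

lemma sum_PiE_insert:
  assumes "w \<notin> V"
  shows "(\<Sum>e\<in>PiE (insert w V) S. g e) = (\<Sum>j\<in>S w. \<Sum>e\<in>PiE V S. g (e(w := j)))"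
  unfolding PiE_insert_eq
  by (subst sum.reindex) (use inj_combinator[OF assms] in \<open>auto simp: case_prod_unfold sum.cartesian_product\<close>)

text \<open>With the other variables fixed, the sum is a one-variable polynomial in
  \<open>x w\<close> with all values zero. So each of its coefficients \<open>d y j\<close> vanishes
  for every \<open>y\<close>, and the induction hypothesis applies to these.\<close>

lemma monomials_independent:
  fixes c :: "('v \<Rightarrow> nat) \<Rightarrow> complex"
  assumes "finite V" "\<And>x. (\<Sum>e\<in>PiE V (\<lambda>v. {..<B v}). c e * (\<Prod>v\<in>V. x v ^ e v)) = 0"
    and "e \<in> PiE V (\<lambda>v. {..<B v})"
  shows "c e = 0"
  using assms
proof (induction V arbitrary: c e rule: finite_induct)
  case (insert w V)
  define d where "d y j = (\<Sum>e\<in>PiE V (\<lambda>v. {..<B v}). c (e(w := j)) * (\<Prod>v\<in>V. y v ^ e v))" for y j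
  have eq: "(\<Sum>e\<in>PiE (insert w V) (\<lambda>v. {..<B v}). c e * (\<Prod>v\<in>insert w V. x v ^ e v))
      = (\<Sum>j<B w. d x j * x w ^ j)" for x
  proof -
    have "(\<Sum>e\<in>PiE (insert w V) (\<lambda>v. {..<B v}). c e * (\<Prod>v\<in>insert w V. x v ^ e v))
      = (\<Sum>j<B w. \<Sum>e\<in>PiE V (\<lambda>v. {..<B v}). c (e(w := j)) * (\<Prod>v\<in>insert w V. x v ^ (e(w := j)) v))"
      by (rule sum_PiE_insert[OF insert.hyps(2)])
    also have "\<dots> = (\<Sum>j<B w. \<Sum>e\<in>PiE V (\<lambda>v. {..<B v}). c (e(w := j)) * (\<Prod>v\<in>V. x v ^ e v) * x w ^ j)"
    proof (intro sum.cong refl)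
      fix j e
      have "(\<Prod>v\<in>V. x v ^ (e(w := j)) v) = (\<Prod>v\<in>V. x v ^ e v)"
        by (rule prod.cong) (use insert.hyps in auto)
      then show "c (e(w := j)) * (\<Prod>v\<in>insert w V. x v ^ (e(w := j)) v) =
          c (e(w := j)) * (\<Prod>v\<in>V. x v ^ e v) * x w ^ j"
        using insert.hyps by simp
    qed
    also have "\<dots> = (\<Sum>j<B w. d x j * x w ^ j)"
      unfolding d_def sum_distrib_right by simp
    finally show ?thesis .
  qed
  have d0: "d y j = 0" if "j < B w" for y j
  proof -
    define p where "p = (\<Sum>j<B w. monom (d y j) j)"
    have "poly p t = 0" for t
    proof -
      have upd: "d (y(w := t)) j = d y j" for j
        unfolding d_def by (intro sum.cong refl arg_cong2[where f="(*)"] prod.cong) (use insert.hyps in auto)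
      then show ?thesis
        using insert.prems(1)[of "y(w := t)"] unfolding eq upd p_def by (simp add: poly_sum poly_monom)
    qed
    then have "p = 0" using poly_all_0_iff_0 by blast
    then have "coeff p j = 0" by simp
    moreover have "coeff p j = d y j"
      using that by (simp add: p_def coeff_sum if_distrib sum.delta cong: if_cong)
    ultimately show ?thesis by simp
  qed
  have ew: "e w < B w" and er: "restrict e V \<in> PiE V (\<lambda>v. {..<B v})"
    using insert.prems(2) by (auto simp: PiE_iff)
  have "c ((restrict e V)(w := e w)) = 0"
    by (rule insert.IH[where c = "\<lambda>e'. c (e'(w := e w))", OF _ er])
       (use d0[OF ew] in \<open>simp add: d_def\<close>)
  moreover have "(restrict e V)(w := e w) = e"
    using insert.prems(2) by (auto simp: fun_eq_iff PiE_iff extensional_def)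
  ultimately show ?case by simp
qed simp

text \<open>Gaussian elimination: a pivot \<open>a k i0\<close> clears the column \<open>i0\<close>
  from the other equations, and equation \<open>k\<close> then determines the unknown
  \<open>i0\<close>.\<close>

lemma homogeneous_system_solution:
  fixes a :: "'j \<Rightarrow> 'i \<Rightarrow> 'a::field"
  assumes "finite J" "finite I" "card J < card I"
  shows "\<exists>c. (\<exists>i\<in>I. c i \<noteq> 0) \<and> (\<forall>j\<in>J. (\<Sum>i\<in>I. a j i * c i) = 0)"
  using assms
proof (induction J arbitrary: I a rule: finite_induct)
  case empty
  then have "I \<noteq> {}" by auto
  then show ?case by (intro exI[of _ "\<lambda>_. 1"]) auto
next
  case (insert k J)
  show ?case
  proof (cases "\<forall>i\<in>I. a k i = 0")
    case True
    then show ?thesis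
      using insert.IH[of I a] insert.prems insert.hyps by auto
  next
    case False
    then obtain i0 where i0: "i0 \<in> I" "a k i0 \<noteq> 0" by blast
    define b where "b j i = a j i - a j i0 / a k i0 * a k i" for j i
    obtain c where c: "\<exists>i\<in>I - {i0}. c i \<noteq> 0" "\<And>j. j \<in> J \<Longrightarrow> (\<Sum>i\<in>I - {i0}. b j i * c i) = 0"
    proof -
      have "card J < card (I - {i0})" using insert.prems insert.hyps i0 by simp
      then show thesis using insert.IH[of "I - {i0}" b] insert.prems(1) that by blast
    qed
    define c' where "c' = c(i0 := - (\<Sum>i\<in>I - {i0}. a k i * c i) / a k i0)"
    have split: "(\<Sum>i\<in>I. a j i * c' i) = a j i0 * c' i0 + (\<Sum>i\<in>I - {i0}. a j i * c i)" for j
      using insert.prems(1) i0(1) by (simp add: sum.remove[of I i0] c'_def)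
    have "(\<Sum>i\<in>I. a k i * c' i) = 0"
      unfolding split using i0 by (simp add: c'_def)
    moreover have "(\<Sum>i\<in>I. a j i * c' i) = 0" if "j \<in> J" for j
    proof -
      have "0 = (\<Sum>i\<in>I - {i0}. a j i * c i) - a j i0 / a k i0 * (\<Sum>i\<in>I - {i0}. a k i * c i)"
        using c(2)[OF that] by (simp add: b_def algebra_simps sum_subtractf sum_distrib_left)
      then show ?thesis
        unfolding split by (simp add: c'_def)
    qed
    moreover have "\<exists>i\<in>I. c' i \<noteq> 0" using c(1) by (auto simp: c'_def)
    ultimately show ?thesis by auto
  qed
qed

section \<open>Algebraic dependence by counting monomials\<close>

text \<open>The degree is bounded in each variable separately, so the monomials form a box with
  \<open>(d + 1) ^ card V\<close> elements.\<close>

definition bounded_degrees :: "'v set \<Rightarrow> nat \<Rightarrow> (('v \<Rightarrow> complex) \<Rightarrow> complex) set" where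
  "bounded_degrees V d = {f. \<exists>c. \<forall>x. f x = (\<Sum>e\<in>PiE V (\<lambda>_. {..d}). c e * (\<Prod>v\<in>V. x v ^ e v))}"

lemma bounded_degrees_zero: "(\<lambda>x. 0) \<in> bounded_degrees V d"
  unfolding bounded_degrees_def by (auto intro!: exI[of _ "\<lambda>_. 0"])

lemma bounded_degrees_add:
  assumes "f \<in> bounded_degrees V d" "g \<in> bounded_degrees V d"
  shows "(\<lambda>x. f x + g x) \<in> bounded_degrees V d"
proof -
  obtain b c where "\<And>x. f x = (\<Sum>e\<in>PiE V (\<lambda>_. {..d}). b e * (\<Prod>v\<in>V. x v ^ e v))"
    "\<And>x. g x = (\<Sum>e\<in>PiE V (\<lambda>_. {..d}). c e * (\<Prod>v\<in>V. x v ^ e v))"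
    using assms unfolding bounded_degrees_def by blast
  then show ?thesis
    unfolding bounded_degrees_def
    by (auto intro!: exI[of _ "\<lambda>e. b e + c e"] simp: sum.distrib algebra_simps)
qed

lemma bounded_degrees_sum:
  "(\<And>i. i \<in> I \<Longrightarrow> f i \<in> bounded_degrees V d) \<Longrightarrow> (\<lambda>x. \<Sum>i\<in>I. f i x) \<in> bounded_degrees V d"
  by (induction I rule: infinite_finite_induct) (auto intro: bounded_degrees_zero bounded_degrees_add)

lemma bounded_degrees_monomial:
  assumes "finite V" "\<And>v. v \<in> V \<Longrightarrow> e v \<le> d"
  shows "(\<lambda>x. a * (\<Prod>v\<in>V. x v ^ e v)) \<in> bounded_degrees V d"
proof -
  have e: "restrict e V \<in> PiE V (\<lambda>_. {..d})" using assms by auto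
  have "(\<Sum>e'\<in>PiE V (\<lambda>_. {..d}). (if e' = restrict e V then a else 0) * (\<Prod>v\<in>V. x v ^ e' v))
     = a * (\<Prod>v\<in>V. x v ^ e v)" for x
  proof -
    have "(\<Sum>e'\<in>PiE V (\<lambda>_. {..d}). (if e' = restrict e V then a else 0) * (\<Prod>v\<in>V. x v ^ e' v))
      = (\<Sum>e'\<in>PiE V (\<lambda>_. {..d}). if e' = restrict e V then a * (\<Prod>v\<in>V. x v ^ e' v) else 0)"
      by (intro sum.cong) auto
    also have "\<dots> = a * (\<Prod>v\<in>V. x v ^ restrict e V v)"
      using e assms(1) by (subst sum.delta) (auto intro: finite_PiE)
    finally show ?thesis by simp
  qed
  then show ?thesis
    unfolding bounded_degrees_def
    by (auto intro!: exI[of _ "\<lambda>e'. if e' = restrict e V then a else 0"])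
qed

lemma bounded_degrees_mult:
  assumes "finite V" "f \<in> bounded_degrees V d" "g \<in> bounded_degrees V d'"
  shows "(\<lambda>x. f x * g x) \<in> bounded_degrees V (d + d')"
proof -
  obtain b c where f: "\<And>x. f x = (\<Sum>e\<in>PiE V (\<lambda>_. {..d}). b e * (\<Prod>v\<in>V. x v ^ e v))"
    and g: "\<And>x. g x = (\<Sum>e\<in>PiE V (\<lambda>_. {..d'}). c e * (\<Prod>v\<in>V. x v ^ e v))"
    using assms unfolding bounded_degrees_def by blast
  have "(\<lambda>x. f x * g x) = (\<lambda>x. \<Sum>e\<in>PiE V (\<lambda>_. {..d}). \<Sum>e'\<in>PiE V (\<lambda>_. {..d'}).
      (b e * c e') * (\<Prod>v\<in>V. x v ^ (e v + e' v)))"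
    unfolding f g sum_product by (simp add: power_add prod.distrib algebra_simps)
  also have "\<dots> \<in> bounded_degrees V (d + d')"
    by (intro bounded_degrees_sum bounded_degrees_monomial assms(1)) (auto simp: PiE_iff intro: add_mono)
  finally show ?thesis .
qed

lemma bounded_degrees_mono:
  assumes "finite V" "f \<in> bounded_degrees V d" "d \<le> d'"
  shows "f \<in> bounded_degrees V d'"
proof -
  obtain b where f: "\<And>x. f x = (\<Sum>e\<in>PiE V (\<lambda>_. {..d}). b e * (\<Prod>v\<in>V. x v ^ e v))"
    using assms unfolding bounded_degrees_def by blast
  have "f = (\<lambda>x. \<Sum>e\<in>PiE V (\<lambda>_. {..d}). b e * (\<Prod>v\<in>V. x v ^ e v))"
    using f by auto
  also have "\<dots> \<in> bounded_degrees V d'"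
    by (intro bounded_degrees_sum bounded_degrees_monomial assms(1))
       (use assms(3) in \<open>auto simp: PiE_iff intro: order_trans\<close>)
  finally show ?thesis .
qed

lemma bounded_degrees_const: "finite V \<Longrightarrow> (\<lambda>x. c) \<in> bounded_degrees V d"
  using bounded_degrees_monomial[of V "\<lambda>_. 0" d c] by simp

lemma bounded_degrees_power:
  assumes "finite V" "f \<in> bounded_degrees V d"
  shows "(\<lambda>x. f x ^ k) \<in> bounded_degrees V (k * d)"
  using bounded_degrees_mult[OF assms(1) assms(2)]
  by (induction k) (auto intro: bounded_degrees_const assms)

lemma bounded_degrees_prod:
  assumes "finite V" "finite I" "\<And>i. i \<in> I \<Longrightarrow> f i \<in> bounded_degrees V d"
  shows "(\<lambda>x. \<Prod>i\<in>I. f i x) \<in> bounded_degrees V (card I * d)"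
  using assms(2,3)
  by (induction I) (auto intro: bounded_degrees_const bounded_degrees_mult assms(1))

lemma pfuns_bounded_degrees:
  assumes "finite V" "f \<in> pfuns V"
  shows "\<exists>d. f \<in> bounded_degrees V d"
  using assms(2)
proof (induction rule: pfuns.induct)
  case (const c)
  then show ?case using bounded_degrees_const[OF assms(1)] by blast
next
  case (var v)
  have "(\<lambda>x. 1 * (\<Prod>w\<in>V. x w ^ (if w = v then 1 else 0))) \<in> bounded_degrees V 1"
    by (rule bounded_degrees_monomial) (use assms in auto)
  moreover have "(\<Prod>w\<in>V. x w ^ (if w = v then 1 else 0)) = x v" for x :: "'a \<Rightarrow> complex"
    using assms(1) var by (simp add: if_distrib[where f="power _"] prod.delta cong: if_cong)
  ultimately show ?case by auto
next
  case (add f g)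
  then obtain d d' where "f \<in> bounded_degrees V d" "g \<in> bounded_degrees V d'" by blast
  then have "f \<in> bounded_degrees V (max d d')" "g \<in> bounded_degrees V (max d d')"
    using bounded_degrees_mono[OF assms(1)] by (meson max.cobounded1 max.cobounded2)+
  then show ?case using bounded_degrees_add by blast
next
  case (mult f g)
  then show ?case using bounded_degrees_mult[OF assms(1)] by blast
qed

theorem algebraic_dependence:
  assumes V: "finite V" and K: "finite K" "card V < card K"
    and f: "\<And>k. k \<in> K \<Longrightarrow> f k \<in> pfuns V"
  shows "\<exists>B c. (\<exists>e\<in>PiE K (\<lambda>_. {..<B::nat}). c e \<noteq> 0) \<and>
           (\<forall>x. (\<Sum>e\<in>PiE K (\<lambda>_. {..<B}). c e * (\<Prod>k\<in>K. f k x ^ e k)) = 0)"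
proof -
  have "\<exists>d. \<forall>k\<in>K. f k \<in> bounded_degrees V d"
  proof -
    obtain d where d: "\<And>k. k \<in> K \<Longrightarrow> f k \<in> bounded_degrees V (d k)"
      using pfuns_bounded_degrees[OF V f] by metis
    have "f k \<in> bounded_degrees V (\<Sum>k\<in>K. d k)" if "k \<in> K" for k
      using bounded_degrees_mono[OF V d[OF that]] member_le_sum[of k K d] K(1) that by auto
    then show ?thesis by blast
  qed
  then obtain d where d: "\<And>k. k \<in> K \<Longrightarrow> f k \<in> bounded_degrees V d" by blast
  \<comment> \<open>Products of the \<open>f k\<close> with exponents below \<open>B\<close> have
    degree at most \<open>D\<close> in each variable. Since \<open>D + 1 \<le> q * B\<close> and
    \<open>q ^ card V < B\<close>, there are fewer than
    \<open>B ^ (card V + 1) \<le> B ^ card K\<close> monomials, so the products outnumber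
    them.\<close>
  define q where "q = card K * d + 1"
  define B where "B = q ^ card V + 1"
  define D where "D = card K * (B * d)"
  have mon: "(\<lambda>x. \<Prod>k\<in>K. f k x ^ e k) \<in> bounded_degrees V D" if "e \<in> PiE K (\<lambda>_. {..<B})" for e
    unfolding D_def
  proof (rule bounded_degrees_prod[OF V K(1)])
    fix k assume k: "k \<in> K"
    then have "e k * d \<le> B * d" using that by (auto simp: PiE_iff less_imp_le)
    then show "(\<lambda>x. f k x ^ e k) \<in> bounded_degrees V (B * d)"
      using bounded_degrees_mono[OF V bounded_degrees_power[OF V d[OF k]]] by blast
  qed
  have "\<exists>a. \<forall>e\<in>PiE K (\<lambda>_. {..<B}). \<forall>x. (\<Prod>k\<in>K. f k x ^ e k)
      = (\<Sum>m\<in>PiE V (\<lambda>_. {..D}). a e m * (\<Prod>v\<in>V. x v ^ m v))"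
    using mon unfolding bounded_degrees_def mem_Collect_eq by (intro bchoice) blast
  then obtain a where a: "\<And>e x. e \<in> PiE K (\<lambda>_. {..<B}) \<Longrightarrow> (\<Prod>k\<in>K. f k x ^ e k)
      = (\<Sum>m\<in>PiE V (\<lambda>_. {..D}). a e m * (\<Prod>v\<in>V. x v ^ m v))" by blast
  have "card (PiE V (\<lambda>_. {..D})) = (D + 1) ^ card V"
    using V by (simp add: card_PiE)
  also have "\<dots> \<le> (q * B) ^ card V"
    by (intro power_mono) (auto simp: D_def q_def algebra_simps B_def)
  also have "\<dots> = q ^ card V * B ^ card V" by (simp add: power_mult_distrib)
  also have "\<dots> < B * B ^ card V" by (intro mult_strict_right_mono) (auto simp: B_def)
  also have "\<dots> \<le> B ^ card K"
    using K(2) power_increasing[of "Suc (card V)" "card K" B] by (auto simp: B_def)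
  also have "\<dots> = card (PiE K (\<lambda>_. {..<B}))" using K(1) by (simp add: card_PiE)
  finally have "card (PiE V (\<lambda>_. {..D})) < card (PiE K (\<lambda>_. {..<B}))" .
  from homogeneous_system_solution[OF finite_PiE finite_PiE this, of "\<lambda>m e. a e m"]
  obtain c where c: "\<exists>e\<in>PiE K (\<lambda>_. {..<B}). c e \<noteq> 0"
    "\<And>m. m \<in> PiE V (\<lambda>_. {..D}) \<Longrightarrow> (\<Sum>e\<in>PiE K (\<lambda>_. {..<B}). a e m * c e) = 0"
    using V K by auto
  have "(\<Sum>e\<in>PiE K (\<lambda>_. {..<B}). c e * (\<Prod>k\<in>K. f k x ^ e k)) = 0" for x
  proof -
    have "(\<Sum>e\<in>PiE K (\<lambda>_. {..<B}). c e * (\<Prod>k\<in>K. f k x ^ e k)) =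
       (\<Sum>e\<in>PiE K (\<lambda>_. {..<B}). \<Sum>m\<in>PiE V (\<lambda>_. {..D}). a e m * c e * (\<Prod>v\<in>V. x v ^ m v))"
      by (rule sum.cong) (simp_all add: a sum_distrib_left algebra_simps)
    also have "\<dots> = (\<Sum>m\<in>PiE V (\<lambda>_. {..D}). (\<Sum>e\<in>PiE K (\<lambda>_. {..<B}). a e m * c e) * (\<Prod>v\<in>V. x v ^ m v))"
      unfolding sum_distrib_right by (rule sum.swap)
    also have "\<dots> = 0" by (rule sum.neutral) (simp add: c(2))
    finally show ?thesis .
  qed
  then show ?thesis using c(1) by blast
qed

definition alg_independent :: "'k set \<Rightarrow> ('k \<Rightarrow> ('v \<Rightarrow> complex) \<Rightarrow> complex) \<Rightarrow> bool" where
  "alg_independent K \<phi> \<longleftrightarrow> (\<forall>G\<in>pfuns K. (\<forall>x. G (\<lambda>k. \<phi> k x) = 0) \<longrightarrow> (\<forall>y. G y = 0))"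

text \<open>With \<open>f\<close> adjoined, under the index \<open>None\<close>, there are more
  functions than variables, hence a relation. It has to involve \<open>f\<close> because the \<phi>
  are independent among themselves.\<close>

lemma algebraic_relation:
  assumes V: "finite V" and K: "finite K" "card V \<le> card K"
    and \<phi>: "\<And>k. k \<in> K \<Longrightarrow> \<phi> k \<in> pfuns V" and ind: "alg_independent K \<phi>"
    and f: "f \<in> pfuns V"
  shows "\<exists>e a. (\<forall>j. a j \<in> pfuns K) \<and> (\<exists>y. a e y \<noteq> 0) \<and> 0 < e \<and>
           (\<forall>x. (\<Sum>j\<le>e. a j (\<lambda>k. \<phi> k x) * f x ^ j) = 0)"
proof -
  define K' where "K' = insert None (Some ` K)"
  define F where "F = case_option f \<phi>"
  have card: "card V < card K'"
    unfolding K'_def using K by (subst card_insert_disjoint) (auto simp: card_image)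
  have F: "F k \<in> pfuns V" if "k \<in> K'" for k
    using that \<phi> f by (auto simp: K'_def F_def)
  obtain B c where c: "\<exists>e\<in>PiE K' (\<lambda>_. {..<B::nat}). c e \<noteq> 0"
    and rel: "\<And>x. (\<Sum>e\<in>PiE K' (\<lambda>_. {..<B}). c e * (\<Prod>k\<in>K'. F k x ^ e k)) = 0"
  proof -
    have "finite K'" using K(1) by (simp add: K'_def)
    from algebraic_dependence[OF V this card, of F, OF F] show thesis using that by blast
  qed
  define b where "b j y = (\<Sum>e\<in>PiE (Some ` K) (\<lambda>_. {..<B}). c (e(None := j)) * (\<Prod>k\<in>K. y k ^ e (Some k)))"
    for j and y :: "'b \<Rightarrow> complex"
  have b_in: "b j \<in> pfuns K" for j
    unfolding b_def by (intro pfuns_intros)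
  have b_rel: "(\<Sum>j<B. b j (\<lambda>k. \<phi> k x) * f x ^ j) = 0" for x
  proof -
    have "(\<Prod>k\<in>K'. F k x ^ (e(None := j)) k) = (\<Prod>k\<in>K. \<phi> k x ^ e (Some k)) * f x ^ j" for e j
      unfolding K'_def using K(1)
      by (subst prod.insert) (auto simp: F_def prod.reindex)
    then have "(\<Sum>j<B. b j (\<lambda>k. \<phi> k x) * f x ^ j) = (\<Sum>e\<in>PiE K' (\<lambda>_. {..<B}). c e * (\<Prod>k\<in>K'. F k x ^ e k))"
      unfolding b_def K'_def
      by (subst sum_PiE_insert) (auto simp: sum_distrib_right mult.assoc)
    then show ?thesis using rel by simp
  qed
  obtain e where e: "e \<in> PiE K' (\<lambda>_. {..<B})" "c e \<noteq> 0" using c by blast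
  have ex: "\<exists>y. b (e None) y \<noteq> 0"
  proof (rule ccontr)
    assume "\<nexists>y. b (e None) y \<noteq> 0"
    then have 0: "(\<Sum>e'\<in>PiE (Some ` K) (\<lambda>_. {..<B}). c (e'(None := e None)) * (\<Prod>v\<in>Some ` K. y v ^ e' v)) = 0" for y
      unfolding b_def by (auto simp: prod.reindex dest: spec[of _ "y \<circ> Some"])
    have "restrict e (Some ` K) \<in> PiE (Some ` K) (\<lambda>_. {..<B})"
      using e(1) by (auto simp: K'_def PiE_iff)
    from monomials_independent[OF _ 0 this]
    have "c ((restrict e (Some ` K))(None := e None)) = 0" using K(1) by simp
    moreover have "(restrict e (Some ` K))(None := e None) = e"
      using e(1) by (auto simp: fun_eq_iff K'_def PiE_iff extensional_def)
    ultimately show False using e(2) by simp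
  qed
  have eB: "e None < B" using e(1) by (auto simp: K'_def PiE_iff)
  \<comment> \<open>The degree in \<open>f\<close> is the largest index whose coefficient is a
    nonzero polynomial. It is positive, since degree 0 would give a relation among the \<phi>
    alone.\<close>
  define S where "S = {j. j < B \<and> (\<exists>y. b j y \<noteq> 0)}"
  have S: "finite S" "S \<noteq> {}" using ex eB by (auto simp: S_def)
  define m where "m = Max S"
  have m: "m \<in> S" unfolding m_def using S by (rule Max_in)
  have above: "b j y = 0" if "m < j" "j < B" for j y
  proof (rule ccontr)
    assume "b j y \<noteq> 0"
    then have "j \<in> S" using that by (auto simp: S_def)
    then show False using Max_ge[OF S(1)] that(1) unfolding m_def by fastforce
  qed
  have rel': "(\<Sum>j\<le>m. b j (\<lambda>k. \<phi> k x) * f x ^ j) = 0" for x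
  proof -
    have "(\<Sum>j\<le>m. b j (\<lambda>k. \<phi> k x) * f x ^ j) = (\<Sum>j<B. b j (\<lambda>k. \<phi> k x) * f x ^ j)"
      by (rule sum.mono_neutral_left) (use m above in \<open>auto simp: S_def not_le\<close>)
    then show ?thesis using b_rel by simp
  qed
  have "0 < m"
  proof (rule ccontr)
    assume "\<not> 0 < m"
    then have "\<forall>x. b m (\<lambda>k. \<phi> k x) = 0" using rel' by simp
    then show False using ind b_in[of m] m unfolding alg_independent_def S_def by blast
  qed
  then show ?thesis using b_in m rel' unfolding S_def by blast
qed

text \<open>Let \<open>a m\<close> be the lowest nonzero coefficient in a relation for
  \<open>f\<close>, and cancel \<open>f ^ m\<close>. Then \<open>a m\<close>, taken at \<phi>, is a
  multiple of \<open>f\<close>, so it can be nonzero only where \<open>f\<close> is; it serves as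
  \<open>G\<close>.\<close>

lemma alg_independent_nonvanishing:
  assumes V: "finite V" and K: "finite K" "card V \<le> card K"
    and \<phi>: "\<And>k. k \<in> K \<Longrightarrow> \<phi> k \<in> pfuns V" and ind: "alg_independent K \<phi>"
    and f: "f \<in> pfuns V" "f x0 \<noteq> 0"
  shows "\<exists>G\<in>pfuns K. (\<exists>y. G y \<noteq> 0) \<and> (\<forall>x. G (\<lambda>k. \<phi> k x) \<noteq> 0 \<longrightarrow> f x \<noteq> 0)"
proof -
  obtain e a where a: "\<And>j. a j \<in> pfuns K" "\<exists>y. a e y \<noteq> 0"
    "\<And>x. (\<Sum>j\<le>e. a j (\<lambda>k. \<phi> k x) * f x ^ j) = 0"
    using algebraic_relation[OF V K \<phi> ind f(1)] by blast
  define m where "m = (LEAST j. \<exists>y. a j y \<noteq> 0)"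
  have m: "\<exists>y. a m y \<noteq> 0" "m \<le> e"
    unfolding m_def using a(2) by (rule LeastI) (use a(2) in \<open>rule Least_le\<close>)
  have below: "a j y = 0" if "j < m" for j y
    using not_less_Least[of j "\<lambda>j. \<exists>y. a j y \<noteq> 0"] that unfolding m_def by blast
  define g where "g x = (\<Sum>i\<le>e - m. a (m + i) (\<lambda>k. \<phi> k x) * f x ^ i)" for x
  have g: "g \<in> pfuns V"
    unfolding g_def by (intro pfuns_intros f pfuns_compose[OF a(1)] \<phi>)
  have fg: "f x ^ m * g x = 0" for x
  proof -
    have "f x ^ m * g x = (\<Sum>i\<le>e - m. a (m + i) (\<lambda>k. \<phi> k x) * f x ^ (m + i))"
      unfolding g_def by (simp add: sum_distrib_left power_add mult_ac)
    also have "\<dots> = (\<Sum>j\<in>{m..e}. a j (\<lambda>k. \<phi> k x) * f x ^ j)"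
      by (rule sum.reindex_bij_witness[of _ "\<lambda>j. j - m" "\<lambda>i. m + i"]) (use m(2) in auto)
    also have "\<dots> = (\<Sum>j\<le>e. a j (\<lambda>k. \<phi> k x) * f x ^ j)"
      by (rule sum.mono_neutral_left) (auto simp: below)
    finally show ?thesis using a(3) by simp
  qed
  have g0: "g x = 0" for x
    using pfuns_mult_nonzero[OF pfuns_power[OF f(1), of m] _ g, of x0 x] f(2) fg by auto
  have "f x \<noteq> 0" if "a m (\<lambda>k. \<phi> k x) \<noteq> 0" for x
  proof
    assume "f x = 0"
    then have "g x = (\<Sum>i\<le>e - m. if i = 0 then a m (\<lambda>k. \<phi> k x) else 0)"
      unfolding g_def by (intro sum.cong) auto
    then show False using g0[of x] that by simp
  qed
  then show ?thesis using a(1) m(1) by blast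
qed

text \<open>The determinant trick behind Nakayama's lemma, carried out by eliminating one unknown at
  a time. At \<open>y0\<close> the system is diagonal with nonzero entries, a property inherited by
  \<open>u'\<close> and \<open>C'\<close>; \<open>D\<close> collects the pivots.\<close>

lemma nakayama_elimination:
  assumes "finite B" "\<And>i. i \<in> B \<Longrightarrow> u i \<in> pfuns K" "\<And>i. i \<in> B \<Longrightarrow> u i y0 \<noteq> 0"
    and "\<And>i j. i \<in> B \<Longrightarrow> j \<in> B \<Longrightarrow> C i j \<in> pfuns K"
    and "\<And>i j. i \<in> B \<Longrightarrow> j \<in> B \<Longrightarrow> C i j y0 = 0"
  shows "\<exists>D\<in>pfuns K. D y0 \<noteq> 0 \<and>
    (\<forall>y b. (\<forall>i\<in>B. u i y * b i = (\<Sum>j\<in>B. C i j y * b j)) \<longrightarrow> (\<forall>i\<in>B. D y * b i = 0))"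
  using assms
proof (induction B arbitrary: u C rule: finite_induct)
  case empty
  show ?case by (intro bexI[of _ "\<lambda>_. 1"]) (auto intro: pfuns.const)
next
  case (insert k B)
  define w where "w y = u k y - C k k y" for y
  define u' where "u' i y = w y * u i y" for i y
  define C' where "C' i j y = w y * C i j y + C i k y * C k j y" for i j y
  have w: "w \<in> pfuns K" "w y0 \<noteq> 0"
    unfolding w_def using insert.prems by (auto intro!: pfuns_intros)
  have "\<exists>D\<in>pfuns K. D y0 \<noteq> 0 \<and>
    (\<forall>y b. (\<forall>i\<in>B. u' i y * b i = (\<Sum>j\<in>B. C' i j y * b j)) \<longrightarrow> (\<forall>i\<in>B. D y * b i = 0))"
  proof (rule insert.IH)
    show "u' i \<in> pfuns K" if "i \<in> B" for i
      unfolding u'_def using insert.prems that w by (intro pfuns_intros) auto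
    show "u' i y0 \<noteq> 0" if "i \<in> B" for i
      unfolding u'_def using insert.prems that w by auto
    show "C' i j \<in> pfuns K" if "i \<in> B" "j \<in> B" for i j
      unfolding C'_def using insert.prems that w by (intro pfuns_intros) auto
    show "C' i j y0 = 0" if "i \<in> B" "j \<in> B" for i j
      unfolding C'_def using insert.prems that by auto
  qed
  then obtain D where D: "D \<in> pfuns K" "D y0 \<noteq> 0"
    and kill: "\<And>y b. (\<forall>i\<in>B. u' i y * b i = (\<Sum>j\<in>B. C' i j y * b j)) \<Longrightarrow> (\<forall>i\<in>B. D y * b i = 0)"
    by blast
  show ?case
  proof (intro bexI[of _ "\<lambda>y. w y * D y"] conjI allI impI)
    show "w y0 * D y0 \<noteq> 0" using w D by simp
    show "(\<lambda>y. w y * D y) \<in> pfuns K" by (intro pfuns_intros w D)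
    fix y b
    assume eq: "\<forall>i\<in>insert k B. u i y * b i = (\<Sum>j\<in>insert k B. C i j y * b j)"
    have k: "w y * b k = (\<Sum>j\<in>B. C k j y * b j)"
      using eq insert.hyps by (simp add: w_def algebra_simps)
    have "u' i y * b i = (\<Sum>j\<in>B. C' i j y * b j)" if "i \<in> B" for i
    proof -
      have "u' i y * b i = w y * (C i k y * b k + (\<Sum>j\<in>B. C i j y * b j))"
        using eq insert.hyps that by (simp add: u'_def mult.assoc)
      also have "\<dots> = C i k y * (w y * b k) + (\<Sum>j\<in>B. w y * C i j y * b j)"
        by (simp add: algebra_simps sum_distrib_left)
      also have "\<dots> = (\<Sum>j\<in>B. C' i j y * b j)"
        unfolding k C'_def by (simp add: sum_distrib_left sum.distrib algebra_simps)
      finally show ?thesis .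
    qed
    then have B: "\<forall>i\<in>B. D y * b i = 0" using kill by blast
    have "w y * D y * b k = (\<Sum>j\<in>B. C k j y * (D y * b j))"
      using arg_cong[OF k, of "\<lambda>z. D y * z"] by (simp add: sum_distrib_left mult_ac)
    also have "\<dots> = 0" using B by (intro sum.neutral) auto
    finally show "\<forall>i\<in>insert k B. w y * D y * b i = 0" using B by (auto simp: mult.assoc)
  qed
qed

section \<open>Ideals and zeros\<close>

definition pf_ideal :: "'v set \<Rightarrow> (('v \<Rightarrow> complex) \<Rightarrow> complex) set \<Rightarrow> bool" where
  "pf_ideal V J \<longleftrightarrow> J \<subseteq> pfuns V \<and> (\<lambda>x. 0) \<in> J \<and> (\<forall>f\<in>J. \<forall>g\<in>J. (\<lambda>x. f x + g x) \<in> J) \<and>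
     (\<forall>h\<in>pfuns V. \<forall>f\<in>J. (\<lambda>x. h x * f x) \<in> J)"

lemma pf_idealD:
  assumes "pf_ideal V J"
  shows "f \<in> J \<Longrightarrow> f \<in> pfuns V" "(\<lambda>x. 0) \<in> J"
    "f \<in> J \<Longrightarrow> g \<in> J \<Longrightarrow> (\<lambda>x. f x + g x) \<in> J"
    "h \<in> pfuns V \<Longrightarrow> f \<in> J \<Longrightarrow> (\<lambda>x. h x * f x) \<in> J"
  using assms unfolding pf_ideal_def by blast+

lemma pf_ideal_sum:
  assumes "pf_ideal V J" "\<And>i. i \<in> I \<Longrightarrow> f i \<in> J"
  shows "(\<lambda>x. \<Sum>i\<in>I. f i x) \<in> J"
  using assms(2) by (induction I rule: infinite_finite_induct) (auto intro: pf_idealD[OF assms(1)])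

text \<open>Modulo \<open>J\<close> the \<phi> are congruent to the constants \<open>y\<close>, and
  polynomials respect congruences.\<close>

lemma pf_ideal_compose_diff:
  assumes J: "pf_ideal V J" and \<phi>: "\<And>k. k \<in> K \<Longrightarrow> \<phi> k \<in> pfuns V"
    and diff: "\<And>k. k \<in> K \<Longrightarrow> (\<lambda>x. \<phi> k x - y k) \<in> J" and f: "f \<in> pfuns K"
  shows "(\<lambda>x. f (\<lambda>k. \<phi> k x) - f y) \<in> J"
  using f
proof (induction rule: pfuns.induct)
  case (const c)
  then show ?case using pf_idealD[OF J] by simp
next
  case (var v)
  then show ?case using diff by simp
next
  case (add f g)
  show ?case using pf_idealD(3)[OF J add.IH] by (simp add: algebra_simps)
next
  case (mult f g)
  have "(\<lambda>x. f (\<lambda>k. \<phi> k x) * (g (\<lambda>k. \<phi> k x) - g y) + g y * (f (\<lambda>k. \<phi> k x) - f y)) \<in> J"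
    by (intro pf_idealD(3,4)[OF J] mult.IH pfuns_compose[OF mult.hyps(1)] \<phi> pfuns.const)
  then show ?case by (simp add: algebra_simps)
qed

definition adjoin_root :: "'v set \<Rightarrow> (('v \<Rightarrow> complex) \<Rightarrow> complex) set \<Rightarrow> 'v \<Rightarrow> complex \<Rightarrow> (('v \<Rightarrow> complex) \<Rightarrow> complex) set" where
  "adjoin_root V J v r = {\<lambda>x. f x + h x * (x v - r) | f h. f \<in> J \<and> h \<in> pfuns V}"

lemma adjoin_rootI: "f \<in> J \<Longrightarrow> h \<in> pfuns V \<Longrightarrow> (\<lambda>x. f x + h x * (x v - r)) \<in> adjoin_root V J v r"
  unfolding adjoin_root_def by blast

lemma pf_ideal_adjoin_root:
  assumes J: "pf_ideal V J" and v: "v \<in> V"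
  shows "pf_ideal V (adjoin_root V J v r)"
  unfolding pf_ideal_def
proof (intro conjI ballI subsetI)
  fix f assume "f \<in> adjoin_root V J v r"
  then show "f \<in> pfuns V"
    unfolding adjoin_root_def
    by (auto intro!: pfuns.add pfuns.mult pfuns_diff pfuns.const pfuns.var v dest: pf_idealD(1)[OF J])
next
  show "(\<lambda>x. 0) \<in> adjoin_root V J v r"
    using adjoin_rootI[OF pf_idealD(2)[OF J] pfuns.const[of 0]] by simp
next
  fix f g assume "f \<in> adjoin_root V J v r" "g \<in> adjoin_root V J v r"
  then obtain a b c d where f: "f = (\<lambda>x. a x + b x * (x v - r))" and g: "g = (\<lambda>x. c x + d x * (x v - r))"
    and abcd: "a \<in> J" "b \<in> pfuns V" "c \<in> J" "d \<in> pfuns V"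
    unfolding adjoin_root_def by blast
  show "(\<lambda>x. f x + g x) \<in> adjoin_root V J v r"
    using adjoin_rootI[OF pf_idealD(3)[OF J abcd(1,3)] pfuns.add[OF abcd(2,4)], of v r]
    unfolding f g by (simp add: algebra_simps)
next
  fix h f assume h: "h \<in> pfuns V" and "f \<in> adjoin_root V J v r"
  then obtain a b where f: "f = (\<lambda>x. a x + b x * (x v - r))" and ab: "a \<in> J" "b \<in> pfuns V"
    unfolding adjoin_root_def by blast
  show "(\<lambda>x. h x * f x) \<in> adjoin_root V J v r"
    using adjoin_rootI[OF pf_idealD(4)[OF J h ab(1)] pfuns.mult[OF h ab(2)], of v r]
    unfolding f by (simp add: algebra_simps)
qed

lemma adjoin_root_superset: "J \<subseteq> adjoin_root V J v r"
proof
  fix f assume "f \<in> J"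
  then show "f \<in> adjoin_root V J v r" using adjoin_rootI[OF _ pfuns.const[of 0], of f J v r] by simp
qed

text \<open>Write \<open>p = [:- r, 1:] * q\<close>. If adjoining \<open>x v - r\<close> gave the
  unit ideal, multiplying \<open>1 = u x + w x * (x v - r)\<close> by \<open>q\<close> would put
  \<open>q\<close> into \<open>J\<close>. So either \<open>r\<close> works or the degree of the
  polynomial drops, down to a nonzero constant in \<open>J\<close>.\<close>

lemma adjoin_root_proper:
  assumes J: "pf_ideal V J" "(\<lambda>x. 1) \<notin> J" and v: "v \<in> V"
    and p: "p \<noteq> 0" "(\<lambda>x. poly p (x v)) \<in> J"
  shows "\<exists>r. (\<lambda>x. 1) \<notin> adjoin_root V J v r"
  using p
proof (induction "degree p" arbitrary: p)
  case 0
  then obtain c where c: "p = [:c:]" "c \<noteq> 0" by (metis degree_eq_zeroE pCons_0_0)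
  then have "(\<lambda>x. 1) \<in> J"
    using pf_idealD(4)[OF J(1) pfuns.const[of "1 / c"] 0(3)] by simp
  then show ?case using J(2) by blast
next
  case (Suc n)
  then obtain r where r: "poly p r = 0"
    using fundamental_theorem_of_algebra[of p] by (auto simp: constant_degree)
  then obtain q where q: "p = [:- r, 1:] * q" by (meson dvdE poly_eq_0_iff_dvd)
  have q0: "q \<noteq> 0" using Suc.prems q by auto
  have deg: "degree q = n" using Suc.hyps(2) q0 unfolding q by (subst (asm) degree_mult_eq) auto
  show ?case
  proof (rule ccontr)
    assume *: "\<not> ?thesis"
    then have "(\<lambda>x. 1) \<in> adjoin_root V J v r" by blast
    then obtain u w where uw: "(\<lambda>x. 1) = (\<lambda>x. u x + w x * (x v - r))" "u \<in> J" "w \<in> pfuns V"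
      unfolding adjoin_root_def by blast
    have qv: "(\<lambda>x. poly q (x v)) \<in> pfuns V"
      unfolding poly_altdef by (intro pfuns_intros v)
    have "(\<lambda>x. poly q (x v) * u x + w x * poly p (x v)) \<in> J"
      by (intro pf_idealD(3,4)[OF J(1)] uw qv Suc.prems)
    moreover have "poly q (x v) * u x + w x * poly p (x v) = poly q (x v)" for x
    proof -
      have "poly q (x v) = poly q (x v) * (u x + w x * (x v - r))" using uw(1) by (metis mult.right_neutral)
      then show ?thesis unfolding q by (simp add: algebra_simps)
    qed
    ultimately have "(\<lambda>x. poly q (x v)) \<in> J" by simp
    then show False using Suc.hyps(1)[OF deg[symmetric] q0] * by blast
  qed
qed

text \<open>The Nullstellensatz for ideals modulo which every coordinate satisfies a polynomial
  equation. Adjoining one root per coordinate keeps the ideal proper, and in the end it contains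
  every \<open>x v - a v\<close>; an element of \<open>J\<close> nonzero at \<open>a\<close> would
  then produce 1.\<close>

lemma pf_ideal_common_zero:
  assumes V: "finite V" and J: "pf_ideal V J" "(\<lambda>x. 1) \<notin> J"
    and p: "\<And>v. v \<in> V \<Longrightarrow> p v \<noteq> 0" "\<And>v. v \<in> V \<Longrightarrow> (\<lambda>x. poly (p v) (x v)) \<in> J"
  shows "\<exists>a. \<forall>f\<in>J. f a = 0"
proof -
  have "\<exists>a J'. pf_ideal V J' \<and> J \<subseteq> J' \<and> (\<lambda>x. 1) \<notin> J' \<and> (\<forall>v\<in>W. (\<lambda>x. x v - a v) \<in> J')"
    if "W \<subseteq> V" for W
    using finite_subset[OF that V] that
  proof (induction W rule: finite_induct)
    case empty
    then show ?case using J by (intro exI[of _ "\<lambda>_. 0"] exI[of _ J]) auto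
  next
    case (insert w W)
    then obtain a J' where *: "pf_ideal V J'" "J \<subseteq> J'" "(\<lambda>x. 1) \<notin> J'" "\<forall>v\<in>W. (\<lambda>x. x v - a v) \<in> J'"
      by auto
    have w: "w \<in> V" using insert.prems by simp
    obtain r where r: "(\<lambda>x. 1) \<notin> adjoin_root V J' w r"
      using adjoin_root_proper[OF *(1,3) w p(1)[OF w]] p(2)[OF w] *(2) by blast
    have "(\<lambda>x. 0 + 1 * (x w - r)) \<in> adjoin_root V J' w r"
      by (intro adjoin_rootI pf_idealD(2)[OF *(1)] pfuns.const)
    then have "(\<lambda>x. x w - r) \<in> adjoin_root V J' w r" by simp
    then have "\<forall>v\<in>insert w W. (\<lambda>x. x v - (a(w := r)) v) \<in> adjoin_root V J' w r"
      using *(4) adjoin_root_superset[of J' V w r] insert.hyps by auto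
    moreover have "J \<subseteq> adjoin_root V J' w r" using adjoin_root_superset *(2) by (rule order_trans[rotated])
    ultimately show ?case
      using r pf_ideal_adjoin_root[OF *(1) w, of r]
      by (intro exI[of _ "a(w := r)"] exI[of _ "adjoin_root V J' w r"] conjI)
  qed
  then obtain a J' where *: "pf_ideal V J'" "J \<subseteq> J'" "(\<lambda>x. 1) \<notin> J'"
    "\<forall>v\<in>V. (\<lambda>x. x v - a v) \<in> J'" by (metis order_refl)
  have "f a = 0" if f: "f \<in> J" for f
  proof (rule ccontr)
    assume nz: "f a \<noteq> 0"
    have "(\<lambda>x. f x - f a) \<in> J'"
      by (rule pf_ideal_compose_diff[OF *(1), where K = V and \<phi> = "\<lambda>k x. x k"])
         (use *(4) in \<open>auto intro: pfuns.var pf_idealD(1)[OF J(1) f]\<close>)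
    then have "(\<lambda>x. (1 / f a) * (f x + (- 1) * (f x - f a))) \<in> J'"
      by (intro pf_idealD(3,4)[OF *(1)] pfuns.const) (use f *(2) in auto)
    then show False using *(3) nz by simp
  qed
  then show ?thesis by blast
qed

section \<open>Images of dominant polynomial maps\<close>

definition monom_fun :: "'v set \<Rightarrow> ('v \<Rightarrow> nat) \<Rightarrow> ('v \<Rightarrow> complex) \<Rightarrow> complex" where
  "monom_fun V e x = (\<Prod>v\<in>V. x v ^ e v)"

text \<open>Every coordinate is algebraic over the \<phi>. Inverting the product \<open>lead\<close>
  of the leading coefficients makes the coordinates integral, so that the finitely many monomials
  with exponents below \<open>e\<close> generate all polynomial functions as a module.\<close>

locale integral_relations =
  fixes V :: "'v set" and K :: "'k set" and \<phi> :: "'k \<Rightarrow> ('v \<Rightarrow> complex) \<Rightarrow> complex"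
    and e :: "'v \<Rightarrow> nat" and a :: "'v \<Rightarrow> nat \<Rightarrow> ('k \<Rightarrow> complex) \<Rightarrow> complex"
  assumes finite_V: "finite V"
    and \<phi>: "\<And>k. k \<in> K \<Longrightarrow> \<phi> k \<in> pfuns V"
    and a: "\<And>v j. v \<in> V \<Longrightarrow> a v j \<in> pfuns K"
    and e: "\<And>v. v \<in> V \<Longrightarrow> 0 < e v"
    and rel: "\<And>v x. v \<in> V \<Longrightarrow> (\<Sum>j\<le>e v. a v j (\<lambda>k. \<phi> k x) * x v ^ j) = 0"
begin

definition "exps = PiE V (\<lambda>v. {..<e v})"

definition "lead y = (\<Prod>v\<in>V. a v (e v) y)"

abbreviation "\<Phi> x \<equiv> (\<lambda>k. \<phi> k x)"

text \<open>The power \<open>s\<close> encodes localisation at \<open>lead\<close>. The set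
  \<open>M\<close> of admissible coefficients is needed both for all polynomials and for the maximal
  ideal of a point.\<close>

definition module_span :: "(('k \<Rightarrow> complex) \<Rightarrow> complex) set \<Rightarrow> (('v \<Rightarrow> complex) \<Rightarrow> complex) set" where
  "module_span M = {f. \<exists>s c. (\<forall>\<alpha>\<in>exps. c \<alpha> \<in> M) \<and>
     (\<forall>x. lead (\<Phi> x) ^ s * f x = (\<Sum>\<alpha>\<in>exps. c \<alpha> (\<Phi> x) * monom_fun V \<alpha> x))}"

lemma finite_exps: "finite exps"
  unfolding exps_def using finite_V by (intro finite_PiE) auto

lemma lead: "lead \<in> pfuns K"
  unfolding lead_def by (intro pfuns_intros a)

lemma module_spanI:
  "(\<And>\<alpha>. \<alpha> \<in> exps \<Longrightarrow> c \<alpha> \<in> M) \<Longrightarrow>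
   (\<And>x. lead (\<Phi> x) ^ s * f x = (\<Sum>\<alpha>\<in>exps. c \<alpha> (\<Phi> x) * monom_fun V \<alpha> x)) \<Longrightarrow> f \<in> module_span M"
  unfolding module_span_def by blast

lemma module_spanE:
  assumes "f \<in> module_span M"
  obtains s c where "\<And>\<alpha>. \<alpha> \<in> exps \<Longrightarrow> c \<alpha> \<in> M"
    "\<And>x. lead (\<Phi> x) ^ s * f x = (\<Sum>\<alpha>\<in>exps. c \<alpha> (\<Phi> x) * monom_fun V \<alpha> x)"
  using assms unfolding module_span_def by blast

lemma module_span_zero: "pf_ideal K M \<Longrightarrow> (\<lambda>x. 0) \<in> module_span M"
  by (rule module_spanI[where c = "\<lambda>_ _. 0"]) (auto dest: pf_idealD)

lemma module_span_add:
  assumes M: "pf_ideal K M" and "f \<in> module_span M" "g \<in> module_span M"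
  shows "(\<lambda>x. f x + g x) \<in> module_span M"
proof -
  obtain s b where b: "\<And>\<alpha>. \<alpha> \<in> exps \<Longrightarrow> b \<alpha> \<in> M"
    and f: "\<And>x. lead (\<Phi> x) ^ s * f x = (\<Sum>\<alpha>\<in>exps. b \<alpha> (\<Phi> x) * monom_fun V \<alpha> x)"
    using assms(2) by (elim module_spanE) blast
  obtain t c where c: "\<And>\<alpha>. \<alpha> \<in> exps \<Longrightarrow> c \<alpha> \<in> M"
    and g: "\<And>x. lead (\<Phi> x) ^ t * g x = (\<Sum>\<alpha>\<in>exps. c \<alpha> (\<Phi> x) * monom_fun V \<alpha> x)"
    using assms(3) by (elim module_spanE) blast
  show ?thesis
  proof (rule module_spanI[where s = "s + t" and c = "\<lambda>\<alpha> y. lead y ^ t * b \<alpha> y + lead y ^ s * c \<alpha> y"])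
    show "(\<lambda>y. lead y ^ t * b \<alpha> y + lead y ^ s * c \<alpha> y) \<in> M" if "\<alpha> \<in> exps" for \<alpha>
      by (intro pf_idealD(3,4)[OF M] pfuns_power lead b c that)
    fix x
    have "lead (\<Phi> x) ^ (s + t) * (f x + g x)
      = lead (\<Phi> x) ^ t * (lead (\<Phi> x) ^ s * f x) + lead (\<Phi> x) ^ s * (lead (\<Phi> x) ^ t * g x)"
      by (simp add: power_add algebra_simps)
    also have "\<dots> = (\<Sum>\<alpha>\<in>exps. (lead (\<Phi> x) ^ t * b \<alpha> (\<Phi> x) + lead (\<Phi> x) ^ s * c \<alpha> (\<Phi> x)) * monom_fun V \<alpha> x)"
      unfolding f g by (simp add: sum_distrib_left sum.distrib algebra_simps)
    finally show "lead (\<Phi> x) ^ (s + t) * (f x + g x) =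
      (\<Sum>\<alpha>\<in>exps. (lead (\<Phi> x) ^ t * b \<alpha> (\<Phi> x) + lead (\<Phi> x) ^ s * c \<alpha> (\<Phi> x)) * monom_fun V \<alpha> x)" .
  qed
qed

lemma module_span_sum:
  "pf_ideal K M \<Longrightarrow> (\<And>i. i \<in> I \<Longrightarrow> f i \<in> module_span M) \<Longrightarrow> (\<lambda>x. \<Sum>i\<in>I. f i x) \<in> module_span M"
  by (induction I rule: infinite_finite_induct) (auto intro: module_span_zero module_span_add)

lemma module_span_mult:
  assumes h: "\<And>c. c \<in> M \<Longrightarrow> (\<lambda>y. h y * c y) \<in> M'" and f: "f \<in> module_span M"
  shows "(\<lambda>x. h (\<Phi> x) * f x) \<in> module_span M'"
proof -
  obtain s b where b: "\<And>\<alpha>. \<alpha> \<in> exps \<Longrightarrow> b \<alpha> \<in> M"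
    and eq: "\<And>x. lead (\<Phi> x) ^ s * f x = (\<Sum>\<alpha>\<in>exps. b \<alpha> (\<Phi> x) * monom_fun V \<alpha> x)"
    using f by (elim module_spanE) blast
  show ?thesis
  proof (rule module_spanI[where s = s and c = "\<lambda>\<alpha> y. h y * b \<alpha> y"])
    fix x
    show "lead (\<Phi> x) ^ s * (h (\<Phi> x) * f x) = (\<Sum>\<alpha>\<in>exps. h (\<Phi> x) * b \<alpha> (\<Phi> x) * monom_fun V \<alpha> x)"
      using arg_cong[OF eq[of x], of "\<lambda>z. h (\<Phi> x) * z"] by (simp add: sum_distrib_left mult_ac)
  qed (use h b in auto)
qed

lemma module_span_divide:
  assumes "(\<lambda>x. lead (\<Phi> x) ^ t * f x) \<in> module_span M"
  shows "f \<in> module_span M"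
proof -
  obtain s b where b: "\<And>\<alpha>. \<alpha> \<in> exps \<Longrightarrow> b \<alpha> \<in> M"
    and eq: "\<And>x. lead (\<Phi> x) ^ s * (lead (\<Phi> x) ^ t * f x) = (\<Sum>\<alpha>\<in>exps. b \<alpha> (\<Phi> x) * monom_fun V \<alpha> x)"
    using assms by (elim module_spanE) blast
  show ?thesis
    by (rule module_spanI[where s = "s + t" and c = b]) (use b eq in \<open>auto simp: power_add mult.assoc\<close>)
qed

lemma pf_ideal_UNIV: "pf_ideal K (pfuns K)"
  unfolding pf_ideal_def by (auto intro: pfuns.intros)

lemma monom_in_module_span:
  assumes "\<alpha> \<in> exps"
  shows "monom_fun V \<alpha> \<in> module_span (pfuns K)"
proof (rule module_spanI[where s = 0 and c = "\<lambda>\<beta> _. if \<beta> = \<alpha> then 1 else 0"])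
  fix x
  have "(\<Sum>\<beta>\<in>exps. (if \<beta> = \<alpha> then 1 else 0) * monom_fun V \<beta> x)
     = (\<Sum>\<beta>\<in>exps. if \<beta> = \<alpha> then monom_fun V \<beta> x else 0)" by (rule sum.cong) auto
  also have "\<dots> = monom_fun V \<alpha> x" using assms finite_exps by simp
  finally show "lead (\<Phi> x) ^ 0 * monom_fun V \<alpha> x
     = (\<Sum>\<beta>\<in>exps. (if \<beta> = \<alpha> then 1 else 0) * monom_fun V \<beta> x)" by simp
qed (auto intro: pfuns.const)

lemma monom_fun_upd: "v \<in> V \<Longrightarrow> monom_fun V (\<alpha>(v := j)) x = x v ^ j * (\<Prod>w\<in>V - {v}. x w ^ \<alpha> w)"
  unfolding monom_fun_def using finite_V by (simp add: prod.remove[of V v])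

text \<open>Only the exponent \<open>e v\<close> leaves the generating set. There the relation
  rewrites \<open>x v ^ e v\<close> times its leading coefficient by lower powers, and the factor
  \<open>b\<close> completes that leading coefficient to \<open>lead\<close>.\<close>

lemma var_mult_monom:
  assumes v: "v \<in> V" and \<alpha>: "\<alpha> \<in> exps"
  shows "(\<lambda>x. x v * monom_fun V \<alpha> x) \<in> module_span (pfuns K)"
proof -
  have upd: "x v * monom_fun V \<alpha> x = monom_fun V (\<alpha>(v := Suc (\<alpha> v))) x" for x
    using monom_fun_upd[OF v, of \<alpha> "\<alpha> v" x] monom_fun_upd[OF v, of \<alpha> "Suc (\<alpha> v)" x] by simp
  have exps_upd: "\<alpha>(v := j) \<in> exps" if "j < e v" for j
    using \<alpha> v that unfolding exps_def by (auto simp: PiE_iff extensional_def)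
  show ?thesis
  proof (cases "Suc (\<alpha> v) < e v")
    case True
    then show ?thesis unfolding upd using monom_in_module_span[OF exps_upd] by simp
  next
    case False
    then have ev: "Suc (\<alpha> v) = e v" using \<alpha> v by (auto simp: exps_def PiE_iff)
    define b where "b y = (\<Prod>w\<in>V - {v}. a w (e w) y)" for y
    have b: "b \<in> pfuns K" unfolding b_def by (intro pfuns_intros a) auto
    have lead_b: "lead y = b y * a v (e v) y" for y
      unfolding lead_def b_def using finite_V v by (simp add: prod.remove[of V v])
    have "(\<lambda>x. \<Sum>j<e v. (- b (\<Phi> x) * a v j (\<Phi> x)) * monom_fun V (\<alpha>(v := j)) x) \<in> module_span (pfuns K)"
    proof (intro module_span_sum pf_ideal_UNIV)
      fix j assume "j \<in> {..<e v}"
      then have "monom_fun V (\<alpha>(v := j)) \<in> module_span (pfuns K)"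
        by (intro monom_in_module_span exps_upd) simp
      then show "(\<lambda>x. (- b (\<Phi> x) * a v j (\<Phi> x)) * monom_fun V (\<alpha>(v := j)) x) \<in> module_span (pfuns K)"
        by (rule module_span_mult[where h = "\<lambda>y. - b y * a v j y", rotated])
           (intro pfuns.mult pfuns_uminus b a v)
    qed
    moreover have "(\<Sum>j<e v. (- b (\<Phi> x) * a v j (\<Phi> x)) * monom_fun V (\<alpha>(v := j)) x)
       = lead (\<Phi> x) ^ 1 * (x v * monom_fun V \<alpha> x)" for x
    proof -
      define P where "P = (\<Prod>w\<in>V - {v}. x w ^ \<alpha> w)"
      have "(\<Sum>j<e v. a v j (\<Phi> x) * x v ^ j) + a v (e v) (\<Phi> x) * x v ^ e v = 0"
        using rel[OF v, of x] by (simp add: lessThan_Suc_atMost[symmetric])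
      then have r: "a v (e v) (\<Phi> x) * x v ^ e v = - (\<Sum>j<e v. a v j (\<Phi> x) * x v ^ j)"
        by (simp add: eq_neg_iff_add_eq_0 add.commute)
      have "lead (\<Phi> x) ^ 1 * (x v * monom_fun V \<alpha> x) = b (\<Phi> x) * (a v (e v) (\<Phi> x) * x v ^ e v) * P"
        unfolding upd ev monom_fun_upd[OF v] lead_b P_def by simp
      also have "\<dots> = (\<Sum>j<e v. (- b (\<Phi> x) * a v j (\<Phi> x)) * monom_fun V (\<alpha>(v := j)) x)"
        unfolding r monom_fun_upd[OF v] P_def[symmetric]
        by (simp add: sum_distrib_left sum_distrib_right sum_negf mult_ac)
      finally show ?thesis by simp
    qed
    ultimately show ?thesis using module_span_divide[of 1] by simp
  qed
qed

lemma var_mult_module_span: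
  assumes v: "v \<in> V" and f: "f \<in> module_span (pfuns K)"
  shows "(\<lambda>x. x v * f x) \<in> module_span (pfuns K)"
proof -
  obtain s c where c: "\<And>\<alpha>. \<alpha> \<in> exps \<Longrightarrow> c \<alpha> \<in> pfuns K"
    and eq: "\<And>x. lead (\<Phi> x) ^ s * f x = (\<Sum>\<alpha>\<in>exps. c \<alpha> (\<Phi> x) * monom_fun V \<alpha> x)"
    using f by (elim module_spanE) blast
  have "(\<lambda>x. \<Sum>\<alpha>\<in>exps. c \<alpha> (\<Phi> x) * (x v * monom_fun V \<alpha> x)) \<in> module_span (pfuns K)"
    by (intro module_span_sum pf_ideal_UNIV module_span_mult[where M = "pfuns K"] var_mult_monom v)
       (auto intro: pfuns.mult c)
  moreover have "(\<Sum>\<alpha>\<in>exps. c \<alpha> (\<Phi> x) * (x v * monom_fun V \<alpha> x)) = lead (\<Phi> x) ^ s * (x v * f x)" for x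
    using arg_cong[OF eq[of x], of "\<lambda>z. x v * z"] by (simp add: sum_distrib_left mult_ac)
  ultimately show ?thesis using module_span_divide[of s] by simp
qed

lemma pfuns_mult_module_span:
  assumes "f \<in> pfuns V" "h \<in> module_span (pfuns K)"
  shows "(\<lambda>x. f x * h x) \<in> module_span (pfuns K)"
  using assms
proof (induction arbitrary: h rule: pfuns.induct)
  case (const c)
  show ?case
    using module_span_mult[where h = "\<lambda>_. c", OF _ const.prems] pfuns.mult[OF pfuns.const] by blast
next
  case (var v)
  then show ?case using var_mult_module_span by blast
next
  case (add f g)
  show ?case using module_span_add[OF pf_ideal_UNIV add.IH[OF add.prems]]
    by (simp add: distrib_right)
next
  case (mult f g)
  then show ?case by (simp add: mult.assoc)
qed

definition "origin = (\<lambda>v\<in>V. 0::nat)"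

lemma origin: "origin \<in> exps" "monom_fun V origin x = 1"
  unfolding origin_def exps_def monom_fun_def by (auto simp: e)

text \<open>If no point lay over \<open>y0\<close>, then \<open>1\<close> would be a combination of the \<open>\<phi> k - y0 k\<close>; hence the
  generating monomials satisfy a linear system that is diagonal and invertible at \<open>y0\<close>.\<close>

lemma point_over:
  assumes K: "finite K" and ind: "alg_independent K \<phi>" and y0: "lead y0 \<noteq> 0"
  shows "\<exists>x. \<forall>k\<in>K. \<phi> k x = y0 k"
proof (rule ccontr)
  assume no: "\<nexists>x. \<forall>k\<in>K. \<phi> k x = y0 k"
  define J where "J = {\<lambda>x. \<Sum>k\<in>K. (\<phi> k x - y0 k) * h k x | h. \<forall>k\<in>K. h k \<in> pfuns V}"
  have JI: "(\<lambda>x. \<Sum>k\<in>K. (\<phi> k x - y0 k) * h k x) \<in> J" if "\<And>k. k \<in> K \<Longrightarrow> h k \<in> pfuns V" for h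
    using that unfolding J_def by blast
  have ideal: "pf_ideal V J"
    unfolding pf_ideal_def
  proof (intro conjI ballI subsetI)
    fix f assume "f \<in> J"
    then show "f \<in> pfuns V"
      unfolding J_def by (auto intro!: pfuns_sum pfuns.mult pfuns_diff pfuns.const \<phi>)
  next
    show "(\<lambda>x. 0) \<in> J" using JI[of "\<lambda>_ _. 0"] by (simp add: pfuns.const)
  next
    fix f g assume "f \<in> J" "g \<in> J"
    then obtain p q where "f = (\<lambda>x. \<Sum>k\<in>K. (\<phi> k x - y0 k) * p k x)" "\<forall>k\<in>K. p k \<in> pfuns V"
      "g = (\<lambda>x. \<Sum>k\<in>K. (\<phi> k x - y0 k) * q k x)" "\<forall>k\<in>K. q k \<in> pfuns V"
      unfolding J_def by blast
    then show "(\<lambda>x. f x + g x) \<in> J"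
      using JI[of "\<lambda>k x. p k x + q k x"] by (simp add: pfuns.add distrib_left sum.distrib)
  next
    fix h f assume "h \<in> pfuns V" "f \<in> J"
    then obtain p where "f = (\<lambda>x. \<Sum>k\<in>K. (\<phi> k x - y0 k) * p k x)" "\<forall>k\<in>K. p k \<in> pfuns V"
      unfolding J_def by blast
    then show "(\<lambda>x. h x * f x) \<in> J"
      using JI[of "\<lambda>k x. h x * p k x"] \<open>h \<in> pfuns V\<close> by (simp add: pfuns.mult sum_distrib_left mult_ac)
  qed
  have gen: "(\<lambda>x. \<phi> k x - y0 k) \<in> J" if "k \<in> K" for k
  proof -
    have "(\<Sum>i\<in>K. (\<phi> i x - y0 i) * (if i = k then 1 else 0)) = \<phi> k x - y0 k" for x
      using K that by (simp add: if_distrib cong: if_cong)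
    then show ?thesis
      using JI[of "\<lambda>i x. if i = k then 1 else 0"] by (simp add: pfuns.const)
  qed
  \<comment> \<open>If \<open>J\<close> were proper, specialising the relations at \<open>y0\<close>
    would give each coordinate a nonzero equation modulo \<open>J\<close>, hence a common zero of
    \<open>J\<close>, which is a point over \<open>y0\<close>.\<close>
  have one: "(\<lambda>x. 1) \<in> J"
  proof (rule ccontr)
    assume proper: "(\<lambda>x. 1) \<notin> J"
    define p where "p v = (\<Sum>j\<le>e v. monom (a v j y0) j)" for v
    have p0: "p v \<noteq> 0" if "v \<in> V" for v
    proof -
      have "coeff (p v) (e v) = a v (e v) y0"
        unfolding p_def by (simp add: coeff_sum if_distrib cong: if_cong)
      moreover have "a v (e v) y0 \<noteq> 0"
        using y0 that finite_V unfolding lead_def by auto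
      ultimately show ?thesis by auto
    qed
    have pJ: "(\<lambda>x. poly (p v) (x v)) \<in> J" if "v \<in> V" for v
    proof -
      have "(\<lambda>x. \<Sum>j\<le>e v. (- (x v ^ j)) * (a v j (\<Phi> x) - a v j y0)) \<in> J"
        by (intro pf_ideal_sum[OF ideal] pf_idealD(4)[OF ideal] pfuns_uminus pfuns_power pfuns.var that
            pf_ideal_compose_diff[OF ideal \<phi> gen a])
      moreover have "(\<Sum>j\<le>e v. (- (x v ^ j)) * (a v j (\<Phi> x) - a v j y0)) = poly (p v) (x v)" for x
        using rel[OF that, of x]
        by (simp add: p_def poly_sum poly_monom algebra_simps sum_subtractf sum_negf sum.distrib)
      ultimately show ?thesis by simp
    qed
    obtain x where "\<forall>f\<in>J. f x = 0"
      using pf_ideal_common_zero[OF finite_V ideal proper p0 pJ] by blast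
    then show False using no gen by force
  qed
  then obtain h where h: "(\<lambda>x. 1) = (\<lambda>x. \<Sum>k\<in>K. (\<phi> k x - y0 k) * h k x)" "\<And>k. k \<in> K \<Longrightarrow> h k \<in> pfuns V"
    unfolding J_def by blast
  \<comment> \<open>Multiplying a generator by the expression for 1 as a combination of the
    \<open>\<phi> k - y0 k\<close> shows that it has coordinates in the maximal ideal
    \<open>M\<close> of \<open>y0\<close>.\<close>
  define M where "M = {c \<in> pfuns K. c y0 = 0}"
  have M: "pf_ideal K M"
    unfolding pf_ideal_def M_def by (auto intro: pfuns.intros)
  define Q where "Q \<beta> s c \<longleftrightarrow> (\<forall>\<alpha>\<in>exps. c \<alpha> \<in> M) \<and>
    (\<forall>x. lead (\<Phi> x) ^ s * monom_fun V \<beta> x = (\<Sum>\<alpha>\<in>exps. c \<alpha> (\<Phi> x) * monom_fun V \<alpha> x))" for \<beta> s c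
  have "\<exists>s c. Q \<beta> s c" if "\<beta> \<in> exps" for \<beta>
  proof -
    have "(\<lambda>x. \<Sum>k\<in>K. (\<phi> k x - y0 k) * (h k x * monom_fun V \<beta> x)) \<in> module_span M"
    proof (intro module_span_sum M)
      fix k assume k: "k \<in> K"
      show "(\<lambda>x. (\<phi> k x - y0 k) * (h k x * monom_fun V \<beta> x)) \<in> module_span M"
        by (rule module_span_mult[where h = "\<lambda>y. y k - y0 k", OF _ pfuns_mult_module_span])
           (auto simp: M_def intro!: pfuns.mult pfuns_diff pfuns.var pfuns.const k h monom_in_module_span that)
    qed
    moreover have "(\<Sum>k\<in>K. (\<phi> k x - y0 k) * (h k x * monom_fun V \<beta> x)) = monom_fun V \<beta> x" for x
      using fun_cong[OF h(1), of x] by (simp add: sum_distrib_right[symmetric] mult.assoc[symmetric])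
    ultimately show ?thesis unfolding module_span_def Q_def by simp
  qed
  then obtain s C where Q: "\<And>\<beta>. \<beta> \<in> exps \<Longrightarrow> Q \<beta> (s \<beta>) (C \<beta>)"
    by metis
  have C: "C \<beta> \<alpha> \<in> M" if "\<beta> \<in> exps" "\<alpha> \<in> exps" for \<alpha> \<beta>
    using Q[OF that(1)] that(2) unfolding Q_def by blast
  have sys: "lead (\<Phi> x) ^ s \<beta> * monom_fun V \<beta> x = (\<Sum>\<alpha>\<in>exps. C \<beta> \<alpha> (\<Phi> x) * monom_fun V \<alpha> x)"
    if "\<beta> \<in> exps" for \<beta> x
    using Q[OF that] unfolding Q_def by blast
  have "\<exists>D\<in>pfuns K. D y0 \<noteq> 0 \<and> (\<forall>y b. (\<forall>i\<in>exps. lead y ^ s i * b i = (\<Sum>j\<in>exps. C i j y * b j)) \<longrightarrow>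
      (\<forall>i\<in>exps. D y * b i = 0))"
    using nakayama_elimination[OF finite_exps, of "\<lambda>i y. lead y ^ s i" K y0 C] C y0 lead
    by (auto simp: M_def pfuns_power)
  then obtain D where D: "D \<in> pfuns K" "D y0 \<noteq> 0"
    "\<And>y b. (\<forall>i\<in>exps. lead y ^ s i * b i = (\<Sum>j\<in>exps. C i j y * b j)) \<Longrightarrow> (\<forall>i\<in>exps. D y * b i = 0)"
    by blast
  \<comment> \<open>The generator with all exponents zero is the constant 1, so \<open>D\<close>
    itself vanishes on the image.\<close>
  have "D (\<Phi> x) = 0" for x
  proof -
    have "\<forall>i\<in>exps. D (\<Phi> x) * monom_fun V i x = 0"
      by (rule D(3)) (use sys in blast)
    then show ?thesis using origin(1) origin(2)[of x] by (metis mult.right_neutral)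
  qed
  then show False using ind D(1,2) unfolding alg_independent_def by blast
qed

end

text \<open>Where \<open>lead\<close> is nonzero the fibre has a point; where \<open>H\<close> is
  nonzero every point of the fibre satisfies \<open>h x \<noteq> 0\<close>. The product of the two
  is still a nonzero polynomial.\<close>

theorem dominant_image:
  assumes V: "finite V" and K: "finite K" "card V \<le> card K"
    and \<phi>: "\<And>k. k \<in> K \<Longrightarrow> \<phi> k \<in> pfuns V" and ind: "alg_independent K \<phi>"
    and h: "h \<in> pfuns V" "h x0 \<noteq> 0"
  shows "\<exists>G\<in>pfuns K. (\<exists>y. G y \<noteq> 0) \<and> (\<forall>y. G y \<noteq> 0 \<longrightarrow> (\<exists>x. (\<forall>k\<in>K. \<phi> k x = y k) \<and> h x \<noteq> 0))"
proof -
  define Q where "Q v e a \<longleftrightarrow> (\<forall>j. a j \<in> pfuns K) \<and> (\<exists>y. a e y \<noteq> 0) \<and> 0 < e \<and>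
           (\<forall>x. (\<Sum>j\<le>e. a j (\<lambda>k. \<phi> k x) * x v ^ j) = 0)" for v e a
  have "\<exists>e a. Q v e a" if "v \<in> V" for v
    unfolding Q_def by (rule algebraic_relation[OF V K \<phi> ind pfuns.var[OF that]])
  then obtain e a where Q: "\<And>v. v \<in> V \<Longrightarrow> Q v (e v) (a v)"
    by metis
  have ea: "a v j \<in> pfuns K" "\<exists>y. a v (e v) y \<noteq> 0" "0 < e v"
    "(\<Sum>j\<le>e v. a v j (\<lambda>k. \<phi> k x) * x v ^ j) = 0" if "v \<in> V" for v j x
    using Q[OF that] unfolding Q_def by blast+
  interpret integral_relations V K \<phi> e a
    by unfold_locales (use V \<phi> ea in auto)
  obtain H where H: "H \<in> pfuns K" "\<exists>y. H y \<noteq> 0" "\<And>x. H (\<lambda>k. \<phi> k x) \<noteq> 0 \<Longrightarrow> h x \<noteq> 0"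
    using alg_independent_nonvanishing[OF V K \<phi> ind h] by blast
  obtain y1 where y1: "lead y1 \<noteq> 0"
    using pfuns_prod_nonzero[OF V, of "\<lambda>v. a v (e v)" K] ea unfolding lead_def by blast
  obtain y2 where y2: "H y2 \<noteq> 0" using H(2) by blast
  show ?thesis
  proof (intro bexI[of _ "\<lambda>y. lead y * H y"] conjI allI impI)
    show "\<exists>y. lead y * H y \<noteq> 0" by (rule pfuns_mult_nonzero[OF lead y1 H(1) y2])
    show "(\<lambda>y. lead y * H y) \<in> pfuns K" by (intro pfuns.mult lead H)
    fix y assume y: "lead y * H y \<noteq> 0"
    then have "lead y \<noteq> 0" by simp
    then obtain x where x: "\<forall>k\<in>K. \<phi> k x = y k" using point_over[OF K(1) ind] by blast
    have "H (\<lambda>k. \<phi> k x) = H y" by (rule pfuns_cong[OF H(1)]) (use x in blast)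
    then have "h x \<noteq> 0" using H(3)[of x] y by simp
    then show "\<exists>x. (\<forall>k\<in>K. \<phi> k x = y k) \<and> h x \<noteq> 0" using x by blast
  qed
qed

section \<open>Differential criteria for algebraic independence and dependence\<close>

text \<open>The lowest homogeneous part of a relation at \<open>\<phi>(\<gamma> 0)\<close> would have to vanish identically.\<close>

lemma alg_independentI_derivative:
  fixes \<phi> :: "'k \<Rightarrow> ('v \<Rightarrow> complex) \<Rightarrow> complex"
  assumes K: "finite K"
    and y0: "\<And>t::'k \<Rightarrow> complex. \<exists>\<gamma>. \<forall>k\<in>K. \<phi> k (\<gamma> 0) = y0 k \<and> ((\<lambda>s. \<phi> k (\<gamma> s)) has_field_derivative t k) (at 0)"
  shows "alg_independent K \<phi>"
  unfolding alg_independent_def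
proof (intro ballI impI allI, rule ccontr)
  fix G y1 assume G: "G \<in> pfuns K" and vanish: "\<forall>x. G (\<lambda>k. \<phi> k x) = 0" and y1: "G y1 \<noteq> 0"
  define G' where "G' z = G (\<lambda>k. y0 k + z k)" for z
  have "G' \<in> pfuns K" unfolding G'_def by (intro pfuns_compose[OF G] pfuns_intros)
  then obtain d c where c: "\<And>z. G' z = (\<Sum>e\<in>PiE K (\<lambda>_. {..d}). c e * (\<Prod>k\<in>K. z k ^ e k))"
    using pfuns_bounded_degrees[OF K] unfolding bounded_degrees_def by blast
  define E where "E = PiE K (\<lambda>_. {..d::nat})"
  have E: "finite E" unfolding E_def using K by (intro finite_PiE) auto
  define w where "w e = (\<Sum>k\<in>K. e k)" for e :: "'k \<Rightarrow> nat"
  have "\<exists>e\<in>E. c e \<noteq> 0"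
  proof (rule ccontr)
    assume "\<not> ?thesis"
    then have "G' (\<lambda>k. y1 k - y0 k) = 0" unfolding c E_def by simp
    then show False using y1 by (simp add: G'_def)
  qed
  then obtain e0 where e0: "e0 \<in> E" "c e0 \<noteq> 0" "\<And>e. e \<in> E \<Longrightarrow> c e \<noteq> 0 \<Longrightarrow> w e0 \<le> w e"
    using ex_has_least_nat[of "\<lambda>e. e \<in> E \<and> c e \<noteq> 0" _ w] by blast
  define m where "m = w e0"
  have "(\<Sum>e\<in>E. (if w e = m then c e else 0) * (\<Prod>k\<in>K. t k ^ e k)) = 0" for t
  proof -
    obtain \<gamma> where \<gamma>: "\<And>k. k \<in> K \<Longrightarrow> \<phi> k (\<gamma> 0) = y0 k"
      "\<And>k. k \<in> K \<Longrightarrow> ((\<lambda>s. \<phi> k (\<gamma> s)) has_field_derivative t k) (at 0)" using y0[of t] by blast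
    define q where "q k s = (\<phi> k (\<gamma> s) - y0 k) / s" for k s
    have q: "(q k \<longlongrightarrow> t k) (at 0)" if "k \<in> K" for k
      using \<gamma>(2)[OF that] \<gamma>(1)[OF that] unfolding q_def has_field_derivative_iff by simp
    \<comment> \<open>\<open>F s\<close> is the relation along the curve divided by
      \<open>s ^ m\<close>, hence zero for \<open>s \<noteq> 0\<close>; its limit at 0 is the part
      of degree \<open>m\<close> evaluated at the arbitrary vector \<open>t\<close>. The truncated
      \<open>w e - m\<close> is harmless because \<open>c e = 0\<close> whenever
      \<open>w e < m\<close>.\<close>
    define F where "F s = (\<Sum>e\<in>E. c e * s ^ (w e - m) * (\<Prod>k\<in>K. q k s ^ e k))" for s
    have "(F \<longlongrightarrow> (\<Sum>e\<in>E. c e * 0 ^ (w e - m) * (\<Prod>k\<in>K. t k ^ e k))) (at 0)"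
      unfolding F_def by (intro tendsto_intros q)
    moreover have "F s = 0" if s: "s \<noteq> 0" for s
    proof -
      have "s ^ m * F s = (\<Sum>e\<in>E. c e * (\<Prod>k\<in>K. (\<phi> k (\<gamma> s) - y0 k) ^ e k))"
        unfolding F_def sum_distrib_left
      proof (rule sum.cong[OF refl])
        fix e assume e: "e \<in> E"
        have "(\<Prod>k\<in>K. (\<phi> k (\<gamma> s) - y0 k) ^ e k) = (\<Prod>k\<in>K. s ^ e k * q k s ^ e k)"
          using s by (intro prod.cong) (auto simp: q_def power_mult_distrib[symmetric])
        also have "\<dots> = s ^ w e * (\<Prod>k\<in>K. q k s ^ e k)"
          by (simp add: prod.distrib w_def power_sum)
        finally have eq: "(\<Prod>k\<in>K. (\<phi> k (\<gamma> s) - y0 k) ^ e k) = s ^ w e * (\<Prod>k\<in>K. q k s ^ e k)" .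
        show "s ^ m * (c e * s ^ (w e - m) * (\<Prod>k\<in>K. q k s ^ e k))
           = c e * (\<Prod>k\<in>K. (\<phi> k (\<gamma> s) - y0 k) ^ e k)"
        proof (cases "c e = 0")
          case False
          then have "s ^ w e = s ^ m * s ^ (w e - m)"
            using e0(3)[OF e] by (simp add: m_def flip: power_add)
          then show ?thesis unfolding eq by simp
        qed simp
      qed
      also have "\<dots> = G' (\<lambda>k. \<phi> k (\<gamma> s) - y0 k)" unfolding c E_def ..
      also have "\<dots> = 0" using vanish by (simp add: G'_def)
      finally show ?thesis using s by simp
    qed
    then have "(F \<longlongrightarrow> 0) (at 0)"
      by (intro tendsto_eventually) (auto simp: eventually_at_filter)
    ultimately have "(\<Sum>e\<in>E. c e * 0 ^ (w e - m) * (\<Prod>k\<in>K. t k ^ e k)) = 0"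
      by (rule tendsto_unique[OF at_neq_bot])
    moreover have "c e * 0 ^ (w e - m) = (if w e = m then c e else 0)" if "e \<in> E" for e
      using e0(3)[OF that] by (cases "c e = 0") (auto simp: m_def power_0_left)
    ultimately show ?thesis by simp
  qed
  then have "(if w e0 = m then c e0 else 0) = 0"
    using monomials_independent[OF K, where B = "\<lambda>_. Suc d" and c = "\<lambda>e. if w e = m then c e else 0" and e = e0] e0(1)
    unfolding E_def lessThan_Suc_atMost by blast
  then show False using e0(2) by (simp add: m_def)
qed

lemma pfuns_DERIV_zero:
  assumes "f \<in> pfuns K" "\<And>k. k \<in> K \<Longrightarrow> ((\<lambda>s. \<gamma> s k) has_field_derivative 0) (at 0)"
  shows "((\<lambda>s. f (\<gamma> s)) has_field_derivative 0) (at (0::complex))"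
  using assms
proof (induction rule: pfuns.induct)
  case (add f g)
  then show ?case using DERIV_add[of _ 0 _ _ _ 0] by fastforce
next
  case (mult f g)
  then show ?case using DERIV_mult[of _ 0 _ _ _ 0] by fastforce
qed auto

text \<open>Differentiating a minimal relation between \<open>\<phi>\<close> and a coordinate along a direction in the kernel
  of the differential forces that coordinate of the direction to vanish.\<close>

theorem degenerate_not_alg_independent:
  assumes V: "finite V" and K: "finite K" "card V \<le> card K"
    and \<phi>: "\<And>k. k \<in> K \<Longrightarrow> \<phi> k \<in> pfuns V"
    and h: "h \<in> pfuns V" "h x0 \<noteq> 0"
    and ker: "\<And>x. h x \<noteq> 0 \<Longrightarrow> \<exists>u. (\<exists>v\<in>V. u v \<noteq> 0) \<and>
       (\<forall>k\<in>K. ((\<lambda>s. \<phi> k (\<lambda>v. x v + s * u v)) has_field_derivative 0) (at 0))"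
  shows "\<not> alg_independent K \<phi>"
proof
  assume ind: "alg_independent K \<phi>"
  define Q where "Q v a e \<longleftrightarrow> (\<forall>j. a j \<in> pfuns K) \<and> (\<forall>x. (\<Sum>j\<le>e. a j (\<lambda>k. \<phi> k x) * x v ^ j) = 0) \<and>
      (\<exists>x. (\<Sum>j<e. of_nat (Suc j) * a (Suc j) (\<lambda>k. \<phi> k x) * x v ^ j) \<noteq> 0)" for v a e
  have "\<exists>a e. Q v a e" if v: "v \<in> V" for v
  proof -
    \<comment> \<open>In a relation of least degree the derivative with respect to
      \<open>x v\<close> cannot vanish identically: in characteristic 0 it would be a relation of
      smaller degree.\<close>
    define P where "P e \<longleftrightarrow> (\<exists>a. (\<forall>j. a j \<in> pfuns K) \<and> (\<exists>y. a e y \<noteq> 0) \<and> 0 < e \<and>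
           (\<forall>x. (\<Sum>j\<le>e. a j (\<lambda>k. \<phi> k x) * x v ^ j) = 0))" for e
    have "\<exists>e. P e" unfolding P_def
      using algebraic_relation[OF V K \<phi> ind pfuns.var[OF v]] by blast
    then obtain e where e: "P e" "\<And>e'. e' < e \<Longrightarrow> \<not> P e'"
      by (metis exists_least_iff)
    then obtain a where a: "\<And>j. a j \<in> pfuns K" "\<exists>y. a e y \<noteq> 0" "0 < e"
      "\<And>x. (\<Sum>j\<le>e. a j (\<lambda>k. \<phi> k x) * x v ^ j) = 0" unfolding P_def by blast
    have "\<exists>x. (\<Sum>j<e. of_nat (Suc j) * a (Suc j) (\<lambda>k. \<phi> k x) * x v ^ j) \<noteq> 0"
    proof (rule ccontr)
      assume "\<not> ?thesis"
      then have 0: "\<And>x. (\<Sum>j\<le>e - 1. of_nat (Suc j) * a (Suc j) (\<lambda>k. \<phi> k x) * x v ^ j) = 0"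
        using a(3) by (simp add: lessThan_Suc_atMost[symmetric])
      have top: "\<exists>y. of_nat (Suc (e - 1)) * a (Suc (e - 1)) y \<noteq> 0" using a(2,3) by (simp add: mult_eq_0_iff del: of_nat_Suc)
      show False
      proof (cases "e = 1")
        case True
        then have "\<forall>x. a 1 (\<lambda>k. \<phi> k x) = 0" using 0 by simp
        then show False using ind a(1)[of 1] a(2) True unfolding alg_independent_def by blast
      next
        case False
        then have "P (e - 1)" unfolding P_def using 0 top a(1,3)
          by (intro exI[of _ "\<lambda>j y. of_nat (Suc j) * a (Suc j) y"]) (auto intro!: pfuns.mult pfuns.const simp del: of_nat_Suc)
        then show False using e(2)[of "e - 1"] a(3) by simp
      qed
    qed
    then show ?thesis using a unfolding Q_def by blast
  qed
  then obtain a e where Q: "\<And>v. v \<in> V \<Longrightarrow> Q v (a v) (e v)"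
    by metis
  have a: "a v j \<in> pfuns K"
    and rel: "(\<Sum>j\<le>e v. a v j (\<lambda>k. \<phi> k x) * x v ^ j) = 0"
    and nz: "\<exists>x. (\<Sum>j<e v. of_nat (Suc j) * a v (Suc j) (\<lambda>k. \<phi> k x) * x v ^ j) \<noteq> 0"
    if "v \<in> V" for v j x
    using Q[OF that] unfolding Q_def by blast+
  \<comment> \<open>The relation differentiated in \<open>x v\<close> with its coefficients held
    fixed. Along a kernel direction \<open>u\<close> the coefficients are stationary to first order,
    so the chain rule leaves \<open>D v x * u v = 0\<close>.\<close>
  define D where "D v x = (\<Sum>j<e v. of_nat (Suc j) * a v (Suc j) (\<lambda>k. \<phi> k x) * x v ^ j)" for v x
  have D: "D v \<in> pfuns V" if "v \<in> V" for v
    unfolding D_def by (intro pfuns_intros pfuns_compose[OF a] \<phi> that)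
  obtain x1 where x1: "(\<Prod>v\<in>V. D v x1) \<noteq> 0"
    using pfuns_prod_nonzero[OF V, of D V] D nz unfolding D_def by blast
  obtain x where x: "h x * (\<Prod>v\<in>V. D v x) \<noteq> 0"
    using pfuns_mult_nonzero[of h V x0 "\<lambda>x. \<Prod>v\<in>V. D v x" x1] pfuns_prod[of V D V] D h x1 by blast
  then have hx: "h x \<noteq> 0" and Dx: "\<And>v. v \<in> V \<Longrightarrow> D v x \<noteq> 0" using V by auto
  obtain u where u: "\<exists>v\<in>V. u v \<noteq> 0"
    "\<And>k. k \<in> K \<Longrightarrow> ((\<lambda>s. \<phi> k (\<lambda>v. x v + s * u v)) has_field_derivative 0) (at 0)"
    using ker[OF hx] by blast
  have "u v = 0" if v: "v \<in> V" for v
  proof -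
    have coef: "((\<lambda>s. a v j (\<lambda>k. \<phi> k (\<lambda>v. x v + s * u v))) has_field_derivative 0) (at 0)" for j
      by (rule pfuns_DERIV_zero[OF a[OF v]]) (use u(2) in auto)
    have pw: "((\<lambda>s. (x v + s * u v) ^ j) has_field_derivative of_nat j * x v ^ (j - 1) * u v) (at 0)" for j
      by (auto intro!: derivative_eq_intros)
    have "((\<lambda>s. \<Sum>j\<le>e v. a v j (\<lambda>k. \<phi> k (\<lambda>v. x v + s * u v)) * (x v + s * u v) ^ j)
       has_field_derivative (\<Sum>j\<le>e v. a v j (\<lambda>k. \<phi> k x) * (of_nat j * x v ^ (j - 1) * u v))) (at 0)"
      by (rule DERIV_sum) (rule derivative_eq_intros coef pw | simp)+
    moreover have "(\<lambda>s. \<Sum>j\<le>e v. a v j (\<lambda>k. \<phi> k (\<lambda>v. x v + s * u v)) * (x v + s * u v) ^ j) = (\<lambda>s. 0)"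
      using rel[OF v] by auto
    ultimately have "((\<lambda>s. 0) has_field_derivative
        (\<Sum>j\<le>e v. a v j (\<lambda>k. \<phi> k x) * (of_nat j * x v ^ (j - 1) * u v))) (at 0)" by metis
    then have "(\<Sum>j\<le>e v. a v j (\<lambda>k. \<phi> k x) * (of_nat j * x v ^ (j - 1) * u v)) = 0"
      by (rule DERIV_unique) (rule DERIV_const)
    moreover have "(\<Sum>j\<le>e v. a v j (\<lambda>k. \<phi> k x) * (of_nat j * x v ^ (j - 1) * u v)) = D v x * u v"
      unfolding D_def sum_distrib_right
      by (subst sum.atMost_shift) (simp add: mult_ac)
    ultimately show ?thesis using Dx[OF v] by simp
  qed
  then show False using u(1) by blast
qed

section \<open>Polynomials and forms\<close>

abbreviation Const :: "complex \<Rightarrow> 'v cpoly" where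
  "Const c \<equiv> Poly_Mapping.single 0 c"

abbreviation Mon :: "'v monomial \<Rightarrow> 'v cpoly" where
  "Mon m \<equiv> Poly_Mapping.single m 1"

abbreviation Var :: "'v \<Rightarrow> 'v cpoly" where
  "Var v \<equiv> Mon (Poly_Mapping.single v 1)"

lemma Const_mult: "Const (a * b) = Const a * Const b"
  by (simp add: mult_single)

lemma Const_power: "Const (a ^ k) = Const a ^ k"
  by (induction k) (simp_all add: Const_mult)

lemma Const_sum: "Const (\<Sum>i\<in>I. f i) = (\<Sum>i\<in>I. Const (f i))"
  by (induction I rule: infinite_finite_induct) (auto simp: single_add)

lemma Const_prod: "Const (\<Prod>i\<in>I. f i) = (\<Prod>i\<in>I. Const (f i))"
  by (induction I rule: infinite_finite_induct) (auto simp: Const_mult)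

lemma Const_mult_Mon: "Const c * Mon m = Poly_Mapping.single m c"
  by (simp add: mult_single)

lemma lookup_Const_mult: "Poly_Mapping.lookup (Const c * p) m = c * Poly_Mapping.lookup p m"
  by (simp add: Poly_Mapping.map.rep_eq when_def flip: mult_map_scale_conv_mult)

lemma cpoly_eq_sum:
  assumes "finite S" "Poly_Mapping.keys p \<subseteq> S"
  shows "p = (\<Sum>m\<in>S. Const (Poly_Mapping.lookup p m) * Mon m)"
proof (rule poly_mapping_eqI)
  fix k
  have "Poly_Mapping.lookup (\<Sum>m\<in>S. Const (Poly_Mapping.lookup p m) * Mon m) k
     = (\<Sum>m\<in>S. if m = k then Poly_Mapping.lookup p m else 0)"
    unfolding lookup_sum Const_mult_Mon by (rule sum.cong) (auto simp: lookup_single when_def)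
  also have "\<dots> = Poly_Mapping.lookup p k"
    using assms by (auto simp: in_keys_iff)
  finally show "Poly_Mapping.lookup p k
     = Poly_Mapping.lookup (\<Sum>m\<in>S. Const (Poly_Mapping.lookup p m) * Mon m) k" ..
qed

section \<open>Evaluation as a ring homomorphism\<close>

definition eval_mon :: "('v \<Rightarrow> complex) \<Rightarrow> 'v monomial \<Rightarrow> complex" where
  "eval_mon a m = (\<Prod>v\<in>Poly_Mapping.keys m. a v ^ Poly_Mapping.lookup m v)"

lemma eval_mon_superset:
  "finite S \<Longrightarrow> Poly_Mapping.keys m \<subseteq> S \<Longrightarrow> eval_mon a m = (\<Prod>v\<in>S. a v ^ Poly_Mapping.lookup m v)"
  unfolding eval_mon_def by (rule prod.mono_neutral_left) (auto simp: in_keys_iff)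

lemma eval_mon_add: "eval_mon a (m + m') = eval_mon a m * eval_mon a m'"
proof -
  let ?S = "Poly_Mapping.keys m \<union> Poly_Mapping.keys m'"
  have "eval_mon a (m + m') = (\<Prod>v\<in>?S. a v ^ Poly_Mapping.lookup (m + m') v)"
    by (rule eval_mon_superset) (use keys_add[of m m'] in auto)
  also have "\<dots> = (\<Prod>v\<in>?S. a v ^ Poly_Mapping.lookup m v) * (\<Prod>v\<in>?S. a v ^ Poly_Mapping.lookup m' v)"
    by (simp add: lookup_add power_add prod.distrib)
  also have "\<dots> = eval_mon a m * eval_mon a m'"
    by (subst (1 2) eval_mon_superset[of ?S]) auto
  finally show ?thesis .
qed

lemma eval_poly_superset:
  assumes "finite S" "Poly_Mapping.keys p \<subseteq> S"
  shows "eval_poly a p = (\<Sum>m\<in>S. Poly_Mapping.lookup p m * eval_mon a m)"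
  unfolding eval_poly_def eval_mon_def[symmetric]
  by (rule sum.mono_neutral_left) (use assms in \<open>auto simp: in_keys_iff\<close>)

lemma eval_poly_zero [simp]: "eval_poly a 0 = 0"
  by (simp add: eval_poly_def)

lemma eval_poly_single [simp]: "eval_poly a (Poly_Mapping.single m c) = c * eval_mon a m"
  using eval_poly_superset[of "{m}" "Poly_Mapping.single m c" a] by simp

lemma eval_mon_zero [simp]: "eval_mon a 0 = 1"
  by (simp add: eval_mon_def)

lemma eval_mon_single [simp]: "eval_mon a (Poly_Mapping.single v k) = a v ^ k"
  by (simp add: eval_mon_def)

lemma eval_poly_one [simp]: "eval_poly a 1 = 1"
  using eval_poly_single[of a 0 1] by simp

lemma eval_poly_add [simp]: "eval_poly a (p + q) = eval_poly a p + eval_poly a q"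
proof -
  let ?S = "Poly_Mapping.keys p \<union> Poly_Mapping.keys q"
  have "eval_poly a (p + q) = (\<Sum>m\<in>?S. Poly_Mapping.lookup (p + q) m * eval_mon a m)"
    by (rule eval_poly_superset) (use keys_add[of p q] in auto)
  also have "\<dots> = eval_poly a p + eval_poly a q"
    by (subst (1 2) eval_poly_superset[of ?S]) (auto simp: lookup_add algebra_simps sum.distrib)
  finally show ?thesis .
qed

lemma eval_poly_sum [simp]: "eval_poly a (\<Sum>i\<in>I. f i) = (\<Sum>i\<in>I. eval_poly a (f i))"
  by (induction I rule: infinite_finite_induct) auto

lemma eval_poly_mult [simp]: "eval_poly a (p * q) = eval_poly a p * eval_poly a q"
proof -
  let ?P = "Poly_Mapping.keys p" and ?Q = "Poly_Mapping.keys q"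
  let ?p = "Poly_Mapping.lookup p" and ?q = "Poly_Mapping.lookup q"
  have "p * q = (\<Sum>m\<in>?P. \<Sum>m'\<in>?Q. Poly_Mapping.single (m + m') (?p m * ?q m'))"
    by (subst cpoly_eq_sum[of ?P p], simp, simp, subst cpoly_eq_sum[of ?Q q], simp, simp)
       (simp add: sum_product mult_single)
  then have "eval_poly a (p * q) = (\<Sum>m\<in>?P. \<Sum>m'\<in>?Q. (?p m * eval_mon a m) * (?q m' * eval_mon a m'))"
    by (simp add: eval_mon_add mult_ac)
  also have "\<dots> = eval_poly a p * eval_poly a q"
    by (simp add: eval_poly_superset[of ?P p] eval_poly_superset[of ?Q q] sum_product)
  finally show ?thesis .
qed

lemma eval_poly_power [simp]: "eval_poly a (p ^ k) = eval_poly a p ^ k"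
  by (induction k) auto

lemma eval_poly_prod [simp]: "eval_poly a (\<Prod>i\<in>I. f i) = (\<Prod>i\<in>I. eval_poly a (f i))"
  by (induction I rule: infinite_finite_induct) auto

lemma eval_poly_uminus [simp]: "eval_poly a (- p) = - eval_poly a p"
  using eval_poly_add[of a p "- p"] by (simp add: eq_neg_iff_add_eq_0 add.commute del: eval_poly_add)

lemma eval_poly_diff [simp]: "eval_poly a (p - q) = eval_poly a p - eval_poly a q"
  using eval_poly_add[of a p "- q"] by simp

lemma pfuns_eq_eval_poly:
  assumes "f \<in> pfuns V"
  shows "\<exists>g. \<forall>a. eval_poly a g = f a"
  using assms
proof (induction rule: pfuns.induct)
  case (const c)
  show ?case by (rule exI[of _ "Const c"]) simp
next
  case (var v)
  show ?case by (rule exI[of _ "Var v"]) simp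
next
  case (add f g)
  then show ?case by (metis eval_poly_add)
next
  case (mult f g)
  then show ?case by (metis eval_poly_mult)
qed

lemma eval_poly_in_pfuns:
  "(\<lambda>y. eval_poly (\<lambda>m. if m \<in> V then y m else 0) g) \<in> pfuns V"
  unfolding eval_poly_def
proof (intro pfuns_sum pfuns.mult pfuns.const pfuns_prod pfuns_power)
  show "(\<lambda>y. if v \<in> V then y v else 0) \<in> pfuns V" for v
    by (cases "v \<in> V") (auto intro: pfuns.intros)
qed

section \<open>Monomials and forms of a fixed degree\<close>

lemma monomial_degree_superset:
  "finite S \<Longrightarrow> Poly_Mapping.keys m \<subseteq> S \<Longrightarrow> monomial_degree m = (\<Sum>v\<in>S. Poly_Mapping.lookup m v)"
  unfolding monomial_degree_def by (rule sum.mono_neutral_left) (auto simp: in_keys_iff)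

lemma monomial_degree_add: "monomial_degree (m + m') = monomial_degree m + monomial_degree m'"
proof -
  let ?S = "Poly_Mapping.keys m \<union> Poly_Mapping.keys m'"
  have "monomial_degree (m + m') = (\<Sum>v\<in>?S. Poly_Mapping.lookup (m + m') v)"
    by (rule monomial_degree_superset) (use keys_add[of m m'] in auto)
  then show ?thesis
    by (subst (1 2) monomial_degree_superset[of ?S]) (auto simp: lookup_add sum.distrib)
qed

lemma monomial_degree_zero [simp]: "monomial_degree 0 = 0"
  by (simp add: monomial_degree_def)

lemma monomial_degree_single [simp]: "monomial_degree (Poly_Mapping.single v k) = k"
  by (simp add: monomial_degree_def)

definition mons :: "nat \<Rightarrow> nat \<Rightarrow> nat monomial set" where
  "mons n d = {m. Poly_Mapping.keys m \<subseteq> {..n} \<and> monomial_degree m = d}"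

lemma forms_iff: "F \<in> forms n d \<longleftrightarrow> Poly_Mapping.keys F \<subseteq> mons n d"
  unfolding forms_def mons_def by auto

lemma finite_mons: "finite (mons n d)"
proof (rule finite_imageD)
  let ?f = "\<lambda>m. restrict (Poly_Mapping.lookup m) {..n}"
  show "inj_on ?f (mons n d)"
  proof (rule inj_onI, rule poly_mapping_eqI)
    fix m m' :: "nat monomial" and v assume m: "m \<in> mons n d" "m' \<in> mons n d" "?f m = ?f m'"
    show "Poly_Mapping.lookup m v = Poly_Mapping.lookup m' v"
    proof (cases "v \<le> n")
      case True
      then show ?thesis using fun_cong[OF m(3), of v] by simp
    next
      case False
      then have "v \<notin> Poly_Mapping.keys m" "v \<notin> Poly_Mapping.keys m'"
        using m(1,2) unfolding mons_def by auto
      then show ?thesis by (simp add: in_keys_iff)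
    qed
  qed
  have "Poly_Mapping.lookup m v \<le> d" if "m \<in> mons n d" "v \<le> n" for m v
  proof -
    have "(\<Sum>v\<le>n. Poly_Mapping.lookup m v) = d"
      using that monomial_degree_superset[of "{..n}" m] by (simp add: mons_def)
    then show ?thesis using member_le_sum[of v "{..n}" "Poly_Mapping.lookup m"] that by auto
  qed
  then have "?f ` mons n d \<subseteq> PiE {..n} (\<lambda>_. {..d})" by (auto simp: PiE_iff split: if_splits)
  then show "finite (?f ` mons n d)" by (rule finite_subset) (auto intro: finite_PiE)
qed

lemma forms_zero: "0 \<in> forms n d"
  by (simp add: forms_iff)

lemma forms_add: "F \<in> forms n d \<Longrightarrow> G \<in> forms n d \<Longrightarrow> F + G \<in> forms n d"
  unfolding forms_iff using keys_add[of F G] by blast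

lemma forms_sum: "(\<And>i. i \<in> I \<Longrightarrow> f i \<in> forms n d) \<Longrightarrow> (\<Sum>i\<in>I. f i) \<in> forms n d"
  by (induction I rule: infinite_finite_induct) (auto intro: forms_zero forms_add)

lemma forms_mult:
  assumes "F \<in> forms n d" "G \<in> forms n e"
  shows "F * G \<in> forms n (d + e)"
proof -
  have "a + b \<in> mons n (d + e)" if "a \<in> mons n d" "b \<in> mons n e" for a b
    using that keys_add[of a b] by (auto simp: mons_def monomial_degree_add)
  then show ?thesis using assms keys_mult[of F G] unfolding forms_iff by blast
qed

lemma forms_Mon: "m \<in> mons n d \<Longrightarrow> Mon m \<in> forms n d"
  by (simp add: forms_iff)

lemma forms_Const: "Const c \<in> forms n 0"
  by (simp add: forms_iff mons_def)

lemma forms_one: "1 \<in> forms n 0"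
  using forms_Const[of 1] by simp

lemma forms_Const_mult: "F \<in> forms n d \<Longrightarrow> Const c * F \<in> forms n d"
  using forms_mult[OF forms_Const, of F n d c] by simp

lemma forms_uminus: "F \<in> forms n d \<Longrightarrow> - F \<in> forms n d"
  by (simp add: forms_iff)

lemma forms_diff: "F \<in> forms n d \<Longrightarrow> G \<in> forms n d \<Longrightarrow> F - G \<in> forms n d"
  using forms_add[OF _ forms_uminus, of F n d G] by simp

lemma forms_power: "F \<in> forms n d \<Longrightarrow> F ^ k \<in> forms n (k * d)"
  by (induction k) (auto intro: forms_mult forms_one)

lemma forms_prod: "(\<And>i. i \<in> I \<Longrightarrow> F i \<in> forms n 1) \<Longrightarrow> finite I \<Longrightarrow> (\<Prod>i\<in>I. F i) \<in> forms n (card I)"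
proof (induction I rule: infinite_finite_induct)
  case (insert i I)
  then have "F i * (\<Prod>i\<in>I. F i) \<in> forms n (1 + card I)" by (intro forms_mult) auto
  then show ?case using insert by simp
qed (auto intro: forms_one)

lemma forms_Var: "v \<le> n \<Longrightarrow> Var v \<in> forms n 1"
  by (intro forms_Mon) (simp add: mons_def)

lemma forms_eq_sum: "F \<in> forms n d \<Longrightarrow> F = (\<Sum>m\<in>mons n d. Const (Poly_Mapping.lookup F m) * Mon m)"
  by (rule cpoly_eq_sum[OF finite_mons]) (simp add: forms_iff)

lemma forms_lookup_outside: "F \<in> forms n d \<Longrightarrow> m \<notin> mons n d \<Longrightarrow> Poly_Mapping.lookup F m = 0"
  unfolding forms_iff by (auto simp: in_keys_iff)

lemma mons_0: "mons n 0 = {0}"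
proof -
  have "m = 0" if "m \<in> mons n 0" for m
  proof (rule poly_mapping_eqI)
    fix v show "Poly_Mapping.lookup m v = Poly_Mapping.lookup 0 v"
      using that by (cases "v \<in> Poly_Mapping.keys m") (auto simp: mons_def monomial_degree_def in_keys_iff)
  qed
  then show ?thesis by (auto simp: mons_def)
qed

lemma forms_0_eq: "F \<in> forms n 0 \<Longrightarrow> F = Const (Poly_Mapping.lookup F 0)"
  using forms_eq_sum[of F n 0] by (simp add: mons_0 mult_single)

lemma mons_Suc_split:
  assumes "m \<in> mons n (Suc d)"
  shows "\<exists>v\<le>n. \<exists>m'\<in>mons n d. m = Poly_Mapping.single v 1 + m'"
proof -
  have "Poly_Mapping.keys m \<noteq> {}" using assms by (auto simp: mons_def monomial_degree_def)
  then obtain v where v: "v \<in> Poly_Mapping.keys m" by blast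
  define m' where "m' = m - Poly_Mapping.single v 1"
  have m: "m = Poly_Mapping.single v 1 + m'"
  proof (rule poly_mapping_eqI)
    fix k show "Poly_Mapping.lookup m k = Poly_Mapping.lookup (Poly_Mapping.single v 1 + m') k"
      using v by (auto simp: m'_def lookup_add lookup_minus lookup_single when_def in_keys_iff)
  qed
  have "monomial_degree m' = d"
    using assms arg_cong[OF m, of monomial_degree] by (simp add: monomial_degree_add mons_def)
  moreover have "Poly_Mapping.keys m' \<subseteq> Poly_Mapping.keys m"
    by (auto simp: m'_def in_keys_iff lookup_minus)
  ultimately have "m' \<in> mons n d" using assms by (auto simp: mons_def)
  moreover have "v \<le> n" using v assms by (auto simp: mons_def)
  ultimately show ?thesis using m by blast
qed

lemma forms_Suc_split:
  assumes "F \<in> forms n (Suc d)"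
  shows "\<exists>G. (\<forall>v\<le>n. G v \<in> forms n d) \<and> F = (\<Sum>v\<le>n. Var v * G v)"
proof -
  let ?P = "\<lambda>F. \<exists>G. (\<forall>v\<le>n. G v \<in> forms n d) \<and> F = (\<Sum>v\<le>n. Var v * G v)"
  have add: "?P (F + F')" if F: "?P F" "?P F'" for F F'
  proof -
    obtain G G' where "\<forall>v\<le>n. G v \<in> forms n d" "F = (\<Sum>v\<le>n. Var v * G v)"
      "\<forall>v\<le>n. G' v \<in> forms n d" "F' = (\<Sum>v\<le>n. Var v * G' v)" using F by blast
    then show ?thesis
      by (intro exI[of _ "\<lambda>v. G v + G' v"]) (simp add: forms_add distrib_left sum.distrib)
  qed
  have zero: "?P 0" by (intro exI[of _ "\<lambda>_. 0"]) (simp add: forms_zero)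
  have sum: "?P (\<Sum>i\<in>I. f i)" if "finite I" "\<And>i. i \<in> I \<Longrightarrow> ?P (f i)" for I :: "nat monomial set" and f
    using that by (induction I) (use zero add in auto)
  have "?P (Const (Poly_Mapping.lookup F m) * Mon m)" if m: "m \<in> mons n (Suc d)" for m
  proof -
    obtain v m' where v: "v \<le> n" "m' \<in> mons n d" "m = Poly_Mapping.single v 1 + m'"
      using mons_Suc_split[OF m] by blast
    let ?c = "Poly_Mapping.lookup F m"
    have "(\<Sum>u\<le>n. Var u * (if u = v then Const ?c * Mon m' else 0)) = Const ?c * Mon m"
      using v by (simp add: if_distrib mult_single cong: if_cong)
    then show ?thesis
      by (intro exI[of _ "\<lambda>u. if u = v then Const ?c * Mon m' else 0"])
         (simp add: forms_zero forms_Const_mult forms_Mon v del: single_one)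
  qed
  then have "?P (\<Sum>m\<in>mons n (Suc d). Const (Poly_Mapping.lookup F m) * Mon m)"
    by (intro sum finite_mons)
  then show ?thesis using forms_eq_sum[OF assms] by simp
qed

section \<open>Genericity\<close>

definition form_of :: "nat \<Rightarrow> nat \<Rightarrow> (nat monomial \<Rightarrow> complex) \<Rightarrow> nat cpoly" where
  "form_of n d y = (\<Sum>m\<in>mons n d. Const (y m) * Mon m)"

lemma form_of: "form_of n d y \<in> forms n d"
  unfolding form_of_def by (intro forms_sum forms_Const_mult forms_Mon)

lemma lookup_form_of: "Poly_Mapping.lookup (form_of n d y) m = (if m \<in> mons n d then y m else 0)"
proof -
  have "Poly_Mapping.lookup (form_of n d y) m = (\<Sum>m'\<in>mons n d. if m' = m then y m' else 0)"
    unfolding form_of_def lookup_sum Const_mult_Mon by (rule sum.cong) (auto simp: lookup_single when_def)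
  then show ?thesis by (simp add: finite_mons)
qed

lemma pfuns_lookup_form_of: "G \<in> pfuns (mons n d) \<Longrightarrow> G (Poly_Mapping.lookup (form_of n d y)) = G y"
  by (rule pfuns_cong[of G "mons n d"]) (simp_all add: lookup_form_of)

lemma generic_formI:
  assumes G: "G \<in> pfuns (mons n d)" "G y \<noteq> 0"
    and P: "\<And>F. F \<in> forms n d \<Longrightarrow> G (Poly_Mapping.lookup F) \<noteq> 0 \<Longrightarrow> P F"
  shows "generic_form n d P"
proof -
  obtain g where g: "\<And>a. eval_poly a g = G a" using pfuns_eq_eval_poly[OF G(1)] by blast
  let ?U = "forms n d - {F \<in> forms n d. \<forall>g\<in>{g}. eval_poly (Poly_Mapping.lookup F) g = 0}"
  have "form_of n d y \<in> ?U"
    using form_of G(2) by (simp add: g pfuns_lookup_form_of[OF G(1)])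
  moreover have "zariski_open n d ?U" unfolding zariski_open_def by blast
  ultimately show ?thesis
    unfolding generic_form_def using P g by (intro exI[of _ ?U]) auto
qed

lemma generic_formD:
  assumes "generic_form n d P"
  obtains G y where "G \<in> pfuns (mons n d)" "G y \<noteq> 0"
    "\<And>F. F \<in> forms n d \<Longrightarrow> G (Poly_Mapping.lookup F) \<noteq> 0 \<Longrightarrow> P F"
proof -
  obtain U where U: "zariski_open n d U" "U \<noteq> {}" "\<And>F. F \<in> U \<Longrightarrow> P F"
    using assms unfolding generic_form_def by blast
  obtain Gs where Gs: "U = forms n d - {F \<in> forms n d. \<forall>g\<in>Gs. eval_poly (Poly_Mapping.lookup F) g = 0}"
    using U(1) unfolding zariski_open_def by blast
  obtain F0 g where F0: "F0 \<in> forms n d" "g \<in> Gs" "eval_poly (Poly_Mapping.lookup F0) g \<noteq> 0"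
    using U(2) Gs by blast
  \<comment> \<open>The polynomial may involve variables outside \<open>mons n d\<close>. These are
    zero on forms of degree \<open>d\<close>, so cutting them off does not change its values
    there.\<close>
  define G where "G y = eval_poly (\<lambda>m. if m \<in> mons n d then y m else 0) g" for y
  have eq: "G (Poly_Mapping.lookup F) = eval_poly (Poly_Mapping.lookup F) g" if "F \<in> forms n d" for F
  proof -
    have "(\<lambda>m. if m \<in> mons n d then Poly_Mapping.lookup F m else 0) = Poly_Mapping.lookup F"
      using forms_lookup_outside[OF that] by auto
    then show ?thesis by (simp add: G_def)
  qed
  show ?thesis
  proof (rule that)
    show "G \<in> pfuns (mons n d)" unfolding G_def by (rule eval_poly_in_pfuns)
    show "G (Poly_Mapping.lookup F0) \<noteq> 0" using eq F0 by simp
    show "P F" if "F \<in> forms n d" "G (Poly_Mapping.lookup F) \<noteq> 0" for F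
      using that eq F0(2) by (intro U(3)) (auto simp: Gs)
  qed
qed

text \<open>Irreducibility of affine space: two nonempty open sets meet. This turns generic
  non-presentability into the failure of generic presentability.\<close>

lemma generic_form_not_both:
  assumes "generic_form n d P" "generic_form n d (\<lambda>F. \<not> P F)"
  shows False
proof -
  obtain G y where G: "G \<in> pfuns (mons n d)" "G y \<noteq> 0"
    "\<And>F. F \<in> forms n d \<Longrightarrow> G (Poly_Mapping.lookup F) \<noteq> 0 \<Longrightarrow> P F"
    using generic_formD[OF assms(1)] by blast
  obtain H z where H: "H \<in> pfuns (mons n d)" "H z \<noteq> 0"
    "\<And>F. F \<in> forms n d \<Longrightarrow> H (Poly_Mapping.lookup F) \<noteq> 0 \<Longrightarrow> \<not> P F"
    using generic_formD[OF assms(2)] by blast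
  obtain w where w: "G w * H w \<noteq> 0" using pfuns_mult_nonzero[of G "mons n d" y H z] G H by blast
  then show False
    using G(3)[OF form_of, of w] H(3)[OF form_of, of w]
    by (simp add: pfuns_lookup_form_of[OF G(1)] pfuns_lookup_form_of[OF H(1)])
qed

section \<open>Polynomial families of polynomials\<close>

text \<open>Polynomials whose coefficients depend polynomially on parameters, built as sums of fixed
  polynomials with scalar factors; the two sets of variables stay apart.\<close>

inductive_set families :: "'v set \<Rightarrow> (('v \<Rightarrow> complex) \<Rightarrow> 'w cpoly) set" for V :: "'v set" where
  scale: "f \<in> pfuns V \<Longrightarrow> (\<lambda>x. Const (f x) * p) \<in> families V"
| add: "\<Phi> \<in> families V \<Longrightarrow> \<Psi> \<in> families V \<Longrightarrow> (\<lambda>x. \<Phi> x + \<Psi> x) \<in> families V"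

lemma families_const: "(\<lambda>x. p) \<in> families V"
  using families.scale[OF pfuns.const[of 1], of p] by simp

lemma families_Const: "f \<in> pfuns V \<Longrightarrow> (\<lambda>x. Const (f x)) \<in> families V"
  using families.scale[of f V 1] by simp

lemma families_mult_scale:
  "\<Psi> \<in> families V \<Longrightarrow> f \<in> pfuns V \<Longrightarrow> (\<lambda>x. Const (f x) * p * \<Psi> x) \<in> families V"
proof (induction rule: families.induct)
  case (scale g q)
  have "(\<lambda>x. Const (f x * g x) * (p * q)) \<in> families V"
    by (intro families.scale pfuns.mult scale)
  then show ?case by (simp add: Const_mult mult_ac)
next
  case (add \<Phi> \<Psi>)
  then show ?case using families.add by (fastforce simp: distrib_left)
qed

lemma families_mult: "\<Phi> \<in> families V \<Longrightarrow> \<Psi> \<in> families V \<Longrightarrow> (\<lambda>x. \<Phi> x * \<Psi> x) \<in> families V"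
proof (induction rule: families.induct)
  case (scale g q)
  then show ?case by (rule families_mult_scale[rotated])
next
  case (add \<Phi> \<Phi>')
  then show ?case using families.add by (fastforce simp: distrib_right)
qed

lemma families_sum: "(\<And>i. i \<in> I \<Longrightarrow> f i \<in> families V) \<Longrightarrow> (\<lambda>x. \<Sum>i\<in>I. f i x) \<in> families V"
  by (induction I rule: infinite_finite_induct) (auto intro: families_const families.add)

lemma families_prod: "(\<And>i. i \<in> I \<Longrightarrow> f i \<in> families V) \<Longrightarrow> (\<lambda>x. \<Prod>i\<in>I. f i x) \<in> families V"
  by (induction I rule: infinite_finite_induct) (auto intro: families_const families_mult)

lemma families_lookup: "\<Phi> \<in> families V \<Longrightarrow> (\<lambda>x. Poly_Mapping.lookup (\<Phi> x) m) \<in> pfuns V"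
  by (induction rule: families.induct)
     (auto simp: lookup_Const_mult lookup_add intro: pfuns.intros)

text \<open>A deformation is encoded as a polynomial in one parameter whose coefficients are forms.
  Its derivative at 0 is then the purely algebraic \<open>coeff q 1\<close>.\<close>

lemma lookup_poly_DERIV:
  "((\<lambda>s. Poly_Mapping.lookup (poly q (Const s)) m) has_field_derivative
     Poly_Mapping.lookup (coeff q 1) m) (at 0)"
proof -
  define r where "r = (\<Sum>i\<le>degree q. monom (Poly_Mapping.lookup (coeff q i) m) i)"
  have "Poly_Mapping.lookup (poly q (Const s)) m = poly r s" for s
  proof -
    have "poly q (Const s) = (\<Sum>i\<le>degree q. Const (s ^ i) * coeff q i)"
      by (simp add: poly_altdef Const_power mult.commute[of _ "Const s ^ _"])
    then show ?thesis
      by (simp add: r_def lookup_sum lookup_Const_mult poly_sum poly_monom mult.commute[of "s ^ _"])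
  qed
  moreover have "poly (pderiv r) 0 = Poly_Mapping.lookup (coeff q 1) m"
    by (auto simp: poly_0_coeff_0 coeff_pderiv r_def coeff_sum if_distrib not_le coeff_eq_0 cong: if_cong)
  ultimately show ?thesis using poly_DERIV[of r 0] by simp
qed

section \<open>Linear forms and star configurations\<close>

lemma independent_image_iff:
  assumes I: "finite I"
  shows "inj_on L I \<and> cpoly.independent (L ` I) \<longleftrightarrow>
    (\<forall>b. (\<Sum>i\<in>I. Const (b i) * L i) = 0 \<longrightarrow> (\<forall>i\<in>I. b i = 0))" (is "_ \<longleftrightarrow> ?R")
proof
  assume "inj_on L I \<and> cpoly.independent (L ` I)"
  then have inj: "inj_on L I" and ind: "cpoly.independent (L ` I)" by blast+
  show ?R
  proof (intro allI impI ballI)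
    fix b i assume b: "(\<Sum>i\<in>I. Const (b i) * L i) = 0" and i: "i \<in> I"
    have "(\<Sum>v\<in>L ` I. cpoly_scale (b (the_inv_into I L v)) v) = (\<Sum>i\<in>I. Const (b i) * L i)"
      using inj by (subst sum.reindex) (auto simp: cpoly_scale_def the_inv_into_f_f intro: sum.cong)
    then have "b (the_inv_into I L (L i)) = 0"
      using ind b i I by (subst (asm) cpoly.independent_explicit_finite_subsets) (auto dest!: spec[of _ "L ` I"])
    then show "b i = 0" using inj i by (simp add: the_inv_into_f_f)
  qed
next
  assume R: ?R
  have inj: "inj_on L I"
  proof (rule inj_onI, rule ccontr)
    fix i j assume ij: "i \<in> I" "j \<in> I" "L i = L j" "i \<noteq> j"
    define b where "b k = (if k = i then 1 else if k = j then - 1 else 0 :: complex)" for k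
    have "(\<Sum>k\<in>I. Const (b k) * L k) = (\<Sum>k\<in>{i, j}. Const (b k) * L k)"
      by (rule sum.mono_neutral_right) (use I ij in \<open>auto simp: b_def\<close>)
    also have "\<dots> = 0" using ij by (simp add: b_def single_uminus)
    finally have "b i = 0" using R ij(1) by blast
    then show False by (simp add: b_def)
  qed
  moreover have "cpoly.independent (L ` I)"
  proof
    assume "cpoly.dependent (L ` I)"
    then obtain u where u: "\<exists>v\<in>L ` I. u v \<noteq> 0" "(\<Sum>v\<in>L ` I. cpoly_scale (u v) v) = 0"
      using cpoly.dependent_finite[of "L ` I"] I by auto
    have "(\<Sum>i\<in>I. Const (u (L i)) * L i) = 0"
      using u(2) inj by (simp add: sum.reindex cpoly_scale_def)
    then show False using R u(1) by (auto dest!: spec[of _ "\<lambda>i. u (L i)"])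
  qed
  ultimately show "inj_on L I \<and> cpoly.independent (L ` I)" ..
qed

lemma independent_family_iff:
  "finite I \<Longrightarrow> independent_family L I \<longleftrightarrow>
    (\<forall>b. (\<Sum>i\<in>I. Const (b i) * L i) = 0 \<longrightarrow> (\<forall>i\<in>I. b i = 0))"
  unfolding independent_family_def by (rule independent_image_iff)

section \<open>The ideal of a star configuration in one degree\<close>

definition subs :: "nat \<Rightarrow> nat \<Rightarrow> nat set set" where
  "subs l r = {\<sigma>. \<sigma> \<subseteq> {1..l} \<and> card \<sigma> = r}"

lemma finite_subs: "finite (subs l r)"
  unfolding subs_def by (rule finite_subset[of _ "Pow {1..l}"]) auto

lemma subsD: "\<sigma> \<in> subs l r \<Longrightarrow> \<sigma> \<subseteq> {1..l}" "\<sigma> \<in> subs l r \<Longrightarrow> card \<sigma> = r" "\<sigma> \<in> subs l r \<Longrightarrow> finite \<sigma>"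
  unfolding subs_def by (auto intro: finite_subset)

definition star :: "nat \<Rightarrow> nat \<Rightarrow> nat \<Rightarrow> nat \<Rightarrow> (nat \<Rightarrow> nat cpoly) \<Rightarrow> nat cpoly set" where
  "star n l r d L = {F. \<exists>M. (\<forall>\<sigma>\<in>subs l r. M \<sigma> \<in> forms n (d - r)) \<and> F = (\<Sum>\<sigma>\<in>subs l r. (\<Prod>i\<in>\<sigma>. L i) * M \<sigma>)}"

lemma presentable_iff_star:
  "presentable n l r d F \<longleftrightarrow> (\<exists>L. general_linear_forms n l L \<and> F \<in> star n l r d L)"
  unfolding presentable_def star_def subs_def by auto

lemma star_zero: "0 \<in> star n l r d L"
  unfolding star_def by (auto intro!: exI[of _ "\<lambda>_. 0"] forms_zero)

lemma star_add:
  assumes "F \<in> star n l r d L" "G \<in> star n l r d L"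
  shows "F + G \<in> star n l r d L"
proof -
  obtain M M' where "\<forall>\<sigma>\<in>subs l r. M \<sigma> \<in> forms n (d - r)" "F = (\<Sum>\<sigma>\<in>subs l r. (\<Prod>i\<in>\<sigma>. L i) * M \<sigma>)"
    "\<forall>\<sigma>\<in>subs l r. M' \<sigma> \<in> forms n (d - r)" "G = (\<Sum>\<sigma>\<in>subs l r. (\<Prod>i\<in>\<sigma>. L i) * M' \<sigma>)"
    using assms unfolding star_def by blast
  then show ?thesis
    unfolding star_def by (auto intro!: exI[of _ "\<lambda>\<sigma>. M \<sigma> + M' \<sigma>"] forms_add simp: distrib_left sum.distrib)
qed

lemma star_sum: "(\<And>i. i \<in> I \<Longrightarrow> f i \<in> star n l r d L) \<Longrightarrow> (\<Sum>i\<in>I. f i) \<in> star n l r d L"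
  by (induction I rule: infinite_finite_induct) (auto intro: star_zero star_add)

lemma star_single:
  assumes "\<sigma> \<in> subs l r" "A \<in> forms n (d - r)"
  shows "(\<Prod>i\<in>\<sigma>. L i) * A \<in> star n l r d L"
proof -
  have "(\<Sum>\<sigma>'\<in>subs l r. (\<Prod>i\<in>\<sigma>'. L i) * (if \<sigma>' = \<sigma> then A else 0)) = (\<Prod>i\<in>\<sigma>. L i) * A"
    using assms(1) by (simp add: if_distrib finite_subs cong: if_cong)
  then show ?thesis
    unfolding star_def using assms by (auto intro!: exI[of _ "\<lambda>\<sigma>'. if \<sigma>' = \<sigma> then A else 0"] forms_zero)
qed

lemma star_insert_single:
  assumes "\<rho> \<in> subs l r" "i \<in> {1..l} - \<rho>" "A \<in> forms n (d - Suc r)"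
  shows "(\<Prod>i\<in>\<rho>. L i) * (L i * A) \<in> star n l (Suc r) d L"
proof -
  have "insert i \<rho> \<in> subs l (Suc r)" using assms by (auto simp: subs_def finite_subset)
  then have "(\<Prod>i\<in>insert i \<rho>. L i) * A \<in> star n l (Suc r) d L" using assms(3) by (rule star_single)
  then show ?thesis using assms(2) subsD(3)[OF assms(1)] by (simp add: mult_ac)
qed

text \<open>The Leibniz rule to first order, for factors that are linear in the deformation
  parameter.\<close>

lemma coeff_prod_linear:
  fixes a b :: "'i \<Rightarrow> 'a::comm_ring_1"
  assumes "finite S"
  shows "coeff (\<Prod>i\<in>S. [:a i, b i:]) 0 = (\<Prod>i\<in>S. a i)"
    and "coeff (\<Prod>i\<in>S. [:a i, b i:]) 1 = (\<Sum>i\<in>S. b i * (\<Prod>j\<in>S - {i}. a j))"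
proof -
  show 0: "coeff (\<Prod>i\<in>S. [:a i, b i:]) 0 = (\<Prod>i\<in>S. a i)" for S
    by (induction S rule: infinite_finite_induct) (auto simp: coeff_mult)
  show "coeff (\<Prod>i\<in>S. [:a i, b i:]) 1 = (\<Sum>i\<in>S. b i * (\<Prod>j\<in>S - {i}. a j))"
    using assms
  proof (induction S)
    case (insert k S)
    have "(\<Prod>j\<in>insert k S - {i}. a j) = a k * (\<Prod>j\<in>S - {i}. a j)" if "i \<in> S" for i
    proof -
      have "insert k S - {i} = insert k (S - {i})" using that insert.hyps by auto
      then show ?thesis using insert.hyps by simp
    qed
    then have "(\<Sum>i\<in>S. b i * (\<Prod>j\<in>insert k S - {i}. a j)) = a k * (\<Sum>i\<in>S. b i * (\<Prod>j\<in>S - {i}. a j))"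
      by (simp add: sum_distrib_left mult_ac)
    moreover have "insert k S - {k} = S" using insert.hyps by auto
    ultimately show ?case using insert 0[of S] by (simp add: coeff_mult del: insert_Diff_single)
  qed simp
qed

text \<open>A certificate of independence made of finitely many values. Such values vary
  polynomially in a family, so independence persists on an open set.\<close>

definition dual_points :: "nat set \<Rightarrow> (nat \<Rightarrow> nat cpoly) \<Rightarrow> bool" where
  "dual_points I L \<longleftrightarrow> (\<exists>B. \<forall>i\<in>I. \<forall>j\<in>I. eval_poly (B j) (L i) = (if i = j then 1 else 0))"

lemma dual_points_independent:
  assumes "finite I" "dual_points I L"
  shows "independent_family L I"
  unfolding independent_family_iff[OF assms(1)]
proof (intro allI impI ballI)
  fix b j assume b: "(\<Sum>i\<in>I. Const (b i) * L i) = 0" and j: "j \<in> I"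
  obtain B where B: "\<And>i j. i \<in> I \<Longrightarrow> j \<in> I \<Longrightarrow> eval_poly (B j) (L i) = (if i = j then 1 else 0)"
    using assms(2) unfolding dual_points_def by blast
  have "0 = eval_poly (B j) (\<Sum>i\<in>I. Const (b i) * L i)" unfolding b by simp
  also have "\<dots> = (\<Sum>i\<in>I. if i = j then b i else 0)" by (simp add: B j if_distrib cong: if_cong)
  also have "\<dots> = b j" using assms(1) j by simp
  finally show "b j = 0" ..
qed

lemma dual_points_open:
  assumes I: "finite I" and L: "\<And>i. i \<in> I \<Longrightarrow> (\<lambda>x. L x i) \<in> families V" and dual: "dual_points I (L x0)"
  shows "\<exists>D\<in>pfuns V. D x0 \<noteq> 0 \<and> (\<forall>x. D x \<noteq> 0 \<longrightarrow> independent_family (L x) I)"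
proof -
  obtain B where B: "\<And>i j. i \<in> I \<Longrightarrow> j \<in> I \<Longrightarrow> eval_poly (B j) (L x0 i) = (if i = j then 1 else 0)"
    using dual unfolding dual_points_def by blast
  \<comment> \<open>The identity minus the evaluation matrix. It vanishes at \<open>x0\<close>, and
    the coefficients of a linear relation among the forms are fixed by it, so the elimination lemma
    applies with \<open>u = 1\<close>.\<close>
  define C where "C j i x = (if i = j then 1 else 0) - eval_poly (B j) (L x i)" for j i x
  have eval: "(\<lambda>x. eval_poly b (\<Phi> x)) \<in> pfuns V" if "\<Phi> \<in> families V" for b and \<Phi> :: "_ \<Rightarrow> nat cpoly"
    using that by (induction rule: families.induct) (auto intro: pfuns.intros)
  have "\<exists>D\<in>pfuns V. D x0 \<noteq> 0 \<and>
    (\<forall>y b. (\<forall>i\<in>I. 1 * b i = (\<Sum>j\<in>I. C i j y * b j)) \<longrightarrow> (\<forall>i\<in>I. D y * b i = 0))"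
    by (rule nakayama_elimination[OF I, where u = "\<lambda>_ _. 1"])
       (auto simp: C_def B intro!: pfuns.const pfuns_diff pfuns_uminus eval L)
  then obtain D where D: "D \<in> pfuns V" "D x0 \<noteq> 0"
    "\<And>y b. (\<forall>i\<in>I. b i = (\<Sum>j\<in>I. C i j y * b j)) \<Longrightarrow> \<forall>i\<in>I. D y * b i = 0"
    by auto
  have "independent_family (L x) I" if "D x \<noteq> 0" for x
    unfolding independent_family_iff[OF I]
  proof (intro allI impI)
    fix b assume b: "(\<Sum>i\<in>I. Const (b i) * L x i) = 0"
    have "b j = (\<Sum>i\<in>I. C j i x * b i)" if j: "j \<in> I" for j
    proof -
      have "0 = eval_poly (B j) (\<Sum>i\<in>I. Const (b i) * L x i)" unfolding b by simp
      then have 0: "(\<Sum>i\<in>I. b i * eval_poly (B j) (L x i)) = 0" by simp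
      have "(\<Sum>i\<in>I. C j i x * b i) = (\<Sum>i\<in>I. if i = j then b i else 0) - (\<Sum>i\<in>I. b i * eval_poly (B j) (L x i))"
        unfolding C_def sum_subtractf[symmetric] by (rule sum.cong) (auto simp: algebra_simps)
      then show ?thesis using 0 I j by simp
    qed
    then have "\<forall>i\<in>I. D x * b i = 0" using D(3) by blast
    then show "\<forall>i\<in>I. b i = 0" using that by simp
  qed
  then show ?thesis using D by blast
qed

text \<open>The minimum merges the two clauses of generality: for \<open>l < n + 1\<close> the only
  set of this size is \<open>{1..l}\<close>.\<close>

definition index_sets :: "nat \<Rightarrow> nat \<Rightarrow> nat set set" where
  "index_sets n l = {I. I \<subseteq> {1..l} \<and> card I = min l (n + 1)}"

lemma general_linear_forms_iff:
  "general_linear_forms n l L \<longleftrightarrow>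
     (\<forall>i\<in>{1..l}. L i \<in> forms n 1) \<and> (\<forall>I\<in>index_sets n l. independent_family L I)"
proof (cases "l < n + 1")
  case True
  have "I = {1..l}" if "I \<subseteq> {1..l}" "card I = l" for I :: "nat set"
    using card_subset_eq[OF _ that(1)] that(2) by simp
  then have "index_sets n l = {{1..l}}" using True unfolding index_sets_def by auto
  then show ?thesis using True by (simp add: general_linear_forms_def)
next
  case False
  then show ?thesis by (auto simp: general_linear_forms_def index_sets_def min_def)
qed

text \<open>The hypothesis \<open>tangent\<close> says that the differential at
  \<open>(L, M)\<close> is onto. A chosen preimage of each monomial spans a slice with one parameter
  per coefficient of the form, where the differential becomes the identity; the equality of the two
  numbers is what \<open>dominant_image\<close> requires.\<close>

theorem tangent_space_generic:
  assumes rd: "r \<le> d"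
    and L: "\<And>i. i \<in> {1..l} \<Longrightarrow> L i \<in> forms n 1"
    and M: "\<And>\<sigma>. \<sigma> \<in> subs l r \<Longrightarrow> M \<sigma> \<in> forms n (d - r)"
    and dual: "\<And>I. I \<in> index_sets n l \<Longrightarrow> dual_points I L"
    and tangent: "\<And>F. F \<in> forms n d \<Longrightarrow> \<exists>L' M'. (\<forall>i\<in>{1..l}. L' i \<in> forms n 1) \<and>
      (\<forall>\<sigma>\<in>subs l r. M' \<sigma> \<in> forms n (d - r)) \<and>
      F = (\<Sum>\<sigma>\<in>subs l r. (\<Prod>i\<in>\<sigma>. L i) * M' \<sigma> + (\<Sum>i\<in>\<sigma>. L' i * (\<Prod>j\<in>\<sigma> - {i}. L j)) * M \<sigma>)"
  shows "generic_form n d (\<lambda>F. presentable n l r d F)"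
proof -
  let ?K = "mons n d"
  define Q where "Q m L' M' \<longleftrightarrow> (\<forall>i\<in>{1..l}. L' i \<in> forms n 1) \<and>
      (\<forall>\<sigma>\<in>subs l r. M' \<sigma> \<in> forms n (d - r)) \<and>
      Mon m = (\<Sum>\<sigma>\<in>subs l r. (\<Prod>i\<in>\<sigma>. L i) * M' \<sigma> + (\<Sum>i\<in>\<sigma>. L' i * (\<Prod>j\<in>\<sigma> - {i}. L j)) * M \<sigma>)"
    for m L' M'
  have "\<exists>L' M'. Q m L' M'" if "m \<in> ?K" for m
    unfolding Q_def by (rule tangent[OF forms_Mon[OF that]])
  then obtain L' M' where Q: "\<And>m. m \<in> ?K \<Longrightarrow> Q m (L' m) (M' m)" by metis
  define Lx where "Lx x i = L i + (\<Sum>m\<in>?K. Const (x m) * L' m i)" for x i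
  define Mx where "Mx x \<sigma> = M \<sigma> + (\<Sum>m\<in>?K. Const (x m) * M' m \<sigma>)" for x \<sigma>
  define \<Phi> where "\<Phi> x = (\<Sum>\<sigma>\<in>subs l r. (\<Prod>i\<in>\<sigma>. Lx x i) * Mx x \<sigma>)" for x
  define \<phi> where "\<phi> k x = Poly_Mapping.lookup (\<Phi> x) k" for k x
  have Lx: "(\<lambda>x. Lx x i) \<in> families ?K" for i
    unfolding Lx_def by (intro families.add families_const families_sum families.scale pfuns.var)
  have Mx: "(\<lambda>x. Mx x \<sigma>) \<in> families ?K" for \<sigma>
    unfolding Mx_def by (intro families.add families_const families_sum families.scale pfuns.var)
  have \<phi>: "\<phi> k \<in> pfuns ?K" for k
    unfolding \<phi>_def \<Phi>_def by (intro families_lookup families_sum families_mult families_prod Lx Mx)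
  have Lx_form: "Lx x i \<in> forms n 1" if "i \<in> {1..l}" for x i
    unfolding Lx_def using Q that by (intro forms_add forms_sum forms_Const_mult L) (auto simp: Q_def)
  have Mx_form: "Mx x \<sigma> \<in> forms n (d - r)" if "\<sigma> \<in> subs l r" for x \<sigma>
    unfolding Mx_def using Q that by (intro forms_add forms_sum forms_Const_mult M) (auto simp: Q_def)
  have \<Phi>_form: "\<Phi> x \<in> forms n d" for x
    unfolding \<Phi>_def
  proof (intro forms_sum)
    fix \<sigma> assume \<sigma>: "\<sigma> \<in> subs l r"
    have "(\<Prod>i\<in>\<sigma>. Lx x i) \<in> forms n r"
      using forms_prod[of \<sigma> "Lx x" n] subsD[OF \<sigma>] Lx_form by blast
    from forms_mult[OF this Mx_form[OF \<sigma>]] show "(\<Prod>i\<in>\<sigma>. Lx x i) * Mx x \<sigma> \<in> forms n d"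
      using rd by simp
  qed
  have indep: "alg_independent ?K \<phi>"
  proof (rule alg_independentI_derivative[OF finite_mons, where ?y0.0 = "\<lambda>k. \<phi> k (\<lambda>_. 0)"])
    fix t :: "nat monomial \<Rightarrow> complex"
    define Lt where "Lt i = (\<Sum>m\<in>?K. Const (t m) * L' m i)" for i
    define Mt where "Mt \<sigma> = (\<Sum>m\<in>?K. Const (t m) * M' m \<sigma>)" for \<sigma>
    \<comment> \<open>The deformation of the presentation along \<open>t\<close>. Its linear
      coefficient is the differential, computed below to be the form with coefficients
      \<open>t\<close>.\<close>
    define q where "q = (\<Sum>\<sigma>\<in>subs l r. (\<Prod>i\<in>\<sigma>. [:L i, Lt i:]) * [:M \<sigma>, Mt \<sigma>:])"
    have q: "\<Phi> (\<lambda>m. s * t m) = poly q (Const s)" for s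
    proof -
      have "Lx (\<lambda>m. s * t m) i = L i + Const s * Lt i" for i
        by (simp add: Lx_def Lt_def Const_mult sum_distrib_left mult_ac)
      moreover have "Mx (\<lambda>m. s * t m) \<sigma> = M \<sigma> + Const s * Mt \<sigma>" for \<sigma>
        by (simp add: Mx_def Mt_def Const_mult sum_distrib_left mult_ac)
      ultimately show ?thesis by (simp add: \<Phi>_def q_def poly_sum poly_prod algebra_simps)
    qed
    have "coeff q 1 = (\<Sum>\<sigma>\<in>subs l r. (\<Prod>i\<in>\<sigma>. L i) * Mt \<sigma> + (\<Sum>i\<in>\<sigma>. Lt i * (\<Prod>j\<in>\<sigma> - {i}. L j)) * M \<sigma>)"
      unfolding q_def coeff_sum
    proof (rule sum.cong[OF refl])
      fix \<sigma> assume "\<sigma> \<in> subs l r"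
      note \<sigma> = subsD(3)[OF this]
      show "coeff ((\<Prod>i\<in>\<sigma>. [:L i, Lt i:]) * [:M \<sigma>, Mt \<sigma>:]) 1 =
        (\<Prod>i\<in>\<sigma>. L i) * Mt \<sigma> + (\<Sum>i\<in>\<sigma>. Lt i * (\<Prod>j\<in>\<sigma> - {i}. L j)) * M \<sigma>"
        using coeff_prod_linear[OF \<sigma>, of L Lt] by (simp add: coeff_mult)
    qed
    also have "\<dots> = (\<Sum>m\<in>?K. Const (t m) * (\<Sum>\<sigma>\<in>subs l r. (\<Prod>i\<in>\<sigma>. L i) * M' m \<sigma> +
        (\<Sum>i\<in>\<sigma>. L' m i * (\<Prod>j\<in>\<sigma> - {i}. L j)) * M \<sigma>))"
    proof -
      have "(\<Prod>i\<in>\<sigma>. L i) * Mt \<sigma> + (\<Sum>i\<in>\<sigma>. Lt i * (\<Prod>j\<in>\<sigma> - {i}. L j)) * M \<sigma> =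
        (\<Sum>m\<in>?K. Const (t m) * ((\<Prod>i\<in>\<sigma>. L i) * M' m \<sigma> + (\<Sum>i\<in>\<sigma>. L' m i * (\<Prod>j\<in>\<sigma> - {i}. L j)) * M \<sigma>))" for \<sigma>
      proof -
        have "(\<Sum>i\<in>\<sigma>. Lt i * (\<Prod>j\<in>\<sigma> - {i}. L j)) = (\<Sum>m\<in>?K. \<Sum>i\<in>\<sigma>. Const (t m) * (L' m i * (\<Prod>j\<in>\<sigma> - {i}. L j)))"
          unfolding Lt_def sum_distrib_right by (subst sum.swap) (simp add: mult.assoc)
        then show ?thesis
          unfolding Mt_def by (simp add: sum_distrib_left sum_distrib_right sum.distrib algebra_simps)
      qed
      then show ?thesis by (simp add: sum.swap[of _ ?K] sum_distrib_left)
    qed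
    also have "\<dots> = (\<Sum>m\<in>?K. Const (t m) * Mon m)"
      by (rule sum.cong[OF refl]) (use Q in \<open>simp add: Q_def\<close>)
    also have "\<dots> = form_of n d t" by (simp add: form_of_def)
    finally have "coeff q 1 = form_of n d t" .
    then have "((\<lambda>s. \<phi> k (\<lambda>m. s * t m)) has_field_derivative t k) (at 0)" if "k \<in> ?K" for k
      using lookup_poly_DERIV[of q k] that unfolding \<phi>_def q by (simp add: lookup_form_of)
    then show "\<exists>\<gamma>. \<forall>k\<in>?K. \<phi> k (\<gamma> 0) = \<phi> k (\<lambda>_. 0) \<and> ((\<lambda>s. \<phi> k (\<gamma> s)) has_field_derivative t k) (at 0)"
      by (intro exI[of _ "\<lambda>s m. s * t m"]) simp
  qed
  have fin: "finite (index_sets n l)"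
    unfolding index_sets_def by (rule finite_subset[of _ "Pow {1..l}"]) auto
  have "\<exists>D\<in>pfuns ?K. D (\<lambda>_. 0) \<noteq> 0 \<and> (\<forall>x. D x \<noteq> 0 \<longrightarrow> independent_family (Lx x) I)"
    if I: "I \<in> index_sets n l" for I
  proof (rule dual_points_open)
    show "finite I" using I by (auto simp: index_sets_def intro: finite_subset)
    have "Lx (\<lambda>_. 0) = L" by (simp add: Lx_def fun_eq_iff)
    then show "dual_points I (Lx (\<lambda>_. 0))" using dual[OF I] by simp
  qed (rule Lx)
  then obtain D where D: "\<And>I. I \<in> index_sets n l \<Longrightarrow> D I \<in> pfuns ?K"
    "\<And>I. I \<in> index_sets n l \<Longrightarrow> D I (\<lambda>_. 0) \<noteq> 0"
    "\<And>I x. I \<in> index_sets n l \<Longrightarrow> D I x \<noteq> 0 \<Longrightarrow> independent_family (Lx x) I"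
    by metis
  \<comment> \<open>The point found in the fibre must also have linear forms in general position;
    \<open>h\<close> is the open condition ensuring this.\<close>
  define h where "h x = (\<Prod>I\<in>index_sets n l. D I x)" for x
  have h: "h \<in> pfuns ?K" "h (\<lambda>_. 0) \<noteq> 0"
    unfolding h_def using D fin by (auto intro: pfuns_prod)
  obtain G where G: "G \<in> pfuns ?K" "\<exists>y. G y \<noteq> 0"
    "\<And>y. G y \<noteq> 0 \<Longrightarrow> \<exists>x. (\<forall>k\<in>?K. \<phi> k x = y k) \<and> h x \<noteq> 0"
    using dominant_image[of ?K ?K \<phi> h "\<lambda>_. 0"] finite_mons \<phi> indep h by auto
  from G(2) obtain y where y: "G y \<noteq> 0" by blast
  show ?thesis
  proof (rule generic_formI[OF G(1) y])
    fix F assume F: "F \<in> forms n d" "G (Poly_Mapping.lookup F) \<noteq> 0"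
    then obtain x where x: "\<forall>k\<in>?K. \<phi> k x = Poly_Mapping.lookup F k" "h x \<noteq> 0"
      using G(3) by blast
    have "F = \<Phi> x"
    proof (rule poly_mapping_eqI)
      fix k show "Poly_Mapping.lookup F k = Poly_Mapping.lookup (\<Phi> x) k"
        using x(1) forms_lookup_outside[OF F(1)] forms_lookup_outside[OF \<Phi>_form]
        by (cases "k \<in> ?K") (auto simp: \<phi>_def)
    qed
    moreover have "general_linear_forms n l (Lx x)"
      unfolding general_linear_forms_iff using Lx_form D(3) x(2) fin by (auto simp: h_def)
    ultimately show "presentable n l r d F"
      unfolding presentable_iff_star star_def \<Phi>_def using Mx_form by blast
  qed
qed

section \<open>The moment curve\<close>

definition lagrange :: "nat set \<Rightarrow> nat \<Rightarrow> complex poly" where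
  "lagrange I i = smult (1 / (\<Prod>k\<in>I - {i}. of_nat i - of_nat k)) (\<Prod>k\<in>I - {i}. [:- of_nat k, 1:])"

lemma degree_prod_roots: "finite I \<Longrightarrow> degree (\<Prod>k\<in>I. [:- of_nat k, 1:] :: complex poly) = card I"
  by (subst degree_prod_eq_sum_degree) auto

lemma degree_lagrange:
  assumes "finite I" "i \<in> I"
  shows "degree (lagrange I i) < card I"
proof -
  have "degree (lagrange I i) \<le> card (I - {i})"
    unfolding lagrange_def using degree_prod_roots[of "I - {i}"] assms by (intro order_trans[OF degree_smult_le]) simp
  also have "\<dots> < card I" using assms by (rule card_Diff1_less)
  finally show ?thesis .
qed

lemma poly_lagrange:
  assumes "finite I" "i \<in> I" "j \<in> I"
  shows "poly (lagrange I i) (of_nat j) = (if i = j then 1 else 0)"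
  using assms by (auto simp: lagrange_def poly_prod)

lemma lagrange_interpolation:
  assumes I: "finite I" and p: "degree p < card I"
  shows "p = (\<Sum>i\<in>I. smult (poly p (of_nat i)) (lagrange I i))"
proof (rule poly_eqI_degree[of "of_nat ` I"])
  show "poly p x = poly (\<Sum>i\<in>I. smult (poly p (of_nat i)) (lagrange I i)) x" if x: "x \<in> of_nat ` I" for x
  proof -
    obtain j where j: "j \<in> I" "x = of_nat j" using x by blast
    have "poly (\<Sum>i\<in>I. smult (poly p (of_nat i)) (lagrange I i)) x
       = (\<Sum>i\<in>I. if i = j then poly p (of_nat i) else 0)"
      unfolding j(2) poly_sum by (rule sum.cong) (auto simp: poly_lagrange I j(1))
    then show ?thesis using I j by simp
  qed
  have card: "card (of_nat ` I :: complex set) = card I" by (simp add: card_image)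
  show "degree p < card (of_nat ` I :: complex set)" using p card by simp
  show "degree (\<Sum>i\<in>I. smult (poly p (of_nat i)) (lagrange I i)) < card (of_nat ` I :: complex set)"
    unfolding card
    by (rule degree_sum_less) (use p degree_lagrange[OF I] in \<open>auto intro: le_less_trans[OF degree_smult_le]\<close>)
qed

text \<open>When a point is read as the coefficient vector of a polynomial of degree at most
  \<open>n\<close>, this linear form evaluates the polynomial at \<open>i\<close>. General position
  thus reduces to Lagrange interpolation.\<close>

definition vd :: "nat \<Rightarrow> nat \<Rightarrow> nat cpoly" where
  "vd n i = (\<Sum>v\<le>n. Const (of_nat i ^ v) * Var v)"

lemma vd_form: "vd n i \<in> forms n 1"
  unfolding vd_def by (intro forms_sum forms_Const_mult forms_Var) simp

lemma eval_vd:
  assumes "degree p \<le> n"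
  shows "eval_poly (coeff p) (vd n i) = poly p (of_nat i)"
proof -
  have "eval_poly (coeff p) (vd n i) = (\<Sum>v\<le>n. coeff p v * of_nat i ^ v)"
    by (simp add: vd_def mult.commute)
  also have "\<dots> = (\<Sum>v\<le>degree p. coeff p v * of_nat i ^ v)"
    by (rule sum.mono_neutral_right) (use assms in \<open>auto simp: coeff_eq_0\<close>)
  finally show ?thesis by (simp add: poly_altdef)
qed

lemma vd_dual_points:
  assumes "finite I" "card I \<le> n + 1"
  shows "dual_points I (vd n)"
proof -
  have "eval_poly (coeff (lagrange I j)) (vd n i) = (if i = j then 1 else 0)" if "i \<in> I" "j \<in> I" for i j
  proof -
    have "degree (lagrange I j) \<le> n" using degree_lagrange[OF assms(1) that(2)] assms(2) by simp
    then show ?thesis using that poly_lagrange[OF assms(1), of j i] by (auto simp: eval_vd)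
  qed
  then show ?thesis unfolding dual_points_def
    by (intro exI[of _ "\<lambda>j. coeff (lagrange I j)"] ballI)
qed

lemma vd_dual_points_index_sets: "I \<in> index_sets n l \<Longrightarrow> dual_points I (vd n)"
  by (rule vd_dual_points) (auto simp: index_sets_def intro: finite_subset)

lemma vd_general: "general_linear_forms n l (vd n)"
  unfolding general_linear_forms_iff
  by (auto simp del: One_nat_def intro!: vd_form dual_points_independent vd_dual_points_index_sets)
     (auto simp: index_sets_def intro: finite_subset)

text \<open>A transposition: the coefficients at exponent \<open>v\<close> in the hypotheses, for
  all \<open>w\<close> together, are the coefficients of the \<open>Var w\<close> on the right-hand
  side.\<close>

lemma Var_eq_vd:
  assumes I: "finite I" and v: "v \<le> n"
    and c: "\<And>w. w \<le> n \<Longrightarrow> monom 1 w = smult (c w) q + (\<Sum>i\<in>I. smult (of_nat i ^ w) (l i))"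
  shows "Var v = Const (coeff q v) * (\<Sum>w\<le>n. Const (c w) * Var w) + (\<Sum>i\<in>I. Const (coeff (l i) v) * vd n i)"
proof -
  have "(\<Sum>i\<in>I. Const (coeff (l i) v) * vd n i)
      = (\<Sum>w\<le>n. Const (\<Sum>i\<in>I. of_nat i ^ w * coeff (l i) v) * Var w)"
    unfolding vd_def Const_sum sum_distrib_left sum_distrib_right
    by (subst sum.swap) (simp add: Const_mult mult_ac del: Const_mult_Mon)
  moreover have "Const (coeff q v) * (\<Sum>w\<le>n. Const (c w) * Var w)
      = (\<Sum>w\<le>n. Const (c w * coeff q v) * Var w)"
    by (simp add: sum_distrib_left Const_mult mult_ac)
  ultimately have "Const (coeff q v) * (\<Sum>w\<le>n. Const (c w) * Var w) + (\<Sum>i\<in>I. Const (coeff (l i) v) * vd n i)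
      = (\<Sum>w\<le>n. Const (c w * coeff q v + (\<Sum>i\<in>I. of_nat i ^ w * coeff (l i) v)) * Var w)"
    by (simp add: sum.distrib single_add distrib_right)
  also have "\<dots> = (\<Sum>w\<le>n. if w = v then Var w else 0)"
  proof (rule sum.cong[OF refl])
    fix w assume "w \<in> {..n}"
    then have "coeff (monom (1::complex) w) v = c w * coeff q v + (\<Sum>i\<in>I. of_nat i ^ w * coeff (l i) v)"
      using c[of w] by (simp add: coeff_sum)
    then show "Const (c w * coeff q v + (\<Sum>i\<in>I. of_nat i ^ w * coeff (l i) v)) * Var w = (if w = v then Var w else 0)"
      by (auto simp flip: \<open>coeff (monom 1 w) v = _\<close>)
  qed
  also have "\<dots> = Var v" using v by simp
  finally show ?thesis ..
qed

lemma Var_in_span_vd: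
  assumes "finite I" "card I = n + 1" "v \<le> n"
  shows "Var v = (\<Sum>i\<in>I. Const (coeff (lagrange I i) v) * vd n i)"
proof -
  have "monom 1 w = smult 0 0 + (\<Sum>i\<in>I. smult (of_nat i ^ w) (lagrange I i))" if "w \<le> n" for w
    using lagrange_interpolation[OF assms(1), of "monom 1 w"] that assms(2)
    by (simp add: degree_monom_eq poly_monom)
  from Var_eq_vd[OF assms(1,3), where c = "\<lambda>_. 0" and q = 0, OF this] show ?thesis by simp
qed

section \<open>Points of the configuration and forms modulo their ideals\<close>

text \<open>The monic polynomial with root set \<tau>, as a point. If \<tau> has \<open>n\<close>
  elements it is the intersection of the hyperplanes in \<tau>, normalised to last coordinate
  1.\<close>

definition pt :: "nat set \<Rightarrow> nat \<Rightarrow> complex" where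
  "pt \<tau> = coeff (\<Prod>i\<in>\<tau>. [:- of_nat i, 1:])"

lemma eval_pt_vd:
  "finite \<tau> \<Longrightarrow> card \<tau> \<le> n \<Longrightarrow> eval_poly (pt \<tau>) (vd n i) = (\<Prod>k\<in>\<tau>. of_nat i - of_nat k)"
  unfolding pt_def by (subst eval_vd) (auto simp: degree_prod_roots poly_prod)

lemma eval_pt_Var:
  assumes "finite \<tau>" "card \<tau> = n"
  shows "eval_poly (pt \<tau>) (Var n) = 1"
proof -
  have "lead_coeff (\<Prod>i\<in>\<tau>. [:- of_nat i, 1:] :: complex poly) = 1"
    by (simp add: lead_coeff_prod)
  then show ?thesis using assms by (simp add: pt_def degree_prod_roots)
qed

text \<open>Powers below \<open>n\<close> are recovered from their values on \<tau> by
  interpolation. The power \<open>n\<close> minus the monic polynomial with roots \<tau> has degree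
  below \<open>n\<close> and the same values on \<tau>, so it is interpolated too.\<close>

lemma linear_mod_point:
  assumes \<tau>: "finite \<tau>" "card \<tau> = n" and v: "v \<le> n"
  shows "Var v = Const (pt \<tau> v) * Var n + (\<Sum>i\<in>\<tau>. Const (coeff (lagrange \<tau> i) v) * vd n i)"
proof -
  let ?Q = "\<Prod>i\<in>\<tau>. [:- of_nat i, 1:] :: complex poly"
  have *: "monom 1 w = smult (if w = n then 1 else 0) ?Q + (\<Sum>i\<in>\<tau>. smult (of_nat i ^ w) (lagrange \<tau> i))"
    if w: "w \<le> n" for w
  proof (cases "w = n")
    case False
    then show ?thesis
      using lagrange_interpolation[OF \<tau>(1), of "monom 1 w"] w \<tau>(2) by (simp add: degree_monom_eq poly_monom)
  next
    case True
    define R where "R = monom 1 n - ?Q"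
    have Qi: "poly ?Q (of_nat i) = 0" if "i \<in> \<tau>" for i using that \<tau>(1) by (auto simp: poly_prod)
    have deg: "degree ?Q = n" using degree_prod_roots[OF \<tau>(1)] \<tau>(2) by simp
    have R: "R = (\<Sum>i\<in>\<tau>. smult (of_nat i ^ n) (lagrange \<tau> i))"
    proof (cases "n = 0")
      case True
      then have "\<tau> = {}" using \<tau> by simp
      then show ?thesis using True by (simp add: R_def)
    next
      case False
      have "degree R \<le> n" unfolding R_def using deg by (intro degree_diff_le) (auto simp: degree_monom_le)
      moreover have "coeff R n = 0"
        using eval_pt_Var[OF \<tau>] by (simp add: R_def pt_def)
      ultimately have "degree R < n"
        using False by (metis degree_0 leading_coeff_0_iff le_neq_implies_less neq0_conv)
      then have "R = (\<Sum>i\<in>\<tau>. smult (poly R (of_nat i)) (lagrange \<tau> i))"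
        by (intro lagrange_interpolation \<tau>) (simp add: \<tau>)
      also have "\<dots> = (\<Sum>i\<in>\<tau>. smult (of_nat i ^ n) (lagrange \<tau> i))"
        by (rule sum.cong[OF refl]) (simp add: R_def Qi poly_monom)
      finally show ?thesis .
    qed
    then show ?thesis using True by (simp add: R_def algebra_simps)
  qed
  have "(\<Sum>w\<le>n. Const (if w = n then 1 else 0) * Var w) = (\<Sum>w\<le>n. if w = n then Var w else 0)"
    by (rule sum.cong) auto
  then show ?thesis using Var_eq_vd[OF \<tau>(1) v *] by (simp add: pt_def)
qed

text \<open>The hyperplanes through a point generate its ideal, with control of degrees: split off
  one variable, reduce it by the linear case and its cofactor by induction.\<close>

lemma form_mod_point:
  assumes \<tau>: "finite \<tau>" "card \<tau> = n" and A: "A \<in> forms n e"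
  shows "\<exists>B. (\<forall>i\<in>\<tau>. B i \<in> forms n (e - 1)) \<and>
    A = Const (eval_poly (pt \<tau>) A) * Var n ^ e + (\<Sum>i\<in>\<tau>. vd n i * B i)"
  using A
proof (induction e arbitrary: A)
  case 0
  then obtain c where "A = Const c" using forms_0_eq by blast
  then show ?case by (intro exI[of _ "\<lambda>_. 0"]) (simp add: forms_zero)
next
  case (Suc e)
  obtain G where G: "\<And>v. v \<le> n \<Longrightarrow> G v \<in> forms n e" "A = (\<Sum>v\<le>n. Var v * G v)"
    using forms_Suc_split[OF Suc.prems] by blast
  define Q where "Q v B \<longleftrightarrow> (\<forall>i\<in>\<tau>. B i \<in> forms n e) \<and>
    Var v * G v = Const (eval_poly (pt \<tau>) (Var v * G v)) * Var n ^ Suc e + (\<Sum>i\<in>\<tau>. vd n i * B i)" for v B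
  have "\<exists>B. Q v B"
    if v: "v \<le> n" for v
  proof -
    obtain B where B: "\<forall>i\<in>\<tau>. B i \<in> forms n (e - 1)"
      "G v = Const (eval_poly (pt \<tau>) (G v)) * Var n ^ e + (\<Sum>i\<in>\<tau>. vd n i * B i)"
      using Suc.IH[OF G(1)[OF v]] by blast
    define c where "c = eval_poly (pt \<tau>) (G v)"
    define a :: "nat \<Rightarrow> nat cpoly" where "a i = Const (coeff (lagrange \<tau> i) v)" for i
    \<comment> \<open>For \<open>e = 0\<close> the truncated degree \<open>e - 1\<close> is 0 as
      well, so \<open>Var n * B i\<close> would have the wrong degree; there \<open>G v\<close> is a
      constant and needs no correction.\<close>
    define B' where "B' i = a i * G v + (if e = 0 then 0 else Const (pt \<tau> v) * Var n * B i)" for i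
    have "\<forall>i\<in>\<tau>. B' i \<in> forms n e"
    proof
      fix i assume i: "i \<in> \<tau>"
      have "Const (pt \<tau> v) * Var n * B i \<in> forms n e" if "e \<noteq> 0"
        using forms_mult[OF forms_Const_mult[OF forms_Var[of n n]] B(1)[rule_format, OF i]] that by simp
      then show "B' i \<in> forms n e"
        using G(1)[OF v] unfolding B'_def a_def by (auto intro!: forms_add forms_Const_mult forms_zero)
    qed
    moreover have "Var v * G v = Const (eval_poly (pt \<tau>) (Var v * G v)) * Var n ^ Suc e + (\<Sum>i\<in>\<tau>. vd n i * B' i)"
    proof -
      have "Var v * G v = Const (pt \<tau> v) * Var n * G v + (\<Sum>i\<in>\<tau>. a i * vd n i) * G v"
        by (subst linear_mod_point[OF \<tau> v]) (simp add: a_def distrib_right)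
      also have "Const (pt \<tau> v) * Var n * G v = Const (pt \<tau> v) * Var n * (Const c * Var n ^ e)
          + (\<Sum>i\<in>\<tau>. vd n i * (if e = 0 then 0 else Const (pt \<tau> v) * Var n * B i))"
      proof (cases "e = 0")
        case True
        then have "G v = Const c" using forms_0_eq[of "G v" n] G(1)[OF v] unfolding c_def
          by (metis eval_mon_zero eval_poly_single mult.right_neutral)
        then show ?thesis using True by simp
      next
        case False
        then show ?thesis by (subst B(2)) (simp add: c_def[symmetric] distrib_left sum_distrib_left mult_ac)
      qed
      finally have eq: "Var v * G v = Const (pt \<tau> v) * Var n * (Const c * Var n ^ e)
          + (\<Sum>i\<in>\<tau>. vd n i * (if e = 0 then 0 else Const (pt \<tau> v) * Var n * B i)) + (\<Sum>i\<in>\<tau>. a i * vd n i) * G v" .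
      have ev: "eval_poly (pt \<tau>) (Var v * G v) = pt \<tau> v * c" by (simp add: c_def)
      have "(\<Sum>i\<in>\<tau>. vd n i * B' i) = (\<Sum>i\<in>\<tau>. vd n i * (if e = 0 then 0 else Const (pt \<tau> v) * Var n * B i))
          + (\<Sum>i\<in>\<tau>. a i * vd n i) * G v"
        unfolding B'_def sum_distrib_right sum.distrib[symmetric]
        by (rule sum.cong) (simp_all add: distrib_left mult_ac)
      then show ?thesis
        unfolding ev by (subst eq) (simp add: Const_mult mult_ac)
    qed
    ultimately show ?thesis unfolding Q_def by blast
  qed
  then obtain B where Q: "\<And>v. v \<le> n \<Longrightarrow> Q v (B v)" by metis
  have B: "\<And>i. i \<in> \<tau> \<Longrightarrow> B v i \<in> forms n e"
    "Var v * G v = Const (eval_poly (pt \<tau>) (Var v * G v)) * Var n ^ Suc e + (\<Sum>i\<in>\<tau>. vd n i * B v i)"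
    if "v \<le> n" for v
    using Q[OF that] unfolding Q_def by blast+
  have "A = (\<Sum>v\<le>n. Const (eval_poly (pt \<tau>) (Var v * G v)) * Var n ^ Suc e + (\<Sum>i\<in>\<tau>. vd n i * B v i))"
    unfolding G(2) by (rule sum.cong[OF refl], rule B(2)) simp
  also have "\<dots> = Const (eval_poly (pt \<tau>) A) * Var n ^ Suc e + (\<Sum>i\<in>\<tau>. vd n i * (\<Sum>v\<le>n. B v i))"
    unfolding sum.distrib G(2) eval_poly_sum Const_sum sum_distrib_right sum_distrib_left
    by (subst (2) sum.swap) simp
  finally show ?case
    using B(1) by (intro exI[of _ "\<lambda>i. \<Sum>v\<le>n. B v i"]) (auto intro!: forms_sum)
qed

text \<open>Outside a set \<sigma> of \<open>r\<close> indices at least \<open>n + 1\<close>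
  hyperplanes remain as long as \<open>n + Suc r \<le> l\<close>. They span all linear forms, so a
  variable of the cofactor can be traded for one more factor.\<close>

lemma forms_in_star_vd:
  "n + r \<le> l \<Longrightarrow> r \<le> d \<Longrightarrow> F \<in> forms n d \<Longrightarrow> F \<in> star n l r d (vd n)"
proof (induction r)
  case 0
  have "{} \<in> subs l 0" by (simp add: subs_def)
  from star_single[OF this, of F n d] show ?case using 0 by simp
next
  case (Suc r)
  then obtain M where M: "\<And>\<sigma>. \<sigma> \<in> subs l r \<Longrightarrow> M \<sigma> \<in> forms n (d - r)"
    and F: "F = (\<Sum>\<sigma>\<in>subs l r. (\<Prod>i\<in>\<sigma>. vd n i) * M \<sigma>)"
    unfolding star_def by auto
  show ?case unfolding F
  proof (rule star_sum)
    fix \<sigma> assume \<sigma>: "\<sigma> \<in> subs l r"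
    have dr: "d - r = Suc (d - Suc r)" using Suc.prems by simp
    obtain G where G: "\<And>v. v \<le> n \<Longrightarrow> G v \<in> forms n (d - Suc r)" "M \<sigma> = (\<Sum>v\<le>n. Var v * G v)"
      using forms_Suc_split M[OF \<sigma>] unfolding dr by blast
    have "n + 1 \<le> card ({1..l} - \<sigma>)"
      using subsD[OF \<sigma>] Suc.prems by (simp add: card_Diff_subset)
    then obtain I where I: "I \<subseteq> {1..l} - \<sigma>" "card I = n + 1" "finite I"
      using obtain_subset_with_card_n by metis
    have "(\<Prod>i\<in>\<sigma>. vd n i) * M \<sigma> = (\<Sum>v\<le>n. \<Sum>i\<in>I. (\<Prod>i\<in>\<sigma>. vd n i) *
        (vd n i * (Const (coeff (lagrange I i) v) * G v)))"
      unfolding G(2) sum_distrib_left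
    proof (rule sum.cong[OF refl])
      fix v assume "v \<in> {..n}"
      then show "(\<Prod>i\<in>\<sigma>. vd n i) * (Var v * G v) = (\<Sum>i\<in>I. (\<Prod>i\<in>\<sigma>. vd n i) *
        (vd n i * (Const (coeff (lagrange I i) v) * G v)))"
        by (subst Var_in_span_vd[OF I(3,2)]) (auto simp: sum_distrib_left sum_distrib_right mult_ac)
    qed
    also have "\<dots> \<in> star n l (Suc r) d (vd n)"
      using I(1) by (intro star_sum star_insert_single \<sigma> forms_Const_mult G(1)) auto
    finally show "(\<Prod>i\<in>\<sigma>. vd n i) * M \<sigma> \<in> star n l (Suc r) d (vd n)" .
  qed
qed

theorem every_form_presentable:
  assumes "r \<le> d" "r \<le> l" "n < l - r + 1" "F \<in> forms n d"
  shows "presentable n l r d F"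
proof -
  have "F \<in> star n l r d (vd n)" by (rule forms_in_star_vd) (use assms in auto)
  then show ?thesis unfolding presentable_iff_star using vd_general by blast
qed

section \<open>Generic presentability\<close>

lemma subs_complement:
  assumes "\<rho> \<in> subs (n + s) s"
  shows "finite ({1..n + s} - \<rho>)" "card ({1..n + s} - \<rho>) = n"
  using subsD[OF assms] by (simp_all add: card_Diff_subset)

text \<open>The \<open>n\<close> hyperplanes outside \<rho> generate the ideal of their intersection
  point, so a cofactor vanishing there supplies one more factor from the complement of
  \<rho>.\<close>

lemma vanishing_mem_star:
  assumes \<rho>: "\<rho> \<in> subs (n + s) s" and d: "Suc s \<le> d" and A: "A \<in> forms n (d - s)"
    and zero: "eval_poly (pt ({1..n + s} - \<rho>)) A = 0"
  shows "(\<Prod>i\<in>\<rho>. vd n i) * A \<in> star n (n + s) (Suc s) d (vd n)"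
proof -
  obtain B where B: "\<forall>i\<in>{1..n + s} - \<rho>. B i \<in> forms n (d - s - 1)"
    "A = (\<Sum>i\<in>{1..n + s} - \<rho>. vd n i * B i)"
    using form_mod_point[OF subs_complement[OF \<rho>] A] zero by auto
  have "(\<Prod>i\<in>\<rho>. vd n i) * A = (\<Sum>i\<in>{1..n + s} - \<rho>. (\<Prod>i\<in>\<rho>. vd n i) * (vd n i * B i))"
    unfolding B(2) sum_distrib_left ..
  also have "\<dots> \<in> star n (n + s) (Suc s) d (vd n)"
    using B(1) by (intro star_sum star_insert_single \<rho>) auto
  finally show ?thesis .
qed

text \<open>Regroups a Leibniz sum: removing \<open>i\<close> from \<sigma> is the inverse of
  inserting \<open>i\<close> into \<rho>.\<close>

lemma sum_subs_Suc:
  "(\<Sum>\<sigma>\<in>subs l (Suc s). \<Sum>i\<in>\<sigma>. f (\<sigma> - {i}) i) = (\<Sum>\<rho>\<in>subs l s. \<Sum>i\<in>{1..l} - \<rho>. f \<rho> i)"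
proof -
  have "(\<Sum>\<sigma>\<in>subs l (Suc s). \<Sum>i\<in>\<sigma>. f (\<sigma> - {i}) i) = (\<Sum>(\<sigma>, i)\<in>Sigma (subs l (Suc s)) (\<lambda>\<sigma>. \<sigma>). f (\<sigma> - {i}) i)"
    by (rule sum.Sigma) (auto intro: finite_subs subsD(3))
  also have "\<dots> = (\<Sum>(\<rho>, i)\<in>Sigma (subs l s) (\<lambda>\<rho>. {1..l} - \<rho>). f \<rho> i)"
    by (rule sum.reindex_bij_witness[of _ "\<lambda>(\<rho>, i). (insert i \<rho>, i)" "\<lambda>(\<sigma>, i). (\<sigma> - {i}, i)"])
       (auto simp: subs_def insert_absorb finite_subset[of _ "{Suc 0..l}"])
  also have "\<dots> = (\<Sum>\<rho>\<in>subs l s. \<Sum>i\<in>{1..l} - \<rho>. f \<rho> i)"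
    by (rule sum.Sigma[symmetric]) (auto intro: finite_subs)
  finally show ?thesis .
qed

text \<open>Modulo the ideal of the star configuration, the tangent space is determined by its values at the
  points of the configuration.\<close>

theorem generic_presentableI:
  assumes d: "Suc s \<le> d" and M: "\<And>\<sigma>. \<sigma> \<in> subs (n + s) (Suc s) \<Longrightarrow> M \<sigma> \<in> forms n (d - Suc s)"
    and solve: "\<And>t. \<exists>L'. (\<forall>i\<in>{1..n + s}. L' i \<in> forms n 1) \<and> (\<forall>\<rho>\<in>subs (n + s) s.
      (\<Sum>i\<in>{1..n + s} - \<rho>. eval_poly (pt ({1..n + s} - \<rho>)) (L' i) *
          eval_poly (pt ({1..n + s} - \<rho>)) (M (insert i \<rho>))) = t \<rho>)"
  shows "generic_form n d (\<lambda>F. presentable n (n + s) (Suc s) d F)"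
proof (rule tangent_space_generic[OF d vd_form M vd_dual_points_index_sets])
  fix F assume "F \<in> forms n d"
  then have "F \<in> star n (n + s) s d (vd n)" using d by (intro forms_in_star_vd) auto
  then obtain A where A: "\<And>\<rho>. \<rho> \<in> subs (n + s) s \<Longrightarrow> A \<rho> \<in> forms n (d - s)"
    and F: "F = (\<Sum>\<rho>\<in>subs (n + s) s. (\<Prod>i\<in>\<rho>. vd n i) * A \<rho>)"
    unfolding star_def by blast
  obtain L' where L': "\<And>i. i \<in> {1..n + s} \<Longrightarrow> L' i \<in> forms n 1"
    "\<And>\<rho>. \<rho> \<in> subs (n + s) s \<Longrightarrow>
      (\<Sum>i\<in>{1..n + s} - \<rho>. eval_poly (pt ({1..n + s} - \<rho>)) (L' i) *
          eval_poly (pt ({1..n + s} - \<rho>)) (M (insert i \<rho>))) = eval_poly (pt ({1..n + s} - \<rho>)) (A \<rho>)"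
    using solve[of "\<lambda>\<rho>. eval_poly (pt ({1..n + s} - \<rho>)) (A \<rho>)"] by blast
  \<comment> \<open>What remains after moving the hyperplanes by \<open>L'\<close>. It vanishes at
    the point belonging to \<rho>, so a change of the cofactors absorbs it.\<close>
  define E where "E \<rho> = A \<rho> - (\<Sum>i\<in>{1..n + s} - \<rho>. L' i * M (insert i \<rho>))" for \<rho>
  have "(\<Prod>i\<in>\<rho>. vd n i) * E \<rho> \<in> star n (n + s) (Suc s) d (vd n)" if \<rho>: "\<rho> \<in> subs (n + s) s" for \<rho>
  proof (rule vanishing_mem_star[OF \<rho> d])
    have "L' i * M (insert i \<rho>) \<in> forms n (d - s)" if i: "i \<in> {1..n + s} - \<rho>" for i
    proof -
      have "insert i \<rho> \<in> subs (n + s) (Suc s)" using i subsD[OF \<rho>] by (auto simp: subs_def)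
      then have "L' i * M (insert i \<rho>) \<in> forms n (1 + (d - Suc s))" using i by (intro forms_mult L' M) auto
      then show ?thesis using d by (simp add: Suc_diff_Suc)
    qed
    then show "E \<rho> \<in> forms n (d - s)" unfolding E_def by (intro forms_diff A \<rho> forms_sum)
    show "eval_poly (pt ({1..n + s} - \<rho>)) (E \<rho>) = 0"
      using L'(2)[OF \<rho>] by (simp add: E_def)
  qed
  then have "(\<Sum>\<rho>\<in>subs (n + s) s. (\<Prod>i\<in>\<rho>. vd n i) * E \<rho>) \<in> star n (n + s) (Suc s) d (vd n)"
    by (rule star_sum)
  then obtain M' where M': "\<forall>\<sigma>\<in>subs (n + s) (Suc s). M' \<sigma> \<in> forms n (d - Suc s)"
    "(\<Sum>\<rho>\<in>subs (n + s) s. (\<Prod>i\<in>\<rho>. vd n i) * E \<rho>) = (\<Sum>\<sigma>\<in>subs (n + s) (Suc s). (\<Prod>i\<in>\<sigma>. vd n i) * M' \<sigma>)"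
    unfolding star_def by blast
  have "(\<Sum>\<sigma>\<in>subs (n + s) (Suc s). (\<Sum>i\<in>\<sigma>. L' i * (\<Prod>j\<in>\<sigma> - {i}. vd n j)) * M \<sigma>)
      = (\<Sum>\<sigma>\<in>subs (n + s) (Suc s). \<Sum>i\<in>\<sigma>. L' i * (\<Prod>j\<in>\<sigma> - {i}. vd n j) * M (insert i (\<sigma> - {i})))"
    unfolding sum_distrib_right by (intro sum.cong refl) (auto simp: insert_absorb)
  also have "\<dots> = (\<Sum>\<rho>\<in>subs (n + s) s. \<Sum>i\<in>{1..n + s} - \<rho>. L' i * (\<Prod>j\<in>\<rho>. vd n j) * M (insert i \<rho>))"
    by (rule sum_subs_Suc)
  also have "\<dots> = (\<Sum>\<rho>\<in>subs (n + s) s. (\<Prod>i\<in>\<rho>. vd n i) * (A \<rho> - E \<rho>))"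
    unfolding E_def by (simp add: sum_distrib_left mult_ac)
  finally have eq: "(\<Sum>\<sigma>\<in>subs (n + s) (Suc s). (\<Sum>i\<in>\<sigma>. L' i * (\<Prod>j\<in>\<sigma> - {i}. vd n j)) * M \<sigma>)
     = F - (\<Sum>\<sigma>\<in>subs (n + s) (Suc s). (\<Prod>i\<in>\<sigma>. vd n i) * M' \<sigma>)"
    unfolding F M'(2)[symmetric] by (simp add: right_diff_distrib sum_subtractf)
  show "\<exists>L' M'. (\<forall>i\<in>{1..n + s}. L' i \<in> forms n 1) \<and>
      (\<forall>\<sigma>\<in>subs (n + s) (Suc s). M' \<sigma> \<in> forms n (d - Suc s)) \<and>
      F = (\<Sum>\<sigma>\<in>subs (n + s) (Suc s). (\<Prod>i\<in>\<sigma>. vd n i) * M' \<sigma> + (\<Sum>i\<in>\<sigma>. L' i * (\<Prod>j\<in>\<sigma> - {i}. vd n j)) * M \<sigma>)"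
    using L'(1) M'(1) eq by (intro exI[of _ L'] exI[of _ M']) (simp add: sum.distrib)
qed auto

text \<open>The cofactor \<open>Var n ^ (d - Suc s)\<close> has value 1 at every point of the
  configuration, so the system to be solved no longer depends on the degree.\<close>

lemma generic_presentableI_power:
  assumes d: "Suc s \<le> d"
    and solve: "\<And>t. \<exists>L'. (\<forall>i\<in>{1..n + s}. L' i \<in> forms n 1) \<and> (\<forall>\<rho>\<in>subs (n + s) s.
      (\<Sum>i\<in>{1..n + s} - \<rho>. eval_poly (pt ({1..n + s} - \<rho>)) (L' i)) = t \<rho>)"
  shows "generic_form n d (\<lambda>F. presentable n (n + s) (Suc s) d F)"
proof (rule generic_presentableI[OF d, where M = "\<lambda>_. Var n ^ (d - Suc s)"])
  show "Var n ^ (d - Suc s) \<in> forms n (d - Suc s)"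
    using forms_power[OF forms_Var[of n n], of "d - Suc s"] by simp
  fix t :: "nat set \<Rightarrow> complex"
  obtain L' where L': "\<forall>i\<in>{1..n + s}. L' i \<in> forms n 1" "\<And>\<rho>. \<rho> \<in> subs (n + s) s \<Longrightarrow>
      (\<Sum>i\<in>{1..n + s} - \<rho>. eval_poly (pt ({1..n + s} - \<rho>)) (L' i)) = t \<rho>"
    using solve by blast
  have "eval_poly (pt ({1..n + s} - \<rho>)) (Var n ^ (d - Suc s)) = 1" if "\<rho> \<in> subs (n + s) s" for \<rho>
    using eval_pt_Var[OF subs_complement[OF that]] by (simp del: eval_poly_single)
  then show "\<exists>L'. (\<forall>i\<in>{1..n + s}. L' i \<in> forms n 1) \<and> (\<forall>\<rho>\<in>subs (n + s) s.
      (\<Sum>i\<in>{1..n + s} - \<rho>. eval_poly (pt ({1..n + s} - \<rho>)) (L' i) *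
          eval_poly (pt ({1..n + s} - \<rho>)) (Var n ^ (d - Suc s))) = t \<rho>)"
    using L' by (intro exI[of _ L']) simp
qed

lemma generic_presentable_r1:
  assumes "0 < n" "1 \<le> d"
  shows "generic_form n d (\<lambda>F. presentable n n 1 d F)"
proof -
  have "generic_form n d (\<lambda>F. presentable n (n + 0) (Suc 0) d F)"
  proof (rule generic_presentableI_power)
    fix t :: "nat set \<Rightarrow> complex"
    \<comment> \<open>The configuration is a single point, and moving the first hyperplane alone
      realises every value there.\<close>
    define L' where "L' i = (if i = 1 then Const (t {}) * Var n else 0)" for i :: nat
    have subs: "subs (n + 0) 0 = {{}}" by (auto simp: subs_def dest: finite_subset)
    have "eval_poly (pt {1..n}) (Var n) = 1" by (rule eval_pt_Var) auto
    then have "eval_poly (pt {1..n}) (L' i) = (if i = 1 then t {} else 0)" for i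
      by (simp add: L'_def del: eval_poly_single) simp
    then have "(\<Sum>i\<in>{1..n}. eval_poly (pt {1..n}) (L' i)) = t {}"
      using assms(1) by (simp del: eval_poly_sum)
    then show "\<exists>L'. (\<forall>i\<in>{1..n + 0}. L' i \<in> forms n 1) \<and> (\<forall>\<rho>\<in>subs (n + 0) 0.
      (\<Sum>i\<in>{1..n + 0} - \<rho>. eval_poly (pt ({1..n + 0} - \<rho>)) (L' i)) = t \<rho>)"
      unfolding subs by (intro exI[of _ L']) (auto simp: L'_def intro: forms_zero forms_Const_mult forms_Var[unfolded One_nat_def])
  qed (use assms in simp)
  then show ?thesis by simp
qed

lemma generic_presentable_n1:
  assumes "Suc s \<le> d"
  shows "generic_form 1 d (\<lambda>F. presentable 1 (1 + s) (Suc s) d F)"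
proof (rule generic_presentableI_power[OF assms])
  fix t :: "nat set \<Rightarrow> complex"
  \<comment> \<open>On the projective line each hyperplane is a point of the configuration, so the
    conditions decouple.\<close>
  define L' :: "nat \<Rightarrow> nat cpoly" where "L' j = Const (t ({1..1 + s} - {j})) * Var 1" for j
  have "(\<Sum>i\<in>{1..1 + s} - \<rho>. eval_poly (pt ({1..1 + s} - \<rho>)) (L' i)) = t \<rho>" if \<rho>: "\<rho> \<in> subs (1 + s) s" for \<rho>
  proof -
    obtain j where j: "{1..1 + s} - \<rho> = {j}"
      using subs_complement(2)[OF \<rho>] card_1_singletonE by metis
    then have "\<rho> = {1..1 + s} - {j}" using subsD(1)[OF \<rho>] by blast
    moreover have "eval_poly (pt {j}) (Var 1) = 1" by (rule eval_pt_Var) auto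
    ultimately show ?thesis using j by (simp add: L'_def del: eval_poly_single) simp
  qed
  then show "\<exists>L'. (\<forall>i\<in>{1..1 + s}. L' i \<in> forms 1 1) \<and> (\<forall>\<rho>\<in>subs (1 + s) s.
      (\<Sum>i\<in>{1..1 + s} - \<rho>. eval_poly (pt ({1..1 + s} - \<rho>)) (L' i)) = t \<rho>)"
    by (intro exI[of _ L'] conjI ballI) (auto simp: L'_def simp del: One_nat_def intro!: forms_Const_mult forms_Var)
qed

lemma eval_pt_vd_eq_0: "finite \<tau> \<Longrightarrow> card \<tau> \<le> n \<Longrightarrow> eval_poly (pt \<tau>) (vd n i) = 0 \<longleftrightarrow> i \<in> \<tau>"
  by (auto simp: eval_pt_vd)

text \<open>The point \<open>p j\<close> lies on every hyperplane except the one with index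
  \<open>j\<close>, so the \<open>vd n m\<close> are dual to these points up to scalars. Each of the
  \<open>n\<close> hyperplanes through \<open>p j\<close> is made to contribute the share
  \<open>t {j} / of_nat n\<close>.\<close>

lemma generic_presentable_r2:
  assumes "0 < n" "2 \<le> d"
  shows "generic_form n d (\<lambda>F. presentable n (n + 1) 2 d F)"
proof -
  have "generic_form n d (\<lambda>F. presentable n (n + 1) (Suc 1) d F)"
  proof (rule generic_presentableI_power)
    fix t :: "nat set \<Rightarrow> complex"
    define p where "p j = pt ({1..n + 1} - {j})" for j
    define L' where "L' i = (\<Sum>m\<in>{1..n + 1} - {i}. Const (t {m} / (of_nat n * eval_poly (p m) (vd n m))) * vd n m)" for i
    have "(\<Sum>i\<in>{1..n + 1} - \<rho>. eval_poly (pt ({1..n + 1} - \<rho>)) (L' i)) = t \<rho>" if \<rho>: "\<rho> \<in> subs (n + 1) 1" for \<rho>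
    proof -
      obtain j where j: "\<rho> = {j}" "j \<in> {1..n + 1}"
        using subsD[OF \<rho>] by (metis card_1_singletonE insert_subset)
      have card: "card ({1..n + 1} - {j}) = n" using j(2) by simp
      have nz: "eval_poly (p j) (vd n m) = 0 \<longleftrightarrow> m \<noteq> j" if "m \<in> {1..n + 1}" for m
        unfolding p_def using that eval_pt_vd_eq_0[of "{1..n + 1} - {j}" n m] card by auto
      have "eval_poly (p j) (L' i) = t {j} / of_nat n" if i: "i \<in> {1..n + 1} - {j}" for i
      proof -
        have "eval_poly (p j) (L' i) = (\<Sum>m\<in>{1..n + 1} - {i}. if m = j then t {j} / of_nat n else 0)"
          unfolding L'_def eval_poly_sum
        proof (rule sum.cong[OF refl])
          fix m assume "m \<in> {1..n + 1} - {i}"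
          then show "eval_poly (p j) (Const (t {m} / (of_nat n * eval_poly (p m) (vd n m))) * vd n m)
             = (if m = j then t {j} / of_nat n else 0)"
            using nz[of m] by auto
        qed
        also have "\<dots> = t {j} / of_nat n" using i j(2) by (subst sum.delta) auto
        finally show ?thesis .
      qed
      then have "(\<Sum>i\<in>{1..n + 1} - {j}. eval_poly (p j) (L' i)) = (\<Sum>i\<in>{1..n + 1} - {j}. t {j} / of_nat n)"
        by (intro sum.cong) auto
      also have "\<dots> = t {j}" unfolding sum_constant card using assms(1) by simp
      finally show ?thesis by (simp add: j(1) p_def)
    qed
    then show "\<exists>L'. (\<forall>i\<in>{1..n + 1}. L' i \<in> forms n 1) \<and> (\<forall>\<rho>\<in>subs (n + 1) 1.
      (\<Sum>i\<in>{1..n + 1} - \<rho>. eval_poly (pt ({1..n + 1} - \<rho>)) (L' i)) = t \<rho>)"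
      by (intro exI[of _ L'] conjI ballI) (simp_all add: L'_def forms_sum forms_Const_mult vd_form del: One_nat_def)
  qed (use assms in simp)
  then show ?thesis by (simp add: numeral_2_eq_2)
qed

text \<open>The point for \<open>{j, k}\<close> lies off the hyperplanes \<open>j\<close> and
  \<open>k\<close> only, where \<open>vd\<close> takes the values \<open>w j\<close> and
  \<open>- w k\<close> divided by \<open>of_nat j - of_nat k\<close>. The system becomes: the sum of
  \<open>b i j - b i k\<close> over all \<open>i\<close> other than \<open>j\<close>,
  \<open>k\<close> is \<open>T j k\<close>, with \<open>T\<close> antisymmetric.\<close>

lemma generic_presentable_r3:
  assumes "0 < n" "3 \<le> d"
  shows "generic_form n d (\<lambda>F. presentable n (n + 2) 3 d F)"
proof -
  have "generic_form n d (\<lambda>F. presentable n (n + 2) (Suc 2) d F)"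
  proof (rule generic_presentableI_power)
    fix t :: "nat set \<Rightarrow> complex"
    let ?l = "{1..n + 2}"
    define T where "T j k = (of_nat j - of_nat k) * t {j, k}" for j k :: nat
    have T_anti: "T j k = - T k j" for j k by (simp add: T_def insert_commute algebra_simps)
    define S where "S j = (\<Sum>i\<in>?l. T i j / 2)" for j
    \<comment> \<open>The sum over \<open>i\<close> has \<open>n\<close> terms, so subtracting
      \<open>S j / of_nat n\<close> removes the whole column sum and leaves only the omitted term
      \<open>- T k j / 2\<close>.\<close>
    define b where "b i j = T i j / 2 - S j / of_nat n" for i j
    define w where "w j = (\<Prod>i\<in>?l - {j}. of_nat j - of_nat i :: complex)" for j
    have w0: "w j \<noteq> 0" for j by (auto simp: w_def)
    define L' where "L' i = (\<Sum>m\<in>?l. Const (b i m / w m) * vd n m)" for i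
    have main: "(\<Sum>i\<in>?l - {j, k}. eval_poly (pt (?l - {j, k})) (L' i)) = t {j, k}"
      if jk: "j \<in> ?l" "k \<in> ?l" "j \<noteq> k" for j k
    proof -
      let ?\<tau> = "?l - {j, k}"
      have card: "card ?\<tau> = n" using jk by (simp add: card_Diff_subset)
      have ev: "eval_poly (pt ?\<tau>) (vd n m) = 0" if "m \<in> ?\<tau>" for m
        using that eval_pt_vd_eq_0[of ?\<tau> n m] card by simp
      have ev_w: "eval_poly (pt ?\<tau>) (vd n u) * (of_nat u - of_nat v) = w u"
        if uv: "?\<tau> = ?l - {u, v}" "v \<in> ?l" "u \<noteq> v" for u v
      proof -
        have "?l - {u} = insert v ?\<tau>" unfolding uv(1) using uv(2,3) by blast
        then have "w u = (\<Prod>i\<in>insert v ?\<tau>. of_nat u - of_nat i)"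
          unfolding w_def by simp
        also have "\<dots> = (of_nat u - of_nat v) * (\<Prod>i\<in>?\<tau>. of_nat u - of_nat i)"
          by (rule prod.insert) (unfold uv(1), auto)
        finally show ?thesis using eval_pt_vd[of ?\<tau> n u] card by simp
      qed
      have jk0: "of_nat j - of_nat k \<noteq> (0::complex)" using jk by simp
      have ej: "eval_poly (pt ?\<tau>) (vd n j) = w j / (of_nat j - of_nat k)"
        using ev_w[of j k] jk jk0 by (simp add: field_simps)
      have ek: "eval_poly (pt ?\<tau>) (vd n k) = - (w k / (of_nat j - of_nat k))"
        using ev_w[of k j] jk jk0 by (simp add: field_simps insert_commute)
      have L'e: "eval_poly (pt ?\<tau>) (L' i) = (b i j - b i k) / (of_nat j - of_nat k)" for i
      proof -
        have "eval_poly (pt ?\<tau>) (L' i) = (\<Sum>m\<in>?l. b i m / w m * eval_poly (pt ?\<tau>) (vd n m))"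
          by (simp add: L'_def)
        also have "\<dots> = (\<Sum>m\<in>{j, k}. b i m / w m * eval_poly (pt ?\<tau>) (vd n m))"
          by (rule sum.mono_neutral_right) (use jk ev in auto)
        also have "\<dots> = b i j / w j * eval_poly (pt ?\<tau>) (vd n j) + b i k / w k * eval_poly (pt ?\<tau>) (vd n k)"
          using jk(3) by simp
        also have "\<dots> = (b i j - b i k) / (of_nat j - of_nat k)"
          unfolding ej ek using w0[of j] w0[of k] by (simp add: diff_divide_distrib)
        finally show ?thesis .
      qed
      have split: "(\<Sum>i\<in>?\<tau>. T i m / 2) = S m - T j m / 2 - T k m / 2" for m
      proof -
        have l: "?l = insert j (insert k ?\<tau>)" using jk by auto
        have "S m = (\<Sum>i\<in>insert j (insert k ?\<tau>). T i m / 2)" unfolding S_def by (rule sum.cong[OF l refl])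
        then show ?thesis using jk(3) by simp
      qed
      have diag: "T j j = 0" "T k k = 0" by (simp_all add: T_def)
      have "(\<Sum>i\<in>?\<tau>. b i j - b i k) = T j k"
      proof -
        have b_sum: "(\<Sum>i\<in>?\<tau>. b i j) = - T k j / 2" "(\<Sum>i\<in>?\<tau>. b i k) = - T j k / 2"
          unfolding b_def sum_subtractf split sum_constant card using assms(1) diag by simp_all
        show ?thesis unfolding sum_subtractf b_sum using T_anti[of k j] by simp
      qed
      then have "(\<Sum>i\<in>?\<tau>. eval_poly (pt ?\<tau>) (L' i)) = T j k / (of_nat j - of_nat k)"
        unfolding L'e sum_divide_distrib[symmetric] by simp
      then show ?thesis using jk0 by (simp add: T_def)
    qed
    have "(\<Sum>i\<in>?l - \<rho>. eval_poly (pt (?l - \<rho>)) (L' i)) = t \<rho>" if \<rho>: "\<rho> \<in> subs (n + 2) 2" for \<rho>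
    proof -
      obtain j k where "\<rho> = {j, k}" "j \<noteq> k" using subsD(2)[OF \<rho>] card_2_iff by metis
      then show ?thesis using main[of j k] subsD(1)[OF \<rho>] by simp
    qed
    moreover have "L' i \<in> forms n 1" for i
      unfolding L'_def by (intro forms_sum forms_Const_mult vd_form)
    ultimately show "\<exists>L'. (\<forall>i\<in>{1..n + 2}. L' i \<in> forms n 1) \<and> (\<forall>\<rho>\<in>subs (n + 2) 2.
      (\<Sum>i\<in>{1..n + 2} - \<rho>. eval_poly (pt ({1..n + 2} - \<rho>)) (L' i)) = t \<rho>)"
      by blast
  qed (use assms in simp)
  then show ?thesis by (simp add: numeral_3_eq_3 numeral_2_eq_2)
qed

text \<open>Here the cofactor opposite to the line \<open>m\<close> is taken to vanish on the next line of a cyclic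
  ordering.  This decouples five of the ten equations; the other five form an odd cycle.\<close>

lemma generic_presentable_2_5_4:
  assumes d: "5 \<le> d"
  shows "generic_form 2 d (\<lambda>F. presentable 2 5 4 d F)"
proof -
  define nx where "nx m = (if m = 5 then 1 else m + 1)" for m :: nat
  \<comment> \<open>As 1 + ... + 5 = 15, \<open>15 - \<Sum>\<sigma>\<close> is the index missing
    from \<sigma>. The linear factor is possible because the cofactors have degree
    \<open>d - 4\<close>, which is positive.\<close>
  define M where "M \<sigma> = vd 2 (nx (15 - \<Sum>\<sigma>)) * Var 2 ^ (d - 5)" for \<sigma> :: "nat set"
  have "generic_form 2 d (\<lambda>F. presentable 2 (2 + 3) (Suc 3) d F)"
  proof (rule generic_presentableI[where M = M])
    show "Suc 3 \<le> d" using d by simp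
    fix \<sigma> :: "nat set"
    have "Var 2 ^ (d - 5) \<in> forms 2 (d - 5)" using forms_power[OF forms_Var[of 2 2], of "d - 5"] by simp
    from forms_mult[OF vd_form this, of "nx (15 - \<Sum>\<sigma>)"]
    moreover have "1 + (d - 5) = d - Suc 3" using d by simp
    ultimately show "M \<sigma> \<in> forms 2 (d - Suc 3)" by (simp only: M_def)
  next
    fix t :: "nat set \<Rightarrow> complex"
    define T where "T a b = t ({1..5} - {a, b})" for a b :: nat
    \<comment> \<open>The value of the line \<open>nx a\<close> at the intersection of the lines
      \<open>a\<close> and \<open>b\<close>. For distinct \<open>a\<close>, \<open>b\<close> it
      vanishes exactly when \<open>b = nx a\<close>.\<close>
    define K where "K a b = (of_nat (nx a) - of_nat a) * (of_nat (nx a) - of_nat b :: complex)" for a b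
    have "\<exists>(\<alpha>::nat \<Rightarrow> complex) (g::nat \<Rightarrow> complex). \<forall>a\<in>{1..5}. \<forall>b\<in>{1..5}. a < b \<longrightarrow>
       (\<alpha> a + g a * K a b) * K b a + (\<alpha> b + g b * K b a) * K a b = T a b"
    proof -
      \<comment> \<open>For cyclic neighbours one of \<open>K a b\<close>, \<open>K b a\<close> is
        zero, and the equation contains a single unknown value of \<alpha>.\<close>
      define a1 a2 a3 a4 a5 where "a1 = T 1 2 / K 2 1" and "a2 = T 2 3 / K 3 2" and "a3 = T 3 4 / K 4 3"
        and "a4 = T 4 5 / K 5 4" and "a5 = T 1 5 / K 1 5"
      define s1 s2 s3 s4 s5 where "s1 = (T 1 3 - a1 * K 3 1 - a3 * K 1 3) / (K 1 3 * K 3 1)"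
        and "s2 = (T 2 4 - a2 * K 4 2 - a4 * K 2 4) / (K 2 4 * K 4 2)"
        and "s3 = (T 3 5 - a3 * K 5 3 - a5 * K 3 5) / (K 3 5 * K 5 3)"
        and "s4 = (T 1 4 - a4 * K 1 4 - a1 * K 4 1) / (K 1 4 * K 4 1)"
        and "s5 = (T 2 5 - a5 * K 2 5 - a2 * K 5 2) / (K 2 5 * K 5 2)"
      \<comment> \<open>The remaining equations prescribe \<open>g a + g b\<close> along the cycle
        1, 3, 5, 2, 4. As its length is odd, the alternating sum of the prescribed values is twice
        \<open>g 1\<close>.\<close>
      define g1 where "g1 = (s1 - s3 + s5 - s2 + s4) / 2"
      define \<alpha> :: "nat \<Rightarrow> complex" where "\<alpha> = (\<lambda>_. 0)(1 := a1, 2 := a2, 3 := a3, 4 := a4, 5 := a5 :: complex)"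
      define g :: "nat \<Rightarrow> complex" where "g = (\<lambda>_. 0)(1 := g1, 3 := s1 - g1, 5 := s3 - s1 + g1, 2 := s5 - s3 + s1 - g1,
          4 := s2 - s5 + s3 - s1 + g1)"
      have K: "K 1 2 = 0" "K 2 1 = 2" "K 2 3 = 0" "K 3 2 = 2" "K 3 4 = 0" "K 4 3 = 2" "K 4 5 = 0" "K 5 4 = 12"
        "K 1 5 = -3" "K 5 1 = 0" "K 1 3 = -1" "K 3 1 = 3" "K 2 4 = -1" "K 4 2 = 3" "K 3 5 = -1" "K 5 3 = 8"
        "K 1 4 = -2" "K 4 1 = 4" "K 2 5 = -2" "K 5 2 = 4"
        by (simp_all add: K_def nx_def)
      have eqs: "(\<alpha> a + g a * K a b) * K b a + (\<alpha> b + g b * K b a) * K a b = T a b"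
        if "(a, b) \<in> {(1,2),(1,3),(1,4),(1,5),(2,3),(2,4),(2,5),(3,4),(3,5),(4,5)}" for a b :: nat
        using that unfolding \<alpha>_def g_def g1_def s1_def s2_def s3_def s4_def s5_def a1_def a2_def a3_def a4_def a5_def
        by (elim insertE emptyE) (simp_all add: K field_simps del: One_nat_def)
      have pairs: "(a, b) \<in> {(1,2),(1,3),(1,4),(1,5),(2,3),(2,4),(2,5),(3,4),(3,5),(4,5)}"
        if "a \<in> {1..5}" "b \<in> {1..5}" "a < b" for a b :: nat
      proof -
        have "{1..5::nat} = {1, 2, 3, 4, 5}" by auto
        then have "a \<in> {1, 2, 3, 4, 5}" "b \<in> {1, 2, 3, 4, 5}" using that by simp_all
        then show ?thesis using that(3) by (elim insertE emptyE) simp_all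
      qed
      show ?thesis
        by (intro exI[of _ \<alpha>] exI[of _ g] ballI impI, rule eqs, rule pairs)
    qed
    then obtain \<alpha> g :: "nat \<Rightarrow> complex" where eqs: "\<And>a b. a \<in> {1..5} \<Longrightarrow> b \<in> {1..5} \<Longrightarrow> a < b \<Longrightarrow>
       (\<alpha> a + g a * K a b) * K b a + (\<alpha> b + g b * K b a) * K a b = T a b" by blast
    define L' where "L' b = Const (\<alpha> b) * Var 2 + Const (g b) * vd 2 (nx b)" for b
    have "(\<Sum>i\<in>{1..2 + 3} - \<rho>. eval_poly (pt ({1..2 + 3} - \<rho>)) (L' i) *
          eval_poly (pt ({1..2 + 3} - \<rho>)) (M (insert i \<rho>))) = t \<rho>" if \<rho>: "\<rho> \<in> subs (2 + 3) 3" for \<rho>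
    proof -
      obtain a b where ab: "{1..2 + 3} - \<rho> = {a, b}" "a < b"
      proof -
        obtain a b where "{1..2 + 3} - \<rho> = {a, b}" "a \<noteq> b"
          using subs_complement(2)[OF \<rho>] card_2_iff by metis
        then show thesis using that[of a b] that[of b a] by (cases "a < b") (auto simp: insert_commute)
      qed
      have ab_in: "a \<in> {1..5}" "b \<in> {1..5}" using ab(1) by auto
      have \<rho>_eq: "\<rho> = {1..5} - {a, b}" using ab(1) subsD(1)[OF \<rho>] by auto
      have fin: "finite {a, b}" "card {a, b} = 2" using ab(2) by auto
      have N: "eval_poly (pt {a, b}) (Var 2) = 1" by (rule eval_pt_Var[OF fin])
      have vd: "eval_poly (pt {a, b}) (vd 2 i) = (of_nat i - of_nat a) * (of_nat i - of_nat b)" for i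
        using eval_pt_vd[of "{a, b}" 2 i] fin ab(2) by simp
      have sum15: "\<Sum>{1..5::nat} = 15" by (simp add: eval_nat_numeral)
      have ins: "insert a \<rho> = {1..5} - {b}" "insert b \<rho> = {1..5} - {a}" unfolding \<rho>_eq using ab_in ab(2) by auto
      have miss: "15 - \<Sum>({1..5} - {m}) = m" if "m \<in> {1..5}" for m :: nat
        using that sum15 sum.remove[of "{1..5}" m "\<lambda>x. x"] by simp
      have Me: "eval_poly (pt {a, b}) (M (insert a \<rho>)) = K b a" "eval_poly (pt {a, b}) (M (insert b \<rho>)) = K a b"
        unfolding M_def ins miss[OF ab_in(1)] miss[OF ab_in(2)] eval_poly_mult eval_poly_power N vd K_def
        by simp_all
      have Le: "eval_poly (pt {a, b}) (L' a) = \<alpha> a + g a * K a b" "eval_poly (pt {a, b}) (L' b) = \<alpha> b + g b * K b a"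
        unfolding L'_def eval_poly_add eval_poly_mult N vd K_def by simp_all
      show ?thesis
        unfolding ab(1) using ab(2) Me Le eqs[OF ab_in ab(2)] by (simp add: T_def \<rho>_eq)
    qed
    then show "\<exists>L'. (\<forall>i\<in>{1..2 + 3}. L' i \<in> forms 2 1) \<and> (\<forall>\<rho>\<in>subs (2 + 3) 3.
      (\<Sum>i\<in>{1..2 + 3} - \<rho>. eval_poly (pt ({1..2 + 3} - \<rho>)) (L' i) *
          eval_poly (pt ({1..2 + 3} - \<rho>)) (M (insert i \<rho>))) = t \<rho>)"
      by (intro exI[of _ L'] conjI ballI)
         (auto simp: L'_def simp del: One_nat_def intro!: forms_add forms_Const_mult vd_form forms_Var)
  qed
  then show ?thesis by (simp add: eval_nat_numeral)
qed

section \<open>Generic non-presentability\<close>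

lemma card_less_not_alg_independent:
  assumes V: "finite V" and K: "finite K" "card V < card K"
    and \<phi>: "\<And>k. k \<in> K \<Longrightarrow> \<phi> k \<in> pfuns V"
  shows "\<not> alg_independent K \<phi>"
proof
  assume ind: "alg_independent K \<phi>"
  obtain B c where c: "\<exists>e\<in>PiE K (\<lambda>_. {..<B::nat}). c e \<noteq> 0"
    "\<And>x. (\<Sum>e\<in>PiE K (\<lambda>_. {..<B}). c e * (\<Prod>k\<in>K. \<phi> k x ^ e k)) = 0"
    using algebraic_dependence[OF V K, of \<phi>, OF \<phi>] by blast
  define G where "G y = (\<Sum>e\<in>PiE K (\<lambda>_. {..<B}). c e * (\<Prod>k\<in>K. y k ^ e k))" for y :: "'b \<Rightarrow> complex"
  have "G \<in> pfuns K" unfolding G_def by (intro pfuns_intros)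
  moreover have "\<forall>x. G (\<lambda>k. \<phi> k x) = 0" using c(2) unfolding G_def by blast
  ultimately have "\<forall>y. G y = 0" using ind unfolding alg_independent_def by blast
  then have "c e = 0" if "e \<in> PiE K (\<lambda>_. {..<B})" for e
    using monomials_independent[OF K(1), where B = "\<lambda>_. B" and c = c and e = e] that unfolding G_def by blast
  then show False using c(1) by blast
qed

text \<open>Each family satisfies a nontrivial relation; the product of these finitely many
  relations is a nonzero polynomial vanishing on all of them.\<close>

lemma generic_not_in_families:
  assumes I: "finite I" and \<Phi>: "\<And>i. i \<in> I \<Longrightarrow> \<not> alg_independent (mons n d) (\<lambda>k x. Poly_Mapping.lookup (\<Phi> i x) k)"
    and cover: "\<And>F. F \<in> forms n d \<Longrightarrow> P F \<Longrightarrow> \<exists>i\<in>I. \<exists>x. F = \<Phi> i x"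
  shows "generic_form n d (\<lambda>F. \<not> P F)"
proof -
  have "\<exists>G. G \<in> pfuns (mons n d) \<and> (\<exists>y. G y \<noteq> 0) \<and> (\<forall>x. G (Poly_Mapping.lookup (\<Phi> i x)) = 0)" if "i \<in> I" for i
    using \<Phi>[OF that] unfolding alg_independent_def by blast
  then obtain G where G: "\<And>i. i \<in> I \<Longrightarrow> G i \<in> pfuns (mons n d)" "\<And>i. i \<in> I \<Longrightarrow> \<exists>y. G i y \<noteq> 0"
    "\<And>i x. i \<in> I \<Longrightarrow> G i (Poly_Mapping.lookup (\<Phi> i x)) = 0"
    by metis
  obtain y where y: "(\<Prod>i\<in>I. G i y) \<noteq> 0"
    using pfuns_prod_nonzero[OF I, of G "mons n d"] G by blast
  show ?thesis
  proof (rule generic_formI[where G = "\<lambda>y. \<Prod>i\<in>I. G i y", OF _ y])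
    show "(\<lambda>y. \<Prod>i\<in>I. G i y) \<in> pfuns (mons n d)" by (intro pfuns_prod G)
    fix F assume F: "F \<in> forms n d" "(\<Prod>i\<in>I. G i (Poly_Mapping.lookup F)) \<noteq> 0"
    show "\<not> P F"
    proof
      assume "P F"
      then obtain i x where "i \<in> I" "F = \<Phi> i x" using cover F(1) by blast
      then have "G i (Poly_Mapping.lookup F) = 0" using G(3) by blast
      then show False using F(2) I \<open>i \<in> I\<close> by (simp add: prod_zero)
    qed
  qed
qed

lemma linear_form_expand:
  assumes "F \<in> forms n 1"
  shows "\<exists>c. F = (\<Sum>v\<le>n. Const (c v) * Var v)"
proof -
  obtain G where G: "\<forall>v\<le>n. G v \<in> forms n 0" "F = (\<Sum>v\<le>n. Var v * G v)"
    using forms_Suc_split[of F n 0] assms by auto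
  have "F = (\<Sum>v\<le>n. Const (Poly_Mapping.lookup (G v) 0) * Var v)"
    unfolding G(2) by (rule sum.cong[OF refl], subst forms_0_eq) (use G(1) in \<open>auto simp: mult.commute\<close>)
  then show ?thesis by (intro exI[of _ "\<lambda>v. Poly_Mapping.lookup (G v) 0"])
qed

lemma general_linear_form_nonzero:
  assumes "general_linear_forms n l L" "i \<in> {1..l}"
  shows "L i \<noteq> 0"
proof
  assume L: "L i = 0"
  obtain J where J: "J \<subseteq> {1..l} - {i}" "card J = min l (n + 1) - 1" "finite J"
    using obtain_subset_with_card_n[of "min l (n + 1) - 1" "{1..l} - {i}"] assms(2) by force
  have "card (insert i J) = min l (n + 1)"
    using J assms(2) by (subst card_insert_disjoint) auto
  then have "insert i J \<in> index_sets n l" using J(1) assms(2) unfolding index_sets_def by auto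
  then have "independent_family L (insert i J)" using assms(1) unfolding general_linear_forms_iff by blast
  then have ind: "\<forall>b. (\<Sum>k\<in>insert i J. Const (b k) * L k) = 0 \<longrightarrow> (\<forall>k\<in>insert i J. b k = 0)"
    using J(3) by (subst (asm) independent_family_iff) auto
  have "(\<Sum>k\<in>insert i J. Const (if k = i then 1 else 0) * L k) = 0"
    by (rule sum.neutral) (use L in auto)
  from ind[THEN spec, THEN mp, OF this] show False by simp
qed

lemma general_linear_forms_form: "general_linear_forms n l L \<Longrightarrow> i \<in> {1..l} \<Longrightarrow> L i \<in> forms n 1"
  unfolding general_linear_forms_iff by blast

text \<open>Points on the common zero set of the products that impose independent conditions on
  forms of degree \<open>d\<close>, as witnessed by \<open>G\<close>. The threshold
  \<open>l * n\<close> is the number of parameters of \<open>l\<close> hyperplanes up to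
  scaling.\<close>

definition separates :: "nat \<Rightarrow> nat \<Rightarrow> nat \<Rightarrow> nat \<Rightarrow> (nat \<Rightarrow> nat cpoly) \<Rightarrow> 'q set \<Rightarrow>
    ('q \<Rightarrow> nat \<Rightarrow> complex) \<Rightarrow> ('q \<Rightarrow> nat cpoly) \<Rightarrow> bool" where
  "separates n l r d L Q q G \<longleftrightarrow> finite Q \<and> l * n < card Q \<and> (\<forall>j\<in>Q. G j \<in> forms n d) \<and>
      (\<forall>i\<in>Q. \<forall>j\<in>Q. eval_poly (q j) (G i) = 0 \<longleftrightarrow> i \<noteq> j) \<and>
      (\<forall>\<sigma>\<in>subs l r. \<forall>j\<in>Q. \<exists>i\<in>\<sigma>. eval_poly (q j) (L i) = 0)"

text \<open>Separated points on the star configuration bound the dimension of its ideal, hence the number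
  of products of the linear forms needed to span it.\<close>

theorem generic_not_presentable:
  assumes points: "\<And>L. general_linear_forms n l L \<Longrightarrow> \<exists>(Q::'q set) q G. separates n l r d L Q q G"
    and rd: "r \<le> d"
  shows "generic_form n d (\<lambda>F. \<not> presentable n l r d F)"
proof -
  \<comment> \<open>\<open>P\<close> indexes the products that span the ideal in degree
    \<open>d\<close>. \<open>Js\<close> records for each hyperplane a coefficient scaled to 1, which
    leaves \<open>n\<close> parameters; \<open>Ts\<close> lists the possible bases among the
    products. Only finitely many families arise.\<close>
  define P where "P = subs l r \<times> mons n (d - r)"
  have finP: "finite P" unfolding P_def by (intro finite_cartesian_product finite_subs finite_mons)
  define Js where "Js = PiE {1..l} (\<lambda>_. {..n})"
  define Ts where "Ts = {T. T \<subseteq> P \<and> l * n + card T < card (mons n d)}"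
  have fin: "finite (Js \<times> Ts)"
  proof (rule finite_cartesian_product)
    show "finite Js" unfolding Js_def by (intro finite_PiE) auto
    show "finite Ts" unfolding Ts_def by (rule finite_subset[of _ "Pow P"]) (use finP in auto)
  qed
  define Lx :: "(nat \<Rightarrow> nat) \<Rightarrow> ((nat \<times> nat) + (nat set \<times> nat monomial) \<Rightarrow> complex) \<Rightarrow> nat \<Rightarrow> nat cpoly" where
    "Lx J x i = Var (J i) + (\<Sum>v\<in>{..n} - {J i}. Const (x (Inl (i, v))) * Var v)" for J x i
  define \<Phi> where "\<Phi> = (\<lambda>(J, T) x. \<Sum>t\<in>T. Const (x (Inr t)) * ((\<Prod>i\<in>fst t. Lx J x i) * Mon (snd t)))"
  show ?thesis
  proof (rule generic_not_in_families[OF fin, where \<Phi> = \<Phi>])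
    fix JT assume "JT \<in> Js \<times> Ts"
    then obtain J T where JT: "JT = (J, T)" "J \<in> Js" "T \<in> Ts" by blast
    define V where "V = Inl ` (SIGMA i:{1..l}. {..n} - {J i}) \<union> (Inr ` T :: ((nat \<times> nat) + (nat set \<times> nat monomial)) set)"
    have finT: "finite T" using JT(3) finP unfolding Ts_def by (auto intro: finite_subset)
    have cardS: "card (SIGMA i:{1..l}. {..n} - {J i}) = l * n"
    proof -
      have "card (SIGMA i:{1..l}. {..n} - {J i}) = (\<Sum>i\<in>{1..l}. card ({..n} - {J i}))"
        by (rule card_SigmaI) auto
      also have "\<dots> = (\<Sum>i\<in>{1..l}. n)"
        by (rule sum.cong) (use JT(2) in \<open>auto simp: Js_def PiE_iff card_Diff_singleton\<close>)
      finally show ?thesis by simp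
    qed
    have "card V = card (Inl ` (SIGMA i:{1..l}. {..n} - {J i}) :: ((nat \<times> nat) + (nat set \<times> nat monomial)) set)
        + card (Inr ` T :: ((nat \<times> nat) + (nat set \<times> nat monomial)) set)"
      unfolding V_def by (rule card_Un_disjoint) (use finT in auto)
    also have "\<dots> = l * n + card T"
      by (subst (1 2) card_image) (auto simp only: cardS inj_on_def sum.inject)
    finally have "card V = l * n + card T" .
    then have card: "card V < card (mons n d)" using JT(3) by (simp add: Ts_def)
    have finV: "finite V" unfolding V_def using finT by auto
    have Lx_fam: "(\<lambda>x. Lx J x i) \<in> families V" if "i \<in> {1..l}" for i
      unfolding Lx_def
      by (intro families.add families_const families_sum families.scale pfuns.var)
         (use that in \<open>auto simp: V_def\<close>)
    have "\<Phi> JT \<in> families V"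
      unfolding JT(1) \<Phi>_def prod.case
    proof (intro families_sum families_mult families_Const families_prod families_const pfuns.var)
      fix t i assume "t \<in> T"
      then show "Inr t \<in> V" by (simp add: V_def)
      assume "i \<in> fst t"
      moreover have "t \<in> P" using \<open>t \<in> T\<close> JT(3) by (auto simp: Ts_def)
      then have "fst t \<in> subs l r" by (auto simp: P_def)
      ultimately have "i \<in> {1..l}" using subsD(1) by blast
      then show "(\<lambda>x. Lx J x i) \<in> families V" by (rule Lx_fam)
    qed
    then show "\<not> alg_independent (mons n d) (\<lambda>k x. Poly_Mapping.lookup (\<Phi> JT x) k)"
      by (intro card_less_not_alg_independent[OF finV finite_mons card] families_lookup)
  next
    fix F assume F: "F \<in> forms n d" "presentable n l r d F"
    obtain L where L: "general_linear_forms n l L" "F \<in> star n l r d L"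
      using F(2) unfolding presentable_iff_star by blast
    obtain Q :: "'q set" and q G where sep: "separates n l r d L Q q G"
      using points[OF L(1)] by blast
    have Q: "finite Q" "l * n < card Q" "\<And>j. j \<in> Q \<Longrightarrow> G j \<in> forms n d"
      "\<And>i j. i \<in> Q \<Longrightarrow> j \<in> Q \<Longrightarrow> eval_poly (q j) (G i) = 0 \<longleftrightarrow> i \<noteq> j"
      "\<And>\<sigma> j. \<sigma> \<in> subs l r \<Longrightarrow> j \<in> Q \<Longrightarrow> \<exists>i\<in>\<sigma>. eval_poly (q j) (L i) = 0"
      using sep unfolding separates_def by blast+
    have "\<forall>i\<in>{1..l}. \<exists>c. L i = (\<Sum>v\<le>n. Const (c v) * Var v)"
      using linear_form_expand[OF general_linear_forms_form[OF L(1)]] by blast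
    from bchoice[OF this] obtain c where c: "\<And>i. i \<in> {1..l} \<Longrightarrow> L i = (\<Sum>v\<le>n. Const (c i v) * Var v)"
      by blast
    have "\<exists>v\<le>n. c i v \<noteq> 0" if "i \<in> {1..l}" for i
    proof (rule ccontr)
      assume "\<not> ?thesis"
      then have "L i = 0" unfolding c[OF that] by (intro sum.neutral) auto
      then show False using general_linear_form_nonzero[OF L(1) that] by simp
    qed
    then obtain J0 where J0: "\<And>i. i \<in> {1..l} \<Longrightarrow> J0 i \<le> n \<and> c i (J0 i) \<noteq> 0" by metis
    define J where "J = restrict J0 {1..l}"
    have J: "J \<in> Js" "\<And>i. i \<in> {1..l} \<Longrightarrow> J i \<le> n" "\<And>i. i \<in> {1..l} \<Longrightarrow> c i (J i) \<noteq> 0"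
      unfolding Js_def J_def using J0 by auto
    define K where "K i = Const (1 / c i (J i)) * L i" for i
    have LK: "L i = Const (c i (J i)) * K i" if "i \<in> {1..l}" for i
      using J(3)[OF that] by (simp add: K_def mult.assoc[symmetric] flip: Const_mult)
    define f where "f t = (\<Prod>i\<in>fst t. K i) * Mon (snd t)" for t :: "nat set \<times> nat monomial"
    have f_form: "f t \<in> forms n d" if "t \<in> P" for t
    proof -
      have t: "fst t \<in> subs l r" using that by (auto simp: P_def)
      have "K i \<in> forms n 1" if "i \<in> fst t" for i
        unfolding K_def using that subsD(1)[OF t] by (intro forms_Const_mult general_linear_forms_form[OF L(1)]) blast
      then have "(\<Prod>i\<in>fst t. K i) \<in> forms n r"
        using forms_prod[of "fst t" K n] subsD(2,3)[OF t] by simp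
      from forms_mult[OF this forms_Mon[of "snd t" n "d - r"]] show ?thesis
        using that rd unfolding P_def f_def by auto
    qed
    have f_zero: "eval_poly (q j) (f t) = 0" if t: "t \<in> P" and j: "j \<in> Q" for t j
    proof -
      have t1: "fst t \<in> subs l r" using t by (auto simp: P_def)
      then obtain i where i: "i \<in> fst t" "eval_poly (q j) (L i) = 0" using Q(5) j by blast
      then have "(\<Prod>i\<in>fst t. eval_poly (q j) (K i)) = 0"
        using subsD(3)[OF t1] by (intro prod_zero bexI[of _ i]) (auto simp: K_def)
      then show ?thesis by (simp add: f_def)
    qed
    obtain B where B: "B \<subseteq> f ` P" "cpoly.independent B" "f ` P \<subseteq> cpoly.span B"
      using cpoly.maximal_independent_subset[of "f ` P"] by blast
    then obtain T where T: "T \<subseteq> P" "inj_on f T" "B = f ` T"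
      unfolding subset_image_inj by blast
    have finT: "finite T" using T(1) finP by (rule finite_subset)
    have T_ind: "\<forall>i\<in>T. b i = 0" if "(\<Sum>t\<in>T. Const (b t) * f t) = 0" for b
      using independent_image_iff[OF finT, of f] T B(2) that by blast
    \<comment> \<open>The products vanish at all the points and each \<open>G j\<close> at all but
      one, so the basis and the \<open>G j\<close> are jointly independent among the forms of degree
      \<open>d\<close>.\<close>
    have "card T + card Q \<le> card (mons n d)"
    proof (rule ccontr)
      assume "\<not> ?thesis"
      then have less: "card (mons n d) < card (Inl ` T \<union> Inr ` Q)"
        using finT Q(1) by (subst card_Un_disjoint) (auto simp: card_image)
      define H where "H = case_sum f G"
      have H: "H u \<in> forms n d" if "u \<in> Inl ` T \<union> Inr ` Q" for u
        using that f_form T(1) Q(3) by (auto simp: H_def)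
      obtain b where b: "\<exists>u\<in>Inl ` T \<union> Inr ` Q. b u \<noteq> 0"
        "\<And>m. m \<in> mons n d \<Longrightarrow> (\<Sum>u\<in>Inl ` T \<union> Inr ` Q. Poly_Mapping.lookup (H u) m * b u) = 0"
        using homogeneous_system_solution[OF finite_mons _ less, of "\<lambda>m u. Poly_Mapping.lookup (H u) m"]
          finT Q(1) by blast
      have "(\<Sum>u\<in>Inl ` T \<union> Inr ` Q. Const (b u) * H u) = 0"
      proof (rule poly_mapping_eqI)
        fix m
        show "Poly_Mapping.lookup (\<Sum>u\<in>Inl ` T \<union> Inr ` Q. Const (b u) * H u) m = Poly_Mapping.lookup 0 m"
          using b(2)[of m] forms_lookup_outside[OF H, of _ m]
          by (cases "m \<in> mons n d") (simp_all add: lookup_sum lookup_Const_mult mult.commute[of "Poly_Mapping.lookup _ _" "b _"])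
      qed
      then have eq: "(\<Sum>t\<in>T. Const (b (Inl t)) * f t) + (\<Sum>j\<in>Q. Const (b (Inr j)) * G j) = 0"
        using finT Q(1) by (subst (asm) sum.union_disjoint) (auto simp: sum.reindex H_def)
      have bQ: "b (Inr j) = 0" if j: "j \<in> Q" for j
      proof -
        have "0 = eval_poly (q j) ((\<Sum>t\<in>T. Const (b (Inl t)) * f t) + (\<Sum>i\<in>Q. Const (b (Inr i)) * G i))"
          unfolding eq by simp
        also have "\<dots> = (\<Sum>t\<in>T. b (Inl t) * eval_poly (q j) (f t)) + (\<Sum>i\<in>Q. b (Inr i) * eval_poly (q j) (G i))"
          by simp
        also have "(\<Sum>t\<in>T. b (Inl t) * eval_poly (q j) (f t)) = 0"
          by (rule sum.neutral) (use f_zero T(1) j in auto)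
        also have "(\<Sum>i\<in>Q. b (Inr i) * eval_poly (q j) (G i)) = (\<Sum>i\<in>Q. if i = j then b (Inr j) * eval_poly (q j) (G j) else 0)"
          by (rule sum.cong) (use Q(4) j in auto)
        also have "\<dots> = b (Inr j) * eval_poly (q j) (G j)" using Q(1) j by simp
        finally show ?thesis using Q(4)[OF j j] by simp
      qed
      then have "(\<Sum>t\<in>T. Const (b (Inl t)) * f t) = 0" using eq by simp
      then have "\<forall>t\<in>T. b (Inl t) = 0" by (rule T_ind)
      then show False using bQ b(1) by auto
    qed
    then have T_in: "T \<in> Ts" using T(1) Q(2) unfolding Ts_def by auto
    have "F \<in> cpoly.span (f ` P)"
    proof -
      obtain M where M: "\<And>\<sigma>. \<sigma> \<in> subs l r \<Longrightarrow> M \<sigma> \<in> forms n (d - r)" "F = (\<Sum>\<sigma>\<in>subs l r. (\<Prod>i\<in>\<sigma>. L i) * M \<sigma>)"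
        using L(2) unfolding star_def by blast
      have "(\<Prod>i\<in>\<sigma>. L i) * M \<sigma> \<in> cpoly.span (f ` P)" if \<sigma>: "\<sigma> \<in> subs l r" for \<sigma>
      proof -
        have "(\<Prod>i\<in>\<sigma>. L i) = (\<Prod>i\<in>\<sigma>. Const (c i (J i)) * K i)"
          by (rule prod.cong[OF refl], rule LK) (use subsD(1)[OF \<sigma>] in blast)
        then have pr: "(\<Prod>i\<in>\<sigma>. L i) = Const (\<Prod>i\<in>\<sigma>. c i (J i)) * (\<Prod>i\<in>\<sigma>. K i)"
          by (simp add: prod.distrib Const_prod)
        have "(\<Prod>i\<in>\<sigma>. L i) * M \<sigma> = Const (\<Prod>i\<in>\<sigma>. c i (J i)) * (\<Prod>i\<in>\<sigma>. K i) *
            (\<Sum>m\<in>mons n (d - r). Const (Poly_Mapping.lookup (M \<sigma>) m) * Mon m)"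
          unfolding pr by (rule arg_cong[OF forms_eq_sum[OF M(1)[OF \<sigma>]]])
        also have "\<dots> = (\<Sum>m\<in>mons n (d - r).
            cpoly_scale ((\<Prod>i\<in>\<sigma>. c i (J i)) * Poly_Mapping.lookup (M \<sigma>) m) (f (\<sigma>, m)))"
          unfolding sum_distrib_left
          by (rule sum.cong[OF refl]) (simp only: cpoly_scale_def f_def fst_conv snd_conv Const_mult mult_ac)
        also have "\<dots> \<in> cpoly.span (f ` P)"
          using \<sigma> by (intro cpoly.span_sum cpoly.span_scale cpoly.span_base) (auto simp: P_def)
        finally show ?thesis .
      qed
      then show ?thesis unfolding M(2) by (rule cpoly.span_sum)
    qed
    then have "F \<in> cpoly.span (f ` T)"
      using cpoly.span_minimal[OF B(3) cpoly.subspace_span] T(3) by blast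
    then obtain u where "F = (\<Sum>a\<in>f ` T. cpoly_scale (u a) a)"
      using cpoly.span_finite[of "f ` T"] finT by auto
    then have u: "F = (\<Sum>t\<in>T. Const (u (f t)) * f t)"
      using T(2) by (simp add: sum.reindex cpoly_scale_def)
    define x where "x = case_sum (\<lambda>(i, v). c i v / c i (J i)) (\<lambda>t. u (f t))"
    have "Lx J x i = K i" if i: "i \<in> {1..l}" for i
    proof -
      have "K i = (\<Sum>v\<le>n. Const (c i v / c i (J i)) * Var v)"
        unfolding K_def c[OF i] sum_distrib_left by (simp add: Const_mult[symmetric] mult.assoc[symmetric])
      also have "\<dots> = Const (c i (J i) / c i (J i)) * Var (J i) + (\<Sum>v\<in>{..n} - {J i}. Const (c i v / c i (J i)) * Var v)"
        by (rule sum.remove) (use J(2)[OF i] in auto)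
      also have "\<dots> = Lx J x i"
        using J(3)[OF i] by (simp add: Lx_def x_def)
      finally show ?thesis ..
    qed
    note Lx_K = this
    have prods: "(\<Prod>i\<in>fst t. Lx J x i) = (\<Prod>i\<in>fst t. K i)" if "t \<in> T" for t
    proof -
      have "fst t \<in> subs l r" using that T(1) by (auto simp: P_def)
      then show ?thesis using subsD(1) by (intro prod.cong refl Lx_K) blast
    qed
    have "F = \<Phi> (J, T) x"
      unfolding u \<Phi>_def prod.case
    proof (rule sum.cong[OF refl])
      fix t assume "t \<in> T"
      have "x (Inr t) = u (f t)" by (simp add: x_def)
      then show "Const (u (f t)) * f t = Const (x (Inr t)) * ((\<Prod>i\<in>fst t. Lx J x i) * Mon (snd t))"
        unfolding prods[OF \<open>t \<in> T\<close>] by (simp only: f_def)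
    qed
    then show "\<exists>JT\<in>Js \<times> Ts. \<exists>x. F = \<Phi> JT x" using J(1) T_in by blast
  qed
qed

section \<open>Common zeros of linear forms and points on the configuration\<close>

lemma linear_common_zero:
  assumes I: "finite I" "card I \<le> n" and L: "\<And>i. i \<in> I \<Longrightarrow> L i \<in> forms n 1"
  shows "\<exists>p. (\<exists>a\<le>n. p a \<noteq> 0) \<and> (\<forall>i\<in>I. eval_poly p (L i) = 0)"
proof -
  have "\<forall>i\<in>I. \<exists>c. L i = (\<Sum>v\<le>n. Const (c v) * Var v)"
    using linear_form_expand[OF L] by blast
  from bchoice[OF this] obtain c where c: "\<And>i. i \<in> I \<Longrightarrow> L i = (\<Sum>v\<le>n. Const (c i v) * Var v)"
    by blast
  obtain p where p: "\<exists>a\<in>{..n}. p a \<noteq> 0" "\<And>i. i \<in> I \<Longrightarrow> (\<Sum>v\<le>n. c i v * p v) = 0"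
    using homogeneous_system_solution[of I "{..n}" c] I by auto
  have "eval_poly p (L i) = 0" if "i \<in> I" for i
    unfolding c[OF that] using p(2)[OF that] by simp
  then show ?thesis using p(1) by blast
qed

lemma eval_linear_form_line:
  assumes "L \<in> forms n 1"
  shows "eval_poly (\<lambda>v. p v + s * p' v) L = eval_poly p L + s * eval_poly p' L"
proof -
  obtain c where "L = (\<Sum>v\<le>n. Const (c v) * Var v)" using linear_form_expand[OF assms] by blast
  then show ?thesis by (simp add: sum.distrib algebra_simps sum_distrib_left)
qed

text \<open>Some nontrivial combination of the \<open>n + 1\<close> forms has zero coefficients
  except possibly at \<open>a\<close>. It vanishes at \<open>p\<close>, so
  \<open>p a \<noteq> 0\<close> would make it a linear relation.\<close>

lemma independent_no_common_zero:
  assumes I: "finite I" "card I = n + 1" and L: "\<And>i. i \<in> I \<Longrightarrow> L i \<in> forms n 1"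
    and ind: "independent_family L I" and p: "\<And>i. i \<in> I \<Longrightarrow> eval_poly p (L i) = 0" and a: "a \<le> n"
  shows "p a = 0"
proof (rule ccontr)
  assume pa: "p a \<noteq> 0"
  have "\<forall>i\<in>I. \<exists>c. L i = (\<Sum>v\<le>n. Const (c v) * Var v)"
    using linear_form_expand[OF L] by blast
  from bchoice[OF this] obtain c where c: "\<And>i. i \<in> I \<Longrightarrow> L i = (\<Sum>v\<le>n. Const (c i v) * Var v)"
    by blast
  obtain b where b: "\<exists>i\<in>I. b i \<noteq> 0" "\<And>v. v \<in> {..n} - {a} \<Longrightarrow> (\<Sum>i\<in>I. c i v * b i) = 0"
    using homogeneous_system_solution[of "{..n} - {a}" I "\<lambda>v i. c i v"] I a by auto
  have "(\<Sum>v\<le>n. p v * (\<Sum>i\<in>I. c i v * b i)) = (\<Sum>i\<in>I. b i * (\<Sum>v\<le>n. c i v * p v))"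
    unfolding sum_distrib_left by (subst sum.swap) (simp add: mult_ac)
  also have "\<dots> = 0"
  proof (rule sum.neutral, intro ballI)
    fix i assume "i \<in> I"
    then show "b i * (\<Sum>v\<le>n. c i v * p v) = 0" using p[of i] c[of i] by simp
  qed
  finally have "p a * (\<Sum>i\<in>I. c i a * b i) = 0"
    using a b(2) by (subst (asm) sum.remove[of _ a]) auto
  then have all: "(\<Sum>i\<in>I. c i v * b i) = 0" if "v \<le> n" for v
    using pa b(2)[of v] that by (cases "v = a") auto
  have "(\<Sum>i\<in>I. Const (b i) * L i) = (\<Sum>i\<in>I. \<Sum>v\<le>n. Const (c i v * b i) * Var v)"
    by (rule sum.cong) (simp_all add: c sum_distrib_left Const_mult mult_ac)
  also have "\<dots> = (\<Sum>v\<le>n. Const (\<Sum>i\<in>I. c i v * b i) * Var v)"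
    by (subst sum.swap) (simp add: Const_sum sum_distrib_right)
  also have "\<dots> = 0" by (rule sum.neutral) (simp add: all)
  finally have "\<forall>i\<in>I. b i = 0" using ind unfolding independent_family_iff[OF I(1)] by blast
  then show False using b(1) by blast
qed

text \<open>The first \<open>l - r + 1\<close> hyperplanes contain a common line, being fewer than
  \<open>n\<close>, and every \<sigma> contains one of their indices, so all products vanish on that
  line. A line has \<open>l * n + 1\<close> points that forms of degree \<open>l * n\<close>
  separate.\<close>

theorem generic_not_presentable_high_codim:
  assumes codim: "l - r + 1 < n" and r: "0 < r" "r \<le> l" "r \<le> d" and d: "l * n \<le> d"
  shows "generic_form n d (\<lambda>F. \<not> presentable n l r d F)"
proof (rule generic_not_presentable[OF _ r(3)])
  fix L assume gen: "general_linear_forms n l L"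
  let ?c = "l - r + 1"
  have L: "L i \<in> forms n 1" if "i \<in> {1..?c}" for i
    using general_linear_forms_form[OF gen] that r by auto
  obtain p a where p: "a \<le> n" "p a \<noteq> 0" "\<And>i. i \<in> {1..?c} \<Longrightarrow> eval_poly p (L i) = 0"
    using linear_common_zero[of "{1..?c}" n L] L codim by auto
  \<comment> \<open>The index 0 is free, as the hyperplanes are counted from 1. It carries the extra
    equation \<open>p' a = 0\<close>, which makes \<open>p'\<close> independent of
    \<open>p\<close>.\<close>
  have "\<exists>p'. (\<exists>b\<le>n. p' b \<noteq> 0) \<and> (\<forall>i\<in>insert 0 {1..?c}. eval_poly p' ((L(0 := Var a)) i) = 0)"
  proof (rule linear_common_zero)
    show "card (insert 0 {1..?c}) \<le> n" using codim by simp
    show "(L(0 := Var a)) i \<in> forms n 1" if "i \<in> insert 0 {1..?c}" for i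
      using that forms_Var[OF p(1)] L[of i] by (cases "i = 0") auto
  qed simp
  then obtain p' b where p': "b \<le> n" "p' b \<noteq> 0" "p' a = 0"
    "\<And>i. i \<in> {1..?c} \<Longrightarrow> eval_poly p' (L i) = 0" by force
  \<comment> \<open>Coordinates on the line: at the point \<open>q j\<close> the form
    \<open>A\<close> is 1 and \<open>B\<close> is \<open>j\<close>.\<close>
  define A where "A = Const (1 / p a) * Var a"
  define B where "B = Const (1 / p' b) * (Var b - Const (p b / p a) * Var a)"
  define q where "q j v = p v + of_nat j * p' v" for j :: nat and v
  have AB: "A \<in> forms n 1" "B \<in> forms n 1"
    unfolding A_def B_def by (intro forms_Const_mult forms_diff forms_Var p p')+
  have ev: "eval_poly (q j) A = 1" "eval_poly (q j) B = of_nat j" for j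
    using p(2) p'(2,3) by (simp_all add: A_def B_def q_def field_simps)
  define G where "G i = (\<Prod>k\<in>{..l * n} - {i}. B - Const (of_nat k) * A) * A ^ (d - l * n)" for i
  have "separates n l r d L {..l * n} q G"
    unfolding separates_def
  proof (intro conjI ballI)
    fix i assume i: "i \<in> {..l * n}"
    have "(\<Prod>k\<in>{..l * n} - {i}. B - Const (of_nat k) * A) \<in> forms n (card ({..l * n} - {i}))"
      by (intro forms_prod forms_diff forms_Const_mult AB) simp
    from forms_mult[OF this forms_power[OF AB(1), of "d - l * n"]] show "G i \<in> forms n d"
      using i d by (simp add: G_def)
    fix j assume j: "j \<in> {..l * n}"
    show "eval_poly (q j) (G i) = 0 \<longleftrightarrow> i \<noteq> j"
      using i j by (auto simp: G_def ev simp del: single_of_nat)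
  next
    fix \<sigma> j assume \<sigma>: "\<sigma> \<in> subs l r" and "j \<in> {..l * n}"
    have "\<sigma> \<inter> {1..?c} \<noteq> {}"
    proof
      assume "\<sigma> \<inter> {1..?c} = {}"
      then have "\<sigma> \<subseteq> {?c + 1..l}" using subsD(1)[OF \<sigma>] by force
      then have "card \<sigma> \<le> l - ?c" using card_mono[of "{?c + 1..l}" \<sigma>] by simp
      then show False using subsD(2)[OF \<sigma>] r by simp
    qed
    then obtain i where i: "i \<in> \<sigma>" "i \<in> {1..?c}" by blast
    have "eval_poly (q j) (L i) = 0"
      unfolding q_def eval_linear_form_line[OF L[OF i(2)]] using p(3)[OF i(2)] p'(4)[OF i(2)] by simp
    then show "\<exists>i\<in>\<sigma>. eval_poly (q j) (L i) = 0" using i(1) by blast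
  qed auto
  then show "\<exists>(Q::nat set) q G. separates n l r d L Q q G" by blast
qed

text \<open>The points are the intersections of \<open>n\<close> hyperplanes. By generality the
  point for \<rho> lies on no hyperplane with index in \<rho>, so the product of these linear forms
  separates it from the other points.\<close>

theorem generic_not_presentable_points:
  assumes n: "0 < n" and s: "0 < s" and d: "Suc s \<le> d" and count: "(n + s) * n < (n + s) choose n"
  shows "generic_form n d (\<lambda>F. \<not> presentable n (n + s) (Suc s) d F)"
proof (rule generic_not_presentable[OF _ d])
  let ?l = "n + s"
  fix L assume gen: "general_linear_forms n ?l L"
  have L: "L i \<in> forms n 1" if "i \<in> {1..?l}" for i
    using general_linear_forms_form[OF gen that] .
  have "\<forall>\<rho>\<in>subs ?l s. \<exists>p. (\<exists>a\<le>n. p a \<noteq> 0) \<and> (\<forall>i\<in>{1..?l} - \<rho>. eval_poly p (L i) = 0)"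
    using L by (intro ballI linear_common_zero) (auto simp: subs_complement simp del: One_nat_def)
  from bchoice[OF this] obtain p where p: "\<And>\<rho>. \<rho> \<in> subs ?l s \<Longrightarrow> \<exists>a\<le>n. p \<rho> a \<noteq> 0"
    "\<And>\<rho> i. \<rho> \<in> subs ?l s \<Longrightarrow> i \<in> {1..?l} - \<rho> \<Longrightarrow> eval_poly (p \<rho>) (L i) = 0" by blast
  obtain a where a: "\<And>\<rho>. \<rho> \<in> subs ?l s \<Longrightarrow> a \<rho> \<le> n \<and> p \<rho> (a \<rho>) \<noteq> 0" using p(1) by metis
  have nz: "eval_poly (p \<rho>) (L j) \<noteq> 0" if \<rho>: "\<rho> \<in> subs ?l s" and j: "j \<in> \<rho>" for \<rho> j
  proof
    assume zero: "eval_poly (p \<rho>) (L j) = 0"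
    let ?I = "insert j ({1..?l} - \<rho>)"
    have I: "?I \<subseteq> {1..?l}" "card ?I = n + 1"
      using subs_complement[OF \<rho>] subsD(1)[OF \<rho>] j by auto
    then have "?I \<in> index_sets n ?l" using s by (simp add: index_sets_def)
    then have "independent_family L ?I" using gen unfolding general_linear_forms_iff by blast
    moreover have "eval_poly (p \<rho>) (L i) = 0" if "i \<in> ?I" for i
      using that p(2)[OF \<rho>] zero by blast
    moreover have "L i \<in> forms n 1" if "i \<in> ?I" for i using that I(1) by (intro L) blast
    moreover have "finite ?I" using finite_subset[OF I(1)] by simp
    ultimately have "p \<rho> (a \<rho>) = 0"
      using I(2) a[OF \<rho>] by (intro independent_no_common_zero[of ?I n L "p \<rho>" "a \<rho>"]) simp_all
    then show False using a[OF \<rho>] by simp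
  qed
  define G where "G \<rho> = (\<Prod>j\<in>\<rho>. L j) * Var (a \<rho>) ^ (d - s)" for \<rho>
  have "separates n ?l (Suc s) d L (subs ?l s) p G"
    unfolding separates_def
  proof (intro conjI ballI)
    have "card (subs ?l s) = ?l choose s" unfolding subs_def by (subst n_subsets) auto
    also have "\<dots> = ?l choose n" by (subst binomial_symmetric) auto
    finally show "?l * n < card (subs ?l s)" using count by simp
  next
    fix \<rho> assume \<rho>: "\<rho> \<in> subs ?l s"
    have "(\<Prod>j\<in>\<rho>. L j) \<in> forms n s"
      using forms_prod[of \<rho> L n] subsD[OF \<rho>] L by blast
    from forms_mult[OF this forms_power[OF forms_Var, of "a \<rho>" n "d - s"]] show "G \<rho> \<in> forms n d"
      using a[OF \<rho>] d by (simp add: G_def)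
    fix \<rho>' assume \<rho>': "\<rho>' \<in> subs ?l s"
    show "eval_poly (p \<rho>') (G \<rho>) = 0 \<longleftrightarrow> \<rho> \<noteq> \<rho>'"
    proof (cases "\<rho> = \<rho>'")
      case True
      then show ?thesis using nz[OF \<rho>'] a[OF \<rho>'] subsD(3)[OF \<rho>'] by (simp add: G_def)
    next
      case False
      have "\<not> \<rho> \<subseteq> \<rho>'"
        using card_subset_eq[OF subsD(3)[OF \<rho>'], of \<rho>] subsD(2)[OF \<rho>] subsD(2)[OF \<rho>'] False by auto
      then obtain j where j: "j \<in> \<rho>" "j \<notin> \<rho>'" by blast
      then have "eval_poly (p \<rho>') (L j) = 0" using p(2)[OF \<rho>'] subsD(1)[OF \<rho>] by blast
      then have "(\<Prod>j\<in>\<rho>. eval_poly (p \<rho>') (L j)) = 0"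
        using j(1) subsD(3)[OF \<rho>] by (intro prod_zero) auto
      then show ?thesis using False by (simp add: G_def)
    qed
  next
    fix \<sigma> \<rho> assume \<sigma>: "\<sigma> \<in> subs ?l (Suc s)" and \<rho>: "\<rho> \<in> subs ?l s"
    have "\<not> \<sigma> \<subseteq> \<rho>" using card_mono[OF subsD(3)[OF \<rho>], of \<sigma>] subsD(2)[OF \<rho>] subsD(2)[OF \<sigma>] by auto
    then show "\<exists>i\<in>\<sigma>. eval_poly (p \<rho>) (L i) = 0" using p(2)[OF \<rho>] subsD(1)[OF \<sigma>] by blast
  qed (rule finite_subs)
  then show "\<exists>(Q::nat set set) q G. separates n ?l (Suc s) d L Q q G" by blast
qed

section \<open>Where the number of points exceeds the number of parameters\<close>

text \<open>By Pascal's rule the right-hand side grows by \<open>l choose (n - 1)\<close>, which is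
  at least \<open>n\<close>.\<close>

lemma choose_gt_step:
  assumes "0 < n" "n \<le> l" "l * n < l choose n"
  shows "Suc l * n < Suc l choose n"
proof -
  obtain m where m: "n = Suc m" using assms(1) by (metis gr0_implies_Suc)
  have "n choose m \<le> l choose m" using assms(2) by (rule binomial_right_mono)
  then have "n \<le> l choose m" by (simp add: m)
  then show ?thesis using assms(3) by (simp add: m)
qed

text \<open>The bound 6 is sharp: for five lines in the plane both numbers are 10.\<close>

lemma choose_gt_2: "6 \<le> l \<Longrightarrow> l * 2 < l choose 2"
proof (induction l rule: dec_induct)
  case base
  show ?case by (simp add: choose_two)
next
  case (step l)
  then show ?case using choose_gt_step[of 2 l] by simp
qed

lemma choose_gt_3: "3 \<le> n \<Longrightarrow> n * (n + 3) < (n + 3) choose 3"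
proof (induction n rule: dec_induct)
  case base
  show ?case by (simp add: eval_nat_numeral)
next
  case (step n)
  have "2 * ((n + 3) choose 2) = (n + 3) * (n + 2)"
    using choose_two[of "n + 3"] by (simp add: dvd_mult_div_cancel)
  then have "2 * (2 * n + 4) \<le> 2 * ((n + 3) choose 2)" using step.hyps by (simp add: algebra_simps)
  moreover have "(Suc n + 3) choose 3 = (n + 3 choose 2) + (n + 3 choose 3)"
    by (simp add: eval_nat_numeral)
  ultimately show ?case using step.IH by (simp add: algebra_simps)
qed

lemma choose_gt:
  assumes "3 \<le> n" "n + 3 \<le> l"
  shows "l * n < l choose n"
  using assms(2)
proof (induction l rule: dec_induct)
  case base
  have "(n + 3) choose n = (n + 3) choose 3" by (subst binomial_symmetric) auto
  then show ?case using choose_gt_3[OF assms(1)] by (simp add: mult.commute)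
next
  case (step l)
  then show ?case using choose_gt_step[of n l] assms(1) by simp
qed

section \<open>Lueroth quartics\<close>

text \<open>Normal form on the lines A, B, C, A + B + C and uA + vB + C: each term omits one line,
  and the last coefficient is scaled to 1. With three free lines this leaves 9 + 2 + 4 = 15
  parameters, the number of coefficients of a quartic. The general ring allows deformations as
  arguments.\<close>

definition luroth :: "'a::comm_ring_1 \<Rightarrow> 'a \<Rightarrow> 'a \<Rightarrow> 'a \<Rightarrow> 'a \<Rightarrow> 'a \<Rightarrow> 'a \<Rightarrow> 'a \<Rightarrow> 'a \<Rightarrow> 'a" where
  "luroth A B C u v c1 c2 c3 c4 =
     c1 * (B * C * (A + B + C) * (u * A + v * B + C)) +
     c2 * (A * C * (A + B + C) * (u * A + v * B + C)) +
     c3 * (A * B * (A + B + C) * (u * A + v * B + C)) +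
     c4 * (A * B * C * (u * A + v * B + C)) +
     A * B * C * (A + B + C)"

text \<open>In the following identity the \<open>g i\<close> account for rescaling the lines, and the \<open>D i\<close> for moving the
  five lines as tangents of a fixed conic.\<close>

lemma pentalateral_identity:
  fixes L1 L2 L3 L4 L5 :: "'a::comm_ring_1"
  assumes "D1 + D2 = m12 * L1 + m21 * L2" "D1 + D3 = m13 * L1 + m31 * L3" "D1 + D4 = m14 * L1 + m41 * L4"
    "D1 + D5 = m15 * L1 + m51 * L5" "D2 + D3 = m23 * L2 + m32 * L3" "D2 + D4 = m24 * L2 + m42 * L4"
    "D2 + D5 = m25 * L2 + m52 * L5" "D3 + D4 = m34 * L3 + m43 * L4" "D3 + D5 = m35 * L3 + m53 * L5"
    "D4 + D5 = m45 * L4 + m54 * L5"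
    and bal: "c1 * m15 + c2 * m25 + c3 * m35 + c4 * m45 + g1 + g2 + g3 + g4 = 0"
    and E: "E1 = c1 * D1 + g1 * L1" "E2 = c2 * D2 + g2 * L2" "E3 = c3 * D3 + g3 * L3"
    "E4 = c4 * D4 + g4 * L4" "E5 = D5 + g5 * L5"
    and e: "e1 = - (c1 * (c2 * m21 + c3 * m31 + c4 * m41 + m51 + g2 + g3 + g4 + g5))"
    "e2 = - (c2 * (c1 * m12 + c3 * m32 + c4 * m42 + m52 + g1 + g3 + g4 + g5))"
    "e3 = - (c3 * (c1 * m13 + c2 * m23 + c4 * m43 + m53 + g1 + g2 + g4 + g5))"
    "e4 = - (c4 * (c1 * m14 + c2 * m24 + c3 * m34 + m54 + g1 + g2 + g3 + g5))"
  shows "e1 * (L2 * L3 * L4 * L5) + c1 * (E2 * L3 * L4 * L5 + L2 * E3 * L4 * L5 + L2 * L3 * E4 * L5 + L2 * L3 * L4 * E5) +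
     (e2 * (L1 * L3 * L4 * L5) + c2 * (E1 * L3 * L4 * L5 + L1 * E3 * L4 * L5 + L1 * L3 * E4 * L5 + L1 * L3 * L4 * E5)) +
     (e3 * (L1 * L2 * L4 * L5) + c3 * (E1 * L2 * L4 * L5 + L1 * E2 * L4 * L5 + L1 * L2 * E4 * L5 + L1 * L2 * L4 * E5)) +
     (e4 * (L1 * L2 * L3 * L5) + c4 * (E1 * L2 * L3 * L5 + L1 * E2 * L3 * L5 + L1 * L2 * E3 * L5 + L1 * L2 * L3 * E5)) +
     (E1 * L2 * L3 * L4 + L1 * E2 * L3 * L4 + L1 * L2 * E3 * L4 + L1 * L2 * L3 * E4) = 0" (is "?lhs = 0")
proof -
  \<comment> \<open>At the vertex of lines \<open>i\<close> and \<open>j\<close> the expression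
    reduces to \<open>c i * E j + c j * E i\<close>, that is \<open>c i * c j * (D i + D j)\<close>
    with last coefficient 1, times the other three lines; this vanishes. The remaining multiples of
    fourfold products are cancelled by the \<open>e i\<close>, except for the product without
    \<open>L5\<close>, whose coefficient is fixed; \<open>bal\<close> handles that one.\<close>
  have "?lhs =
      c1 * c2 * (D1 + D2 - m12 * L1 - m21 * L2) * (L3 * L4 * L5) +
      c1 * c3 * (D1 + D3 - m13 * L1 - m31 * L3) * (L2 * L4 * L5) +
      c1 * c4 * (D1 + D4 - m14 * L1 - m41 * L4) * (L2 * L3 * L5) +
      c1 * (D1 + D5 - m15 * L1 - m51 * L5) * (L2 * L3 * L4) +
      c2 * c3 * (D2 + D3 - m23 * L2 - m32 * L3) * (L1 * L4 * L5) +
      c2 * c4 * (D2 + D4 - m24 * L2 - m42 * L4) * (L1 * L3 * L5) +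
      c2 * (D2 + D5 - m25 * L2 - m52 * L5) * (L1 * L3 * L4) +
      c3 * c4 * (D3 + D4 - m34 * L3 - m43 * L4) * (L1 * L2 * L5) +
      c3 * (D3 + D5 - m35 * L3 - m53 * L5) * (L1 * L2 * L4) +
      c4 * (D4 + D5 - m45 * L4 - m54 * L5) * (L1 * L2 * L3) +
      (c1 * m15 + c2 * m25 + c3 * m35 + c4 * m45 + g1 + g2 + g3 + g4) * (L1 * L2 * L3 * L4)"
    unfolding E e by (simp add: algebra_simps)
  then show ?thesis by (simp only: assms(1-10) bal) simp
qed

text \<open>In the dual plane, where (a, b, c) stands for the line aA + bB + cC, the conic -p bc + q
  ac - r ab = 0 passes through all five lines, and the vectors used as \<open>D i\<close> are
  tangent to it there. The values \<open>g1\<close>, \<open>g2\<close>, \<open>g3\<close> keep the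
  fourth line the sum of the first three; \<open>g5\<close>, \<open>u'\<close> and \<open>v'\<close>
  keep the fifth in normal form.\<close>

lemma luroth_kernel:
  fixes A B C :: "'a::comm_ring_1"
  assumes p: "p = u * (v - 1)" and q: "q = v * (u - 1)" and r: "r = u - v"
    and g1: "g1 = g4 - c4 * q - c2 * p + c3 * p" and g2: "g2 = g4 - c4 * p - c1 * q + c3 * q"
    and g3: "g3 = g4 - c1 * r + c2 * r" and g5: "g5 = g4 + c1 * r * (u - 1) - c2 * r * (v - 1)"
    and bal: "c1 * (- 2 * u * r - p) + c2 * (2 * v * r - q) + c3 * (u + v - 2) + c4 * (u + v) + g1 + g2 + g3 + g4 = 0"
    and A': "A' = c1 * (q * B + r * C) + g1 * A" and B': "B' = c2 * (p * A - r * C) + g2 * B"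
    and C': "C' = c3 * (- p * A - q * B) + g3 * C"
    and u': "u' = u * (1 - u) * (1 - c1 * r - c4 * v + c3 * (v - 1))"
    and v': "v' = v * (1 - v) * (1 + c2 * r - c4 * u + c3 * (u - 1))"
    and c1': "c1' = - (c1 * (c2 * q + c3 * r + c4 * r + r + g2 + g3 + g4 + g5))"
    and c2': "c2' = - (c2 * (c1 * p + c3 * (- r) + c4 * (- r) + (- r) + g1 + g3 + g4 + g5))"
    and c3': "c3' = - (c3 * (c1 * (- p) + c2 * (- q) + c4 * (- (p + q)) + (2 - u - v) + g1 + g2 + g4 + g5))"
    and c4': "c4' = - (c4 * (c1 * (- (q + r)) + c2 * (r - p) + c3 * (p + q) + (- (u + v)) + g1 + g2 + g3 + g5))"
  shows "coeff (luroth [:A, A':] [:B, B':] [:C, C':] [:u, u':] [:v, v':] [:c1, c1':] [:c2, c2':] [:c3, c3':] [:c4, c4':]) 1 = 0"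
proof -
  define P Q where "P = A + B + C" and "Q = u * A + v * B + C"
  define P' Q' where "P' = A' + B' + C'" and "Q' = u' * A + u * A' + v' * B + v * B' + C'"
  have P': "P' = c4 * (- q * A - p * B) + g4 * P"
    unfolding P'_def P_def A' B' C' g1 g2 g3 by (simp add: algebra_simps)
  have Q': "Q' = (u * (1 - u) * A + v * (1 - v) * B) + g5 * Q"
    unfolding Q'_def Q_def A' B' C' u' v' g5 g1 g2 g3 p q r by (simp add: algebra_simps)
  have main: "c1' * (B * C * P * Q) + c1 * (B' * C * P * Q + B * C' * P * Q + B * C * P' * Q + B * C * P * Q') +
     (c2' * (A * C * P * Q) + c2 * (A' * C * P * Q + A * C' * P * Q + A * C * P' * Q + A * C * P * Q')) +
     (c3' * (A * B * P * Q) + c3 * (A' * B * P * Q + A * B' * P * Q + A * B * P' * Q + A * B * P * Q')) +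
     (c4' * (A * B * C * Q) + c4 * (A' * B * C * Q + A * B' * C * Q + A * B * C' * Q + A * B * C * Q')) +
     (A' * B * C * P + A * B' * C * P + A * B * C' * P + A * B * C * P') = 0"
    by (rule pentalateral_identity[OF _ _ _ _ _ _ _ _ _ _ bal A' B' C' P' Q' c1' c2' c3' c4'])
       (unfold P_def Q_def p q r, simp_all add: algebra_simps)
  have mult: "coeff (a * b) 1 = coeff a 0 * coeff b 1 + coeff a 1 * coeff b 0"
    "coeff (a * b) 0 = coeff a 0 * coeff b 0" for a b :: "'a poly"
    by (simp_all add: coeff_mult)
  define PP QQ where "PP = [:A, A':] + [:B, B':] + [:C, C':]"
    and "QQ = [:u, u':] * [:A, A':] + [:v, v':] * [:B, B':] + [:C, C':]"
  have PQ: "coeff PP 0 = P" "coeff PP 1 = P'" "coeff QQ 0 = Q" "coeff QQ 1 = Q'"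
    unfolding PP_def QQ_def P_def Q_def P'_def Q'_def coeff_add mult by (simp_all add: algebra_simps)
  have lin: "coeff [:a, b:] 0 = a" "coeff [:a, b:] 1 = b" for a b :: 'a by simp_all
  have "coeff (luroth [:A, A':] [:B, B':] [:C, C':] [:u, u':] [:v, v':] [:c1, c1':] [:c2, c2':] [:c3, c3':] [:c4, c4':]) 1
     = c1' * (B * C * P * Q) + c1 * (B' * C * P * Q + B * C' * P * Q + B * C * P' * Q + B * C * P * Q') +
     (c2' * (A * C * P * Q) + c2 * (A' * C * P * Q + A * C' * P * Q + A * C * P' * Q + A * C * P * Q')) +
     (c3' * (A * B * P * Q) + c3 * (A' * B * P * Q + A * B' * P * Q + A * B * P' * Q + A * B * P * Q')) +
     (c4' * (A * B * C * Q) + c4 * (A' * B * C * Q + A * B' * C * Q + A * B * C' * Q + A * B * C * Q')) +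
     (A' * B * C * P + A * B' * C * P + A * B * C' * P + A * B * C * P')"
    unfolding luroth_def PP_def[symmetric] QQ_def[symmetric] coeff_add mult PQ lin by (simp add: algebra_simps)
  then show ?thesis unfolding main .
qed

lemma poly_luroth:
  "poly (luroth A B C u v c1 c2 c3 c4) s = luroth (poly A s) (poly B s) (poly C s) (poly u s) (poly v s)
     (poly c1 s) (poly c2 s) (poly c3 s) (poly c4 s)"
  by (simp add: luroth_def)

definition lin3 :: "(nat \<Rightarrow> complex) \<Rightarrow> nat \<Rightarrow> nat cpoly" where
  "lin3 x k = (\<Sum>j\<le>2. Const (x (k + j)) * Var j)"

definition luroth_family :: "(nat \<Rightarrow> complex) \<Rightarrow> nat cpoly" where
  "luroth_family x = luroth (lin3 x 0) (lin3 x 3) (lin3 x 6) (Const (x 9)) (Const (x 10))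
     (Const (x 11)) (Const (x 12)) (Const (x 13)) (Const (x 14))"

text \<open>Monomials divisible by the first variable, plus the \<open>d + 2\<close> monomials in
  the other two. Lower bounds suffice for comparing parameters.\<close>

lemma card_mons_2_Suc: "card (mons 2 d) + d + 2 \<le> card (mons 2 (Suc d))"
proof -
  let ?f = "\<lambda>m. Poly_Mapping.single (0::nat) (1::nat) + m"
  let ?g = "\<lambda>a. Poly_Mapping.single (1::nat) a + Poly_Mapping.single 2 (Suc d - a)"
  have f: "?f ` mons 2 d \<subseteq> mons 2 (Suc d)"
  proof (rule image_subsetI)
    fix m :: "nat monomial" assume "m \<in> mons 2 d"
    then show "?f m \<in> mons 2 (Suc d)"
      using keys_add[of "Poly_Mapping.single (0::nat) (1::nat)" m]
      by (auto simp: mons_def monomial_degree_add)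
  qed
  have g: "?g ` {..Suc d} \<subseteq> mons 2 (Suc d)"
  proof (rule image_subsetI)
    fix a assume "a \<in> {..Suc d}"
    then show "?g a \<in> mons 2 (Suc d)"
      using keys_add[of "Poly_Mapping.single (1::nat) a" "Poly_Mapping.single 2 (Suc d - a)"]
      by (auto simp: mons_def monomial_degree_add split: if_splits)
  qed
  have "inj_on ?f (mons 2 d)" by (auto simp: inj_on_def)
  moreover have "inj_on ?g {..Suc d}"
  proof (rule inj_onI)
    fix a b assume "?g a = ?g b"
    then have "Poly_Mapping.lookup (?g a) 1 = Poly_Mapping.lookup (?g b) 1" by simp
    then show "a = b" by (simp add: lookup_add lookup_single)
  qed
  moreover have "?f ` mons 2 d \<inter> ?g ` {..Suc d} = {}"
  proof -
    have "?f m \<noteq> ?g a" for m a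
    proof
      assume "?f m = ?g a"
      then have "Poly_Mapping.lookup (?f m) 0 = Poly_Mapping.lookup (?g a) 0" by simp
      then show False by (simp add: lookup_add lookup_single)
    qed
    then show ?thesis by blast
  qed
  ultimately have "card (?f ` mons 2 d \<union> ?g ` {..Suc d}) = card (mons 2 d) + (d + 2)"
    using finite_mons by (subst card_Un_disjoint) (auto simp: card_image)
  moreover have "card (?f ` mons 2 d \<union> ?g ` {..Suc d}) \<le> card (mons 2 (Suc d))"
    using f g by (intro card_mono finite_mons) blast
  ultimately show ?thesis by simp
qed

lemma card_mons_2: "card (mons 2 3) + 3 < card (mons 2 4)" "15 \<le> card (mons 2 4)"
proof -
  have "card (mons 2 0) = 1" by (simp add: mons_0)
  then show "card (mons 2 3) + 3 < card (mons 2 4)" "15 \<le> card (mons 2 4)"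
    using card_mons_2_Suc[of 0] card_mons_2_Suc[of 1] card_mons_2_Suc[of 2] card_mons_2_Suc[of 3]
    by (simp_all add: eval_nat_numeral)
qed

lemma lin3_line: "lin3 (\<lambda>i. x i + s * w i) k = lin3 x k + Const s * lin3 w k"
  by (simp add: lin3_def single_add Const_mult algebra_simps sum.distrib sum_distrib_left)

lemma lin3_combination:
  assumes "\<And>j. j \<le> 2 \<Longrightarrow> w (k + j) = a * x (k1 + j) + b * x (k2 + j) + c * x (k3 + j)"
  shows "lin3 w k = Const a * lin3 x k1 + Const b * lin3 x k2 + Const c * lin3 x k3"
proof -
  have "lin3 w k = (\<Sum>j\<le>2. Const (a * x (k1 + j) + b * x (k2 + j) + c * x (k3 + j)) * Var j)"
    unfolding lin3_def by (rule sum.cong) (simp_all only: assms atMost_iff)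
  then show ?thesis
    unfolding lin3_def by (simp add: single_add Const_mult distrib_right sum.distrib sum_distrib_left mult.assoc)
qed

lemma families_lin3: "{k..k + 2} \<subseteq> V \<Longrightarrow> (\<lambda>x. lin3 x k) \<in> families V"
  unfolding lin3_def by (intro families_sum families.scale pfuns.var) auto

lemma luroth_family_families: "luroth_family \<in> families {..<15}"
  unfolding luroth_family_def[abs_def] luroth_def
  by (intro families.add families_mult families_Const pfuns.var families_lin3) auto

lemma luroth_family_not_alg_independent:
  "\<not> alg_independent (mons 2 4) (\<lambda>k x. Poly_Mapping.lookup (luroth_family x) k)"
proof -
  \<comment> \<open>This is the component \<open>u'\<close> of the kernel vector; where it is
    nonzero the vector is nonzero.\<close>
  define h :: "(nat \<Rightarrow> complex) \<Rightarrow> complex" where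
    "h x = x 9 * (1 - x 9) * (1 - x 11 * (x 9 - x 10) - x 14 * x 10 + x 13 * (x 10 - 1))" for x
  have h: "h \<in> pfuns {..<15}"
    unfolding h_def by (intro pfuns.mult pfuns_diff pfuns.add pfuns.const pfuns.var) auto
  have h0: "h ((\<lambda>_. 0)(9 := 2)) \<noteq> 0" by (simp add: h_def)
  show ?thesis
  proof (rule degenerate_not_alg_independent[where V = "{..<15}" and h = h, OF _ finite_mons _ _ h h0])
    show "card {..<15::nat} \<le> card (mons 2 4)" using card_mons_2 by simp
    show "(\<lambda>x. Poly_Mapping.lookup (luroth_family x) k) \<in> pfuns {..<15}" for k
      by (rule families_lookup[OF luroth_family_families])
    fix x :: "nat \<Rightarrow> complex" assume hx: "h x \<noteq> 0"
    define u v c1 c2 c3 c4 where "u = x 9" and "v = x 10" and "c1 = x 11" and "c2 = x 12" and "c3 = x 13" and "c4 = x 14"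
    define p q r where "p = u * (v - 1)" and "q = v * (u - 1)" and "r = u - v"
    \<comment> \<open>The balance condition solved for \<open>g4\<close>: each of \<open>g1\<close>,
      \<open>g2\<close>, \<open>g3\<close> is \<open>g4\<close> plus known terms, so
      \<open>g4\<close> occurs four times.\<close>
    define g4 where "g4 = - (c1 * (- 2 * u * r - p) + c2 * (2 * v * r - q) + c3 * (u + v - 2) + c4 * (u + v)
        + (- c4 * q - c2 * p + c3 * p) + (- c4 * p - c1 * q + c3 * q) + (- c1 * r + c2 * r)) / 4"
    define g1 g2 g3 g5 where "g1 = g4 - c4 * q - c2 * p + c3 * p" and "g2 = g4 - c4 * p - c1 * q + c3 * q"
      and "g3 = g4 - c1 * r + c2 * r" and "g5 = g4 + c1 * r * (u - 1) - c2 * r * (v - 1)"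
    define u' where "u' = u * (1 - u) * (1 - c1 * r - c4 * v + c3 * (v - 1))"
    define v' where "v' = v * (1 - v) * (1 + c2 * r - c4 * u + c3 * (u - 1))"
    define c1' where "c1' = - (c1 * (c2 * q + c3 * r + c4 * r + r + g2 + g3 + g4 + g5))"
    define c2' where "c2' = - (c2 * (c1 * p + c3 * (- r) + c4 * (- r) + (- r) + g1 + g3 + g4 + g5))"
    define c3' where "c3' = - (c3 * (c1 * (- p) + c2 * (- q) + c4 * (- (p + q)) + (2 - u - v) + g1 + g2 + g4 + g5))"
    define c4' where "c4' = - (c4 * (c1 * (- (q + r)) + c2 * (r - p) + c3 * (p + q) + (- (u + v)) + g1 + g2 + g3 + g5))"
    define w where "w i = (if i < 3 then c1 * (q * x (3 + i) + r * x (6 + i)) + g1 * x i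
      else if i < 6 then c2 * (p * x (i - 3) - r * x (3 + i)) + g2 * x i
      else if i < 9 then c3 * (- p * x (i - 6) - q * x (i - 3)) + g3 * x i
      else if i = 9 then u' else if i = 10 then v' else if i = 11 then c1'
      else if i = 12 then c2' else if i = 13 then c3' else c4')" for i
    have bal: "c1 * (- 2 * u * r - p) + c2 * (2 * v * r - q) + c3 * (u + v - 2) + c4 * (u + v) + g1 + g2 + g3 + g4 = 0"
      unfolding g1_def g2_def g3_def by (simp add: g4_def field_simps)
    have w: "w (0 + j) = (c1 * q) * x (3 + j) + (c1 * r) * x (6 + j) + g1 * x (0 + j)"
      "w (3 + j) = (c2 * p) * x (0 + j) + (- c2 * r) * x (6 + j) + g2 * x (3 + j)"
      "w (6 + j) = (- c3 * p) * x (0 + j) + (- c3 * q) * x (3 + j) + g3 * x (6 + j)" if j2: "j \<le> 2" for j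
    proof -
      consider "j = 0" | "j = 1" | "j = 2" using j2 by linarith
      note j = this
      show "w (0 + j) = (c1 * q) * x (3 + j) + (c1 * r) * x (6 + j) + g1 * x (0 + j)"
        using j by cases (simp_all add: w_def distrib_left mult.assoc)
      show "w (3 + j) = (c2 * p) * x (0 + j) + (- c2 * r) * x (6 + j) + g2 * x (3 + j)"
        using j by cases (simp_all add: w_def right_diff_distrib mult.assoc flip: numeral_2_eq_2)
      show "w (6 + j) = (- c3 * p) * x (0 + j) + (- c3 * q) * x (3 + j) + g3 * x (6 + j)"
        using j by cases (simp_all add: w_def right_diff_distrib mult.assoc flip: numeral_2_eq_2)
    qed
    have lins: "lin3 w 0 = Const c1 * (Const q * lin3 x 3 + Const r * lin3 x 6) + Const g1 * lin3 x 0"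
      "lin3 w 3 = Const c2 * (Const p * lin3 x 0 - Const r * lin3 x 6) + Const g2 * lin3 x 3"
      "lin3 w 6 = Const c3 * (- Const p * lin3 x 0 - Const q * lin3 x 3) + Const g3 * lin3 x 6"
      using lin3_combination[where w = w and x = x and k = 0, OF w(1)]
        lin3_combination[where w = w and x = x and k = 3, OF w(2)]
        lin3_combination[where w = w and x = x and k = 6, OF w(3)]
      by (simp_all add: single_uminus Const_mult distrib_left right_diff_distrib mult.assoc)
    define qq where "qq = luroth [:lin3 x 0, lin3 w 0:] [:lin3 x 3, lin3 w 3:] [:lin3 x 6, lin3 w 6:]
      [:Const u, Const u':] [:Const v, Const v':] [:Const c1, Const c1':] [:Const c2, Const c2':]
      [:Const c3, Const c3':] [:Const c4, Const c4':]"
    have "coeff qq 1 = 0"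
      unfolding qq_def
    proof (rule luroth_kernel[where ?g4.0 = "Const g4" and ?g5.0 = "Const g5", OF _ _ _ _ _ _ _ _ lins])
      show "Const c1 * (- 2 * Const u * Const r - Const p) + Const c2 * (2 * Const v * Const r - Const q) +
        Const c3 * (Const u + Const v - 2) + Const c4 * (Const u + Const v) + Const g1 + Const g2 + Const g3 + Const g4 = (0::nat cpoly)"
        using arg_cong[OF bal, of "Const :: complex \<Rightarrow> nat cpoly"]
        by (simp add: single_add single_diff single_uminus Const_mult)
    qed (simp_all add: p_def q_def r_def g1_def g2_def g3_def g5_def u'_def v'_def c1'_def c2'_def c3'_def c4'_def
        single_add single_diff single_uminus Const_mult)
    moreover have "luroth_family (\<lambda>i. x i + s * w i) = poly qq (Const s)" for s
    proof -
      have wv: "w 9 = u'" "w 10 = v'" "w 11 = c1'" "w 12 = c2'" "w 13 = c3'" "w 14 = c4'"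
        by (simp_all add: w_def)
      show ?thesis
        unfolding luroth_family_def lin3_line qq_def poly_luroth wv
        by (simp add: single_add Const_mult u_def v_def c1_def c2_def c3_def c4_def)
    qed
    ultimately have "((\<lambda>s. Poly_Mapping.lookup (luroth_family (\<lambda>i. x i + s * w i)) k) has_field_derivative 0) (at 0)" for k
      using lookup_poly_DERIV[of qq k] by simp
    moreover have "w 9 \<noteq> 0" using hx by (simp add: w_def u'_def h_def u_def v_def c1_def c3_def c4_def r_def)
    ultimately show "\<exists>w. (\<exists>i\<in>{..<15}. w i \<noteq> 0) \<and>
       (\<forall>k\<in>mons 2 4. ((\<lambda>s. Poly_Mapping.lookup (luroth_family (\<lambda>i. x i + s * w i)) k) has_field_derivative 0) (at 0))"
      by (intro exI[of _ w]) (auto intro!: bexI[of _ 9])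
  qed simp
qed

text \<open>Every term has degree 4 in \<open>A\<close>, \<open>B\<close>, \<open>C\<close>, so
  scaling the lines by a fourth root of \<open>k5\<close> absorbs the last coefficient.\<close>

lemma luroth_scaled_terms:
  fixes A B C :: "nat cpoly"
  assumes \<mu>: "\<mu> ^ 4 = k5" and k5: "k5 \<noteq> 0"
  shows "Const k1 * (B * C * (A + B + C) * (Const u * A + Const v * B + C)) +
     Const k2 * (A * C * (A + B + C) * (Const u * A + Const v * B + C)) +
     Const k3 * (A * B * (A + B + C) * (Const u * A + Const v * B + C)) +
     Const k4 * (A * B * C * (Const u * A + Const v * B + C)) +
     Const k5 * (A * B * C * (A + B + C)) =
   luroth (Const \<mu> * A) (Const \<mu> * B) (Const \<mu> * C) (Const u) (Const v)
     (Const (k1 / k5)) (Const (k2 / k5)) (Const (k3 / k5)) (Const (k4 / k5))"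
proof -
  define P Q where "P = A + B + C" and "Q = Const u * A + Const v * B + C"
  define m where "m = (Const \<mu> :: nat cpoly)"
  have m4: "m * m * m * m = Const k5"
    using \<mu> by (simp add: m_def mult.assoc numeral_eq_Suc flip: Const_mult)
  have k: "Const (k / k5) * (m * m * m * m) = Const k" for k
    using k5 unfolding m4 by (simp flip: Const_mult)
  have "m * A + m * B + m * C = m * P" "Const u * (m * A) + Const v * (m * B) + m * C = m * Q"
    by (simp_all add: P_def Q_def algebra_simps)
  then have "luroth (m * A) (m * B) (m * C) (Const u) (Const v)
     (Const (k1 / k5)) (Const (k2 / k5)) (Const (k3 / k5)) (Const (k4 / k5)) =
     Const (k1 / k5) * (m * m * m * m) * (B * C * P * Q) + Const (k2 / k5) * (m * m * m * m) * (A * C * P * Q) +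
     Const (k3 / k5) * (m * m * m * m) * (A * B * P * Q) + Const (k4 / k5) * (m * m * m * m) * (A * B * C * Q) +
     (m * m * m * m) * (A * B * C * P)"
    unfolding luroth_def by (simp add: mult_ac)
  also have "\<dots> = Const k1 * (B * C * P * Q) + Const k2 * (A * C * P * Q) + Const k3 * (A * B * P * Q) +
      Const k4 * (A * B * C * Q) + Const k5 * (A * B * C * P)"
    unfolding k unfolding m4 ..
  finally show ?thesis by (simp only: P_def Q_def m_def)
qed

lemma subs_5_4: "subs 5 4 = (\<lambda>i. {1..5} - {i}) ` {1..5}" "inj_on (\<lambda>i. {1..5} - {i}) {1..5::nat}"
proof -
  show "inj_on (\<lambda>i. {1..5} - {i}) {1..5::nat}"
  proof (rule inj_onI)
    fix i j :: nat assume "i \<in> {1..5}" "j \<in> {1..5}" "{1..5} - {i} = {1..5} - {j}"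
    then show "i = j" by blast
  qed
  show "subs 5 4 = (\<lambda>i. {1..5} - {i}) ` {1..5}"
  proof
    show "subs 5 4 \<subseteq> (\<lambda>i. {1..5} - {i}) ` {1..5}"
    proof
      fix \<sigma> assume \<sigma>: "\<sigma> \<in> subs 5 4"
      have "card ({1..5} - \<sigma>) = 1" using subsD[OF \<sigma>] by (simp add: card_Diff_subset)
      then obtain i where i: "{1..5} - \<sigma> = {i}" by (rule card_1_singletonE)
      then have "\<sigma> = {1..5} - {i}" "i \<in> {1..5}" using subsD(1)[OF \<sigma>] by blast+
      then show "\<sigma> \<in> (\<lambda>i. {1..5} - {i}) ` {1..5}" by blast
    qed
  qed (auto simp: subs_def)
qed

text \<open>In a relation among four lines of a general family no coefficient vanishes.\<close>

lemma four_general_lines: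
  assumes gen: "general_linear_forms 2 5 L" and j: "j \<in> {4, 5}"
  shows "\<exists>a b c. a \<noteq> 0 \<and> b \<noteq> 0 \<and> c \<noteq> 0 \<and> L j = Const a * L 1 + Const b * L 2 + Const c * L 3"
proof -
  let ?I = "{1, 2, 3, j}"
  have I: "?I \<subseteq> {1..5}" "finite ?I" "card ?I = 4" using j by auto
  have "\<forall>i\<in>?I. \<exists>c. L i = (\<Sum>v\<le>2. Const (c v) * Var v)"
    using linear_form_expand[OF general_linear_forms_form[OF gen]] I(1) by blast
  from bchoice[OF this] obtain c where c: "\<And>i. i \<in> ?I \<Longrightarrow> L i = (\<Sum>v\<le>2. Const (c i v) * Var v)" by blast
  obtain b where b: "\<exists>i\<in>?I. b i \<noteq> 0" "\<And>v. v \<in> {..2} \<Longrightarrow> (\<Sum>i\<in>?I. c i v * b i) = 0"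
    using homogeneous_system_solution[of "{..2::nat}" ?I "\<lambda>v i. c i v"] I by auto
  have "(\<Sum>i\<in>?I. Const (b i) * L i) = (\<Sum>i\<in>?I. \<Sum>v\<le>2. Const (c i v * b i) * Var v)"
    by (rule sum.cong[OF refl], subst c) (simp_all add: sum_distrib_left Const_mult mult_ac)
  also have "\<dots> = (\<Sum>v\<le>2. Const (\<Sum>i\<in>?I. c i v * b i) * Var v)"
    unfolding Const_sum sum_distrib_right by (rule sum.swap)
  also have "\<dots> = 0" by (intro sum.neutral ballI) (simp only: b(2) single_zero mult_zero_left)
  finally have rel: "(\<Sum>i\<in>?I. Const (b i) * L i) = 0" .
  have nz: "b k \<noteq> 0" if k: "k \<in> ?I" for k
  proof
    assume bk: "b k = 0"
    have K: "?I - {k} \<subseteq> {1..5}" "card (?I - {k}) = min 5 (2 + 1)" using I k by auto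
    then have "?I - {k} \<in> index_sets 2 5" by (simp only: index_sets_def mem_Collect_eq simp_thms)
    then have "independent_family L (?I - {k})" using gen unfolding general_linear_forms_iff by blast
    then have ind: "\<And>b. (\<Sum>i\<in>?I - {k}. Const (b i) * L i) = 0 \<Longrightarrow> \<forall>i\<in>?I - {k}. b i = 0"
      by (subst (asm) independent_family_iff) auto
    have "(\<Sum>i\<in>?I - {k}. Const (b i) * L i) = 0"
      using rel bk k by (subst (asm) sum.remove[OF I(2) k]) simp
    then show False using ind[of b] b(1) bk by blast
  qed
  have jn: "j \<noteq> 1" "j \<noteq> 2" "j \<noteq> 3" using j by auto
  have rel': "Const (b 1) * L 1 + Const (b 2) * L 2 + Const (b 3) * L 3 + Const (b j) * L j = 0"
    using rel jn by (simp add: add.assoc)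
  have "L j = Const (1 / b j) * (Const (b j) * L j)"
    using nz[of j] by (simp add: mult.assoc[symmetric] flip: Const_mult)
  also have "Const (b j) * L j = - (Const (b 1) * L 1 + Const (b 2) * L 2 + Const (b 3) * L 3)"
    by (rule eq_neg_iff_add_eq_0[THEN iffD2]) (use rel' in \<open>simp only: add_ac\<close>)
  also have "Const (1 / b j) * - (Const (b 1) * L 1 + Const (b 2) * L 2 + Const (b 3) * L 3) =
     Const (- b 1 / b j) * L 1 + Const (- b 2 / b j) * L 2 + Const (- b 3 / b j) * L 3"
    by (simp add: distrib_left right_diff_distrib mult.assoc[symmetric] single_uminus flip: Const_mult)
  finally show ?thesis using nz by (intro exI[of _ "- b 1 / b j"] exI[of _ "- b 2 / b j"] exI[of _ "- b 3 / b j"]) simp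
qed

text \<open>If the product without \<open>L 5\<close> has coefficient zero, then \<open>L 5\<close>
  divides the quartic, and a line times a cubic has only 3 + 10 < 15 parameters. All other
  presentations can be brought to the normal form, a degenerate family.\<close>

theorem luroth_quartics_not_generic: "generic_form 2 4 (\<lambda>F. \<not> presentable 2 5 4 4 F)"
proof -
  define V where "V = Inl ` {..<3::nat} \<union> (Inr ` mons 2 3 :: (nat + nat monomial) set)"
  define \<Psi> :: "(nat + nat monomial \<Rightarrow> complex) \<Rightarrow> nat cpoly" where
    "\<Psi> x = lin3 (\<lambda>i. x (Inl i)) 0 * form_of 2 3 (\<lambda>m. x (Inr m))" for x
  define \<Phi> :: "bool \<Rightarrow> (nat + nat monomial \<Rightarrow> complex) \<Rightarrow> nat cpoly" where
    "\<Phi> b x = (if b then luroth_family (\<lambda>i. x (Inl i)) else \<Psi> x)" for b x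
  show ?thesis
  proof (rule generic_not_in_families[where I = UNIV and \<Phi> = \<Phi>])
    fix b
    show "\<not> alg_independent (mons 2 4) (\<lambda>k x. Poly_Mapping.lookup (\<Phi> b x) k)"
    proof (cases b)
      case True
      have "\<exists>G\<in>pfuns (mons 2 4). (\<forall>x. G (\<lambda>k. Poly_Mapping.lookup (luroth_family x) k) = 0) \<and> (\<exists>y. G y \<noteq> 0)"
        using luroth_family_not_alg_independent unfolding alg_independent_def by blast
      then show ?thesis using True unfolding alg_independent_def \<Phi>_def by auto
    next
      case False
      have card: "card V < card (mons 2 4)"
      proof -
        have "card V = card (Inl ` {..<3} :: (nat + nat monomial) set) + card (Inr ` mons 2 3 :: (nat + nat monomial) set)"
          unfolding V_def by (rule card_Un_disjoint) (auto simp: finite_mons)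
        then show ?thesis using card_mons_2(1) by (simp add: card_image)
      qed
      have "(\<lambda>x. \<Psi> x) \<in> families V"
        unfolding \<Psi>_def lin3_def form_of_def
        by (intro families_mult families_sum families.scale pfuns.var) (auto simp: V_def)
      then have "\<not> alg_independent (mons 2 4) (\<lambda>k x. Poly_Mapping.lookup (\<Psi> x) k)"
        by (intro card_less_not_alg_independent[OF _ finite_mons card] families_lookup)
           (simp_all add: V_def finite_mons)
      then show ?thesis using False by (simp add: \<Phi>_def)
    qed
  next
    fix F assume F: "F \<in> forms 2 4" "presentable 2 5 4 4 F"
    obtain L where L: "general_linear_forms 2 5 L" "F \<in> star 2 5 4 4 L"
      using F(2) unfolding presentable_iff_star by blast
    obtain M where M: "\<And>\<sigma>. \<sigma> \<in> subs 5 4 \<Longrightarrow> M \<sigma> \<in> forms 2 0" "F = (\<Sum>\<sigma>\<in>subs 5 4. (\<Prod>i\<in>\<sigma>. L i) * M \<sigma>)"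
      using L(2) unfolding star_def by auto
    define c where "c i = Poly_Mapping.lookup (M ({1..5} - {i})) 0" for i
    have Mc: "M ({1..5} - {i}) = Const (c i)" if "i \<in> {1..5}" for i
      unfolding c_def by (rule forms_0_eq[OF M(1)]) (use that subs_5_4 in blast)
    have F_eq: "F = Const (c 1) * (L 2 * L 3 * L 4 * L 5) + Const (c 2) * (L 1 * L 3 * L 4 * L 5) +
      Const (c 3) * (L 1 * L 2 * L 4 * L 5) + Const (c 4) * (L 1 * L 2 * L 3 * L 5) + Const (c 5) * (L 1 * L 2 * L 3 * L 4)"
    proof -
      have "F = (\<Sum>i\<in>{1..5}. (\<Prod>j\<in>{1..5} - {i}. L j) * M ({1..5} - {i}))"
        unfolding M(2) subs_5_4(1) by (subst sum.reindex[OF subs_5_4(2)]) (simp only: o_def)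
      also have "\<dots> = (\<Sum>i\<in>{1..5}. (\<Prod>j\<in>{1..5} - {i}. L j) * Const (c i))"
        by (rule sum.cong[OF refl]) (simp only: Mc)
      finally have "F = (\<Sum>i\<in>{1..5}. (\<Prod>j\<in>{1..5} - {i}. L j) * Const (c i))" .
      moreover have "{1..5::nat} = {1, 2, 3, 4, 5}" by auto
      moreover have "{1, 2, 3, 4, 5} - {1::nat} = {2, 3, 4, 5}" "{1, 2, 3, 4, 5} - {2::nat} = {1, 3, 4, 5}"
        "{1, 2, 3, 4, 5} - {3::nat} = {1, 2, 4, 5}" "{1, 2, 3, 4, 5} - {4::nat} = {1, 2, 3, 5}"
        "{1, 2, 3, 4, 5} - {5::nat} = {1, 2, 3, 4}" by auto
      ultimately show ?thesis by (simp add: mult_ac add_ac del: One_nat_def insert_Diff_if)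
    qed
    have L_form: "L i \<in> forms 2 1" if "i \<in> {1..5}" for i
      by (rule general_linear_forms_form[OF L(1) that])
    show "\<exists>b\<in>UNIV. \<exists>x. F = \<Phi> b x"
    proof (cases "c 5 = 0")
      case True
      define G where "G = Const (c 1) * (L 2 * L 3 * L 4) + Const (c 2) * (L 1 * L 3 * L 4) +
        Const (c 3) * (L 1 * L 2 * L 4) + Const (c 4) * (L 1 * L 2 * L 3)"
      have "L i * L j * L k \<in> forms 2 3" if "i \<in> {1..5}" "j \<in> {1..5}" "k \<in> {1..5}" for i j k
        using forms_mult[OF forms_mult[OF L_form[OF that(1)] L_form[OF that(2)]] L_form[OF that(3)]]
        by (simp add: eval_nat_numeral)
      then have "G \<in> forms 2 3" unfolding G_def by (intro forms_add forms_Const_mult) auto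
      then have G: "form_of 2 3 (Poly_Mapping.lookup G) = G"
        unfolding form_of_def by (rule forms_eq_sum[symmetric])
      obtain a where a: "L 5 = (\<Sum>v\<le>2. Const (a v) * Var v)"
        using linear_form_expand[OF L_form[of 5]] by auto
      have "F = L 5 * G" unfolding F_eq G_def using True by (simp add: algebra_simps)
      then have "F = \<Psi> (case_sum a (Poly_Mapping.lookup G))"
        by (simp add: \<Psi>_def G a lin3_def)
      then show ?thesis by (intro bexI[of _ False]) (auto simp: \<Phi>_def)
    next
      case False
      obtain a1 a2 a3 where a: "a1 \<noteq> 0" "a2 \<noteq> 0" "a3 \<noteq> 0" "L 4 = Const a1 * L 1 + Const a2 * L 2 + Const a3 * L 3"
        using four_general_lines[OF L(1), of 4] by auto
      obtain b1 b2 b3 where b: "b3 \<noteq> 0" "L 5 = Const b1 * L 1 + Const b2 * L 2 + Const b3 * L 3"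
        using four_general_lines[OF L(1), of 5] by auto
      define A B C where "A = Const a1 * L 1" and "B = Const a2 * L 2" and "C = Const a3 * L 3"
      \<comment> \<open>Scaling the first three lines by \<open>a1\<close>, \<open>a2\<close>,
        \<open>a3\<close> makes the fourth their sum; \<open>w\<close> then scales the fifth so that
        its coefficient at \<open>C\<close> is 1.\<close>
      define w u v where "w = b3 / a3" and "u = b1 / a1 / w" and "v = b2 / a2 / w"
      have w0: "w \<noteq> 0" using b(1) a(3) by (simp add: w_def)
      define P Q where "P = A + B + C" and "Q = Const u * A + Const v * B + C"
      have L123: "L 1 = Const (1 / a1) * A" "L 2 = Const (1 / a2) * B" "L 3 = Const (1 / a3) * C"
        using a by (simp_all add: A_def B_def C_def mult.assoc[symmetric] flip: Const_mult)
      have L4: "L 4 = P" by (simp add: a(4) P_def A_def B_def C_def)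
      have L5: "L 5 = Const w * Q"
        using a w0 by (simp add: b(2) Q_def A_def B_def C_def distrib_left mult.assoc[symmetric] u_def v_def flip: Const_mult)
           (simp add: w_def)
      define k1 k2 k3 k4 k5 where "k1 = c 1 * (w / (a2 * a3))" and "k2 = c 2 * (w / (a1 * a3))"
        and "k3 = c 3 * (w / (a1 * a2))" and "k4 = c 4 * (w / (a1 * a2 * a3))" and "k5 = c 5 * (1 / (a1 * a2 * a3))"
      have F2: "F = Const k1 * (B * C * P * Q) + Const k2 * (A * C * P * Q) + Const k3 * (A * B * P * Q) +
        Const k4 * (A * B * C * Q) + Const k5 * (A * B * C * P)"
      proof -
        have inv: "Const (w / (a2 * a3)) = Const (1 / a2) * Const (1 / a3) * (Const w :: nat cpoly)"
          "Const (w / (a1 * a3)) = Const (1 / a1) * Const (1 / a3) * (Const w :: nat cpoly)"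
          "Const (w / (a1 * a2)) = Const (1 / a1) * Const (1 / a2) * (Const w :: nat cpoly)"
          "Const (w / (a1 * a2 * a3)) = Const (1 / a1) * Const (1 / a2) * Const (1 / a3) * (Const w :: nat cpoly)"
          "Const (1 / (a1 * a2 * a3)) = Const (1 / a1) * Const (1 / a2) * (Const (1 / a3) :: nat cpoly)"
          by (simp_all flip: Const_mult)
        show ?thesis
          unfolding F_eq L123 L4 L5 k1_def k2_def k3_def k4_def k5_def Const_mult[of "c _"] inv
          by (simp only: mult_ac)
      qed
      have k5: "k5 \<noteq> 0" using False a by (simp add: k5_def)
      define \<mu> where "\<mu> = csqrt (csqrt k5)"
      have \<mu>: "\<mu> ^ 4 = k5"
      proof -
        have "\<mu> ^ 4 = (\<mu>\<^sup>2)\<^sup>2" by (simp flip: power_mult)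
        then show ?thesis by (simp only: \<mu>_def power2_csqrt)
      qed
      have "\<exists>y. Const \<mu> * D = lin3 (\<lambda>i. y i) 0" if "D \<in> forms 2 1" for D
        using linear_form_expand[OF forms_Const_mult[OF that, of \<mu>]] unfolding lin3_def by auto
      moreover have "A \<in> forms 2 1" "B \<in> forms 2 1" "C \<in> forms 2 1"
        unfolding A_def B_def C_def by (intro forms_Const_mult L_form; simp)+
      ultimately obtain yA yB yC where y: "Const \<mu> * A = lin3 yA 0" "Const \<mu> * B = lin3 yB 0" "Const \<mu> * C = lin3 yC 0"
        by metis
      define x where "x i = (if i < 3 then yA i else if i < 6 then yB (i - 3) else if i < 9 then yC (i - 6)
        else if i = 9 then u else if i = 10 then v else if i = 11 then k1 / k5 else if i = 12 then k2 / k5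
        else if i = 13 then k3 / k5 else k4 / k5)" for i
      have lins: "lin3 x 0 = lin3 yA 0" "lin3 x 3 = lin3 yB 0" "lin3 x 6 = lin3 yC 0"
        unfolding lin3_def by (rule sum.cong; simp add: x_def)+
      have "F = luroth (Const \<mu> * A) (Const \<mu> * B) (Const \<mu> * C) (Const u) (Const v)
         (Const (k1 / k5)) (Const (k2 / k5)) (Const (k3 / k5)) (Const (k4 / k5))"
        unfolding F2 P_def Q_def by (rule luroth_scaled_terms[OF \<mu> k5])
      also have "\<dots> = luroth_family x"
        unfolding luroth_family_def lins y by (simp add: x_def)
      finally have "F = luroth_family x" .
      then show ?thesis
        by (intro bexI[of _ True] exI[of _ "case_sum x (\<lambda>_. 0)"]) (simp_all add: \<Phi>_def)
    qed
  qed simp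
qed

section \<open>The classification\<close>

theorem theorem1p2:
  shows
    "(\<forall>n l r :: nat. n > 0 \<and> l > 0 \<and> r > 0 \<and> r \<le> l \<and> l - r + 1 < n \<longrightarrow>
        (\<exists>d0. \<forall>d. d \<ge> d0 \<and> d > 0 \<and> r \<le> min d l \<longrightarrow>
           generic_form n d (\<lambda>F. \<not> presentable n l r d F))) \<and>
     (\<forall>n l r d :: nat. n > 0 \<and> l > 0 \<and> r > 0 \<and> d > 0 \<and> r \<le> min d l \<and> l - r + 1 = n \<longrightarrow>
        (generic_form n d (\<lambda>F. presentable n l r d F) \<longleftrightarrow>
           (n, l, r, d) \<in>
             {(1, l, l, d) | l d. d \<ge> l \<and> l \<ge> 1} \<union>
             {(2, 2, 1, d) | d. d \<ge> 1} \<union>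
             {(2, 3, 2, d) | d. d \<ge> 2} \<union>
             {(2, 4, 3, d) | d. d \<ge> 3} \<union>
             {(2, 5, 4, d) | d. d \<ge> 5} \<union>
             {(n, n, 1, d) | n d. n \<ge> 3 \<and> d \<ge> 1} \<union>
             {(n, n + 1, 2, d) | n d. n \<ge> 3 \<and> d \<ge> 2} \<union>
             {(n, n + 2, 3, d) | n d. n \<ge> 3 \<and> d \<ge> 3})) \<and>
     (\<forall>n l r d :: nat. n > 0 \<and> l > 0 \<and> r > 0 \<and> d > 0 \<and> r \<le> min d l \<and> l - r + 1 > n \<longrightarrow>
        (\<forall>F\<in>forms n d. presentable n l r d F))"
proof (intro conjI allI impI ballI)
  fix n l r :: nat
  assume "n > 0 \<and> l > 0 \<and> r > 0 \<and> r \<le> l \<and> l - r + 1 < n"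
  \<comment> \<open>From degree \<open>l * n\<close> on, the \<open>l * n + 1\<close> points on a
    line can be separated.\<close>
  then show "\<exists>d0. \<forall>d. d \<ge> d0 \<and> d > 0 \<and> r \<le> min d l \<longrightarrow> generic_form n d (\<lambda>F. \<not> presentable n l r d F)"
    by (intro exI[of _ "l * n"]) (auto intro: generic_not_presentable_high_codim)
next
  fix n l r d :: nat
  assume asm: "n > 0 \<and> l > 0 \<and> r > 0 \<and> d > 0 \<and> r \<le> min d l \<and> l - r + 1 = n"
  define s where "s = r - 1"
  have r: "r = Suc s" and l: "l = n + s" and d: "Suc s \<le> d" and n: "0 < n"
    using asm by (auto simp: s_def)
  let ?G = "generic_form n d (\<lambda>F. presentable n l r d F)"
  have not_G: "\<not> ?G" if "generic_form n d (\<lambda>F. \<not> presentable n l r d F)"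
    using generic_form_not_both that by blast
  \<comment> \<open>For \<open>s = 3\<close> the hypothesis gives \<open>d \<ge> 4\<close>, so
    \<open>d = 4\<close> is the only value left besides \<open>d \<ge> 5\<close>. The last two cases
    are those with more than \<open>l * n\<close> points.\<close>
  consider "n = 1" | "n \<ge> 2" "s = 0" | "n \<ge> 2" "s = 1" | "n \<ge> 2" "s = 2" | "n = 2" "s = 3" "d \<ge> 5"
    | "n = 2" "s = 3" "d = 4" | "n = 2" "s \<ge> 4" | "n \<ge> 3" "s \<ge> 3"
    using n d by linarith
  then show "?G \<longleftrightarrow> (n, l, r, d) \<in>
             {(1, l, l, d) | l d. d \<ge> l \<and> l \<ge> 1} \<union>
             {(2, 2, 1, d) | d. d \<ge> 1} \<union>
             {(2, 3, 2, d) | d. d \<ge> 2} \<union>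
             {(2, 4, 3, d) | d. d \<ge> 3} \<union>
             {(2, 5, 4, d) | d. d \<ge> 5} \<union>
             {(n, n, 1, d) | n d. n \<ge> 3 \<and> d \<ge> 1} \<union>
             {(n, n + 1, 2, d) | n d. n \<ge> 3 \<and> d \<ge> 2} \<union>
             {(n, n + 2, 3, d) | n d. n \<ge> 3 \<and> d \<ge> 3}"
  proof cases
    case 1
    then have ?G using generic_presentable_n1[OF d] by (simp add: l r)
    then show ?thesis using 1 d by (simp add: l r)
  next
    case 2
    then have ?G using generic_presentable_r1[OF n] d by (simp add: l r)
    then show ?thesis using 2 d by (cases "n = 2") (auto simp: l r)
  next
    case 3
    then have ?G using generic_presentable_r2[OF n] d by (simp add: l r numeral_2_eq_2)
    then show ?thesis using 3 d by (cases "n = 2") (auto simp: l r)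
  next
    case 4
    then have ?G using generic_presentable_r3[OF n] d by (simp add: l r numeral_3_eq_3)
    then show ?thesis using 4 d by (cases "n = 2") (auto simp: l r)
  next
    case 5
    then have ?G using generic_presentable_2_5_4 by (simp add: l r)
    then show ?thesis using 5 d by (auto simp: l r)
  next
    case 6
    then have "\<not> ?G" using luroth_quartics_not_generic not_G by (simp add: l r)
    then show ?thesis using 6 by (auto simp: l r)
  next
    case 7
    then have "(n + s) * n < (n + s) choose n" using choose_gt_2[of "n + s"] by simp
    then have "\<not> ?G" using generic_not_presentable_points[OF n _ d] 7 not_G by (simp add: l r)
    then show ?thesis using 7 by (auto simp: l r)
  next
    case 8
    then have "(n + s) * n < (n + s) choose n" by (intro choose_gt) auto
    then have "\<not> ?G" using generic_not_presentable_points[OF n _ d] 8 not_G by (simp add: l r)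
    then show ?thesis using 8 by (auto simp: l r)
  qed
next
  fix n l r d :: nat and F
  assume "n > 0 \<and> l > 0 \<and> r > 0 \<and> d > 0 \<and> r \<le> min d l \<and> l - r + 1 > n" "F \<in> forms n d"
  then show "presentable n l r d F" by (intro every_form_presentable) auto
qed

end
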